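(* There exist an analytic map $\phi\colon \mathbb{D}\to\mathbb{D}$ and an Orlicz function $\Psi$ such that the composition operator $C_\phi\colon H^\Psi\to H^\Psi$, $C_\phi(f)=f\circ\phi$, is compact, whereas the composition operator $C_\phi\colon \mathfrak{B}^\Psi\to\mathfrak{B}^\Psi$ is not compact.
   Context: $\mathbb{D}=\{z\in\mathbb{C}: |z|<1\}$, $\mathbb{T}=\partial\mathbb{D}$, $\mathcal{A}$ is the normalized area measure $dx\,dy/\pi$ on $\mathbb{D}$, and $m$ is the normalized Lebesgue measure on $\mathbb{T}$. An Orlicz function is a nonnegative increasing convex function $\Psi\colon[0,\infty)\to[0,\infty)$ with $\Psi(0)=0$, $\Psi(x)>0$ for $x>0$, and $\Psi(x)\to\infty$ as $x\to\infty$. For a positive measure $\mu$, $L^\Psi(\mu)$ is the space of measurable $f$ with $\int\Psi(|f|/C)\,d\mu<\infty$ for some $C>0$, normed by $\|f\|_\Psi=\inf\{C>0:\int\Psi(|f|/C)\,d\mu\le 1\}$. The Bergman–Orlicz space $\mathfrak{B}^\Psi$ is the subspace of $L^\Psi(\mathbb{D},\mathcal{A})$ of functions analytic in $\mathbb{D}$. The Hardy–Orlicz space $H^\Psi$ is the space of $f$ in the Hardy space $H^1$ whose boundary values $f^*$ belong to $L^\Psi(\mathbb{T},m)$, normed by $\|f^*\|_{L^\Psi(m)}$. For every analytic $\phi\colon\mathbb{D}\to\mathbb{D}$, $C_\phi$ is bounded on both spaces; compact means it maps bounded sets to relatively compact sets. *)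

theory Defs
  imports "HOL-Analysis.Analysis"
begin

definition orlicz_function :: "(real \<Rightarrow> real) \<Rightarrow> bool" where
  "orlicz_function \<Psi> \<longleftrightarrow>
     (\<forall>x\<ge>0. \<Psi> x \<ge> 0) \<and> mono_on {0..} \<Psi> \<and> convex_on {0..} \<Psi> \<and> \<Psi> 0 = 0 \<and>
     (\<forall>x>0. \<Psi> x > 0) \<and> filterlim \<Psi> at_top at_top"

definition analytic_selfmap :: "(complex \<Rightarrow> complex) \<Rightarrow> bool" where
  "analytic_selfmap \<phi> \<longleftrightarrow> \<phi> holomorphic_on ball 0 1 \<and> \<phi> ` ball 0 1 \<subseteq> ball 0 1"

definition disc_modular :: "(real \<Rightarrow> real) \<Rightarrow> (complex \<Rightarrow> complex) \<Rightarrow> real \<Rightarrow> ennreal" where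
  "disc_modular \<Psi> f C =
     ennreal (1 / pi) * (\<integral>\<^sup>+ z \<in> ball 0 1. ennreal (\<Psi> (norm (f z) / C)) \<partial>lborel)"

definition circle_modular :: "(real \<Rightarrow> real) \<Rightarrow> (complex \<Rightarrow> complex) \<Rightarrow> real \<Rightarrow> ennreal" where
  "circle_modular \<Psi> g C =
     ennreal (1 / (2 * pi)) * (\<integral>\<^sup>+ t \<in> {0..2*pi}. ennreal (\<Psi> (norm (g (cis t)) / C)) \<partial>lborel)"

definition orlicz_norm :: "('f \<Rightarrow> real \<Rightarrow> ennreal) \<Rightarrow> 'f \<Rightarrow> real" where
  "orlicz_norm M f = Inf {C. C > 0 \<and> M f C \<le> 1}"

definition bergman_orlicz :: "(real \<Rightarrow> real) \<Rightarrow> (complex \<Rightarrow> complex) set" where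
  "bergman_orlicz \<Psi> = {f. f holomorphic_on ball 0 1 \<and> (\<exists>C>0. disc_modular \<Psi> f C < \<infinity>)}"

definition bergman_orlicz_norm :: "(real \<Rightarrow> real) \<Rightarrow> (complex \<Rightarrow> complex) \<Rightarrow> real" where
  "bergman_orlicz_norm \<Psi> f = orlicz_norm (disc_modular \<Psi>) f"

definition hardy1 :: "(complex \<Rightarrow> complex) set" where
  "hardy1 = {f. f holomorphic_on ball 0 1 \<and>
     (\<exists>B<\<infinity>. \<forall>r. 0 < r \<and> r < 1 \<longrightarrow>
        (\<integral>\<^sup>+ t \<in> {0..2*pi}. ennreal (norm (f (complex_of_real r * cis t))) \<partial>lborel) \<le> B)}"

text \<open>Boundary values (radial limits, existing a.e. for H^1 functions).\<close>
definition boundary :: "(complex \<Rightarrow> complex) \<Rightarrow> complex \<Rightarrow> complex" where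
  "boundary f w = Lim (at_left 1) (\<lambda>r::real. f (complex_of_real r * w))"

definition hardy_orlicz :: "(real \<Rightarrow> real) \<Rightarrow> (complex \<Rightarrow> complex) set" where
  "hardy_orlicz \<Psi> = {f \<in> hardy1. \<exists>C>0. circle_modular \<Psi> (boundary f) C < \<infinity>}"

definition hardy_orlicz_norm :: "(real \<Rightarrow> real) \<Rightarrow> (complex \<Rightarrow> complex) \<Rightarrow> real" where
  "hardy_orlicz_norm \<Psi> f = orlicz_norm (circle_modular \<Psi>) (boundary f)"

text \<open>Compact operator T on the normed function space (S, nrm): the image of every
  bounded sequence has a subsequence converging in norm to an element of S
  (equivalent to: images of bounded sets are relatively compact).\<close>
definition compact_comp_op ::
  "(complex \<Rightarrow> complex) set \<Rightarrow> ((complex \<Rightarrow> complex) \<Rightarrow> real) \<Rightarrow>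
   ((complex \<Rightarrow> complex) \<Rightarrow> (complex \<Rightarrow> complex)) \<Rightarrow> bool" where
  "compact_comp_op S nrm T \<longleftrightarrow>
     (\<forall>(F::nat \<Rightarrow> complex \<Rightarrow> complex) M. (\<forall>n. F n \<in> S \<and> nrm (F n) \<le> M) \<longrightarrow>
        (\<exists>r g. strict_mono r \<and> g \<in> S \<and>
           (\<lambda>k. nrm (\<lambda>z. T (F (r k)) z - g z)) \<longlonglongrightarrow> 0))"

end

theory Submission
  imports Defs "HOL-Complex_Analysis.Complex_Analysis"
begin

text \<open>
  Write \<open>P\<^sub>n = \<Psi>(y\<^sub>n)\<close> and \<open>Q\<^sub>n = \<Psi>(2y\<^sub>n)\<close> for a piecewise linear \<open>\<Psi>\<close> with knots \<open>y\<^sub>n = (n + 1)!\<close>, whose slopes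
  grow so fast that \<open>Q\<^sub>n \<ge> 4\<^sup>n\<^sup>+\<^sup>3 P\<^sub>n\<^sup>4\<close>, while \<open>P\<^sub>n\<^sub>+\<^sub>1 \<le> (n + 2) Q\<^sub>n\<close>. With
  \<open>\<delta>\<^sub>n = 8/Q\<^sub>n\<close> and \<open>\<ell>\<^sub>n = 2\<^sup>-\<^sup>n/P\<^sub>n\<^sub>+\<^sub>2\<close> take \<open>\<phi>(z) = 1 - \<Sum> \<delta>\<^sub>n (1 - z)/(1 - z + \<ell>\<^sub>n)\<close>, which touches
  the circle only at \<open>1\<close> and satisfies \<open>1 - |\<phi>(z)| \<ge> \<delta>\<^sub>n/4\<close> whenever \<open>|1 - z| \<ge> \<ell>\<^sub>n\<close>.

  On the Hardy side, \<open>\<Psi>(|f(z)|) \<le> 2/(1 - |z|)\<close> for \<open>f\<close> in the unit ball, so \<open>|f \<circ> \<phi>| \<le> 2y\<^sub>n\<close> where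
  \<open>|1 - z| \<ge> \<ell>\<^sub>n\<close>. Since \<open>\<Sum> \<ell>\<^sub>n \<Psi>(2A y\<^sub>n\<^sub>+\<^sub>1)\<close> converges for every \<open>A\<close>, all these functions have a common
  majorant, and compactness follows from Montel's theorem by dominated convergence.

  On the Bergman side, \<open>1 - \<phi>\<close> is at most \<open>3\<delta>\<^sub>n\<^sub>+\<^sub>1\<close> at the point \<open>1 - \<delta>\<^sub>n\<^sub>+\<^sub>1\<ell>\<^sub>n\<close>. Bounded test functions of
  height \<open>y\<^sub>n\<^sub>+\<^sub>2\<close> concentrated at distance \<open>3\<delta>\<^sub>n\<^sub>+\<^sub>1\<close> from \<open>1\<close> have images of norm at least \<open>1/32\<close>, because
  \<open>Q\<^sub>n\<^sub>+\<^sub>2\<close> exceeds \<open>(\<delta>\<^sub>n\<^sub>+\<^sub>1\<ell>\<^sub>n)\<^sup>-\<^sup>2\<close>; yet they tend to \<open>0\<close> pointwise.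

  The Hardy estimate needs the Poisson representation of \<open>H\<^sup>1\<close> functions by their radial limits. It is
  obtained by writing an \<open>H\<^sup>1\<close> function as a product of two \<open>H\<^sup>2\<close> functions, for which an \<open>L\<^sup>2\<close> maximal
  inequality yields both the almost everywhere existence of radial limits and a majorant.
\<close>

section \<open>The Poisson kernel\<close>

text \<open>Functions in the unit ball may have \<open>\<Psi>(|f|)\<close> of order
  \<open>1/(1 - |z|)\<close> in the Hardy case, but \<open>1/(1 - |z|)\<^sup>2\<close> in the
  Bergman case. At distance \<open>1/Q(n)\<close> from the circle the former keeps
  \<open>|f|\<close> of order \<open>y(n)\<close>, while the latter leaves room for
  \<open>y(n+1)\<close>, because \<open>P(n+1) \<le> (n+2) Q(n)\<close> is far below
  \<open>Q(n)\<^sup>2\<close>. The ratio \<open>y(n+1)/y(n) = n+2\<close> is unbounded for a reason: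
  norm convergence tests the modular of the common majorant at every dilation \<open>A\<close>, and
  a fixed \<open>A\<close> is eventually absorbed by one step of the sequence. Two demands on
  \<open>\<ell>(n)\<close> pull in opposite directions. It has to be small for the Hardy majorant,
  yet the point at depth \<open>\<delta>(n+1) \<ell>(n)\<close> must stay visible to the Bergman
  norm. Since \<open>Q(n+1) \<le> P(n+2)\<close>, the inverse square of that depth,
  \<open>(2^n Q(n+1) P(n+2) / 8)\<^sup>2\<close>, is at most \<open>4^n P(n+2)^4\<close>; this is
  the origin of the fourth power and of the powers of 4 in the growth imposed on
  \<open>\<Psi>\<close>.\<close>

definition circ :: "real measure" where
  "circ = density lborel (\<lambda>t. ennreal (1 / (2 * pi)) * indicator {0..2*pi} t)"

lemma sets_circ [measurable_cong, simp]: "sets circ = sets borel"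
  by (simp add: circ_def)

lemma space_circ [simp]: "space circ = UNIV"
  by (simp add: circ_def)

lemma nn_integral_circ:
  assumes [measurable]: "f \<in> borel_measurable borel"
  shows "(\<integral>\<^sup>+t. f t \<partial>circ) = ennreal (1 / (2 * pi)) * (\<integral>\<^sup>+t\<in>{0..2*pi}. f t \<partial>lborel)"
  unfolding circ_def
  by (subst nn_integral_density) (auto simp: nn_integral_cmult[symmetric] ac_simps)

lemma emeasure_circ: "emeasure circ UNIV = 1"
proof -
  have "emeasure circ UNIV = (\<integral>\<^sup>+t. 1 \<partial>circ)" by simp
  also have "\<dots> = 1"
    by (subst nn_integral_circ) (auto simp: ennreal_mult[symmetric] divide_simps)
  finally show ?thesis .
qed

interpretation circ: finite_measure circ
  by standard (simp add: emeasure_circ)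

lemma AE_circ_iff: "(AE t in circ. P t) \<longleftrightarrow> (AE t in lborel. t \<in> {0..2*pi} \<longrightarrow> P t)"
  unfolding circ_def by (subst AE_density) (auto simp: indicator_def elim!: eventually_mono)

lemma integral_circ:
  fixes f :: "real \<Rightarrow> complex"
  assumes "continuous_on UNIV f"
  shows "integrable circ f" "(\<integral>t. f t \<partial>circ) = integral {0..2*pi} f / (2 * pi)"
proof -
  have int: "set_integrable lborel {0..2*pi} f"
    unfolding set_integrable_def
    by (intro borel_integrable_compact) (auto intro: continuous_on_subset[OF assms])
  have circ': "circ = density lborel (\<lambda>t. ennreal (indicator {0..2*pi} t / (2 * pi)))"
    unfolding circ_def by (intro arg_cong[where f = "density lborel"]) (auto simp: indicator_def fun_eq_iff)
  have m [measurable]: "f \<in> borel_measurable borel"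
    using assms by (simp add: borel_measurable_continuous_onI)
  have *: "(indicator {0..2*pi} t / (2*pi)) *\<^sub>R f t = (1/(2*pi)) *\<^sub>R (indicator {0..2*pi} t *\<^sub>R f t)" for t
    by (auto simp: indicator_def)
  show "integrable circ f"
    unfolding circ' using int
    by (subst integrable_density) (simp_all only: * set_integrable_def integrable_scaleR_right, auto)
  have "(\<integral>t. f t \<partial>circ) = (\<integral>t. (indicator {0..2*pi} t / (2*pi)) *\<^sub>R f t \<partial>lborel)"
    unfolding circ' by (subst integral_density) auto
  also have "\<dots> = (\<integral>t. (1/(2*pi)) *\<^sub>R (indicator {0..2*pi} t *\<^sub>R f t) \<partial>lborel)"
    by (rule Bochner_Integration.integral_cong[OF refl *])
  also have "\<dots> = (1/(2*pi)) *\<^sub>R (LINT t:{0..2*pi}|lborel. f t)"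
    by (simp only: set_lebesgue_integral_def integral_scaleR_right)
  also have "(LINT t:{0..2*pi}|lborel. f t) = integral {0..2*pi} f"
    using int by (rule set_borel_integral_eq_integral)
  finally show "(\<integral>t. f t \<partial>circ) = integral {0..2*pi} f / (2 * pi)"
    by (simp add: scaleR_conv_of_real)
qed

lemma Cauchy_circ:
  assumes g: "g holomorphic_on ball 0 R" and R: "R > 1" and z: "norm z < 1"
  shows "(\<integral>t. g (cis t) * cis t / (cis t - z) \<partial>circ) = g z"
proof -
  have "((\<lambda>u. g u/(u-z)) has_contour_integral (2 * of_real pi * \<i> * g z)) (circlepath 0 1)"
    by (rule Cauchy_integral_circlepath_simple) (use R z in \<open>auto intro: holomorphic_on_subset[OF g]\<close>)
  then have "((\<lambda>t. g (cis t) / (cis t - z) * \<i> * cis t) has_integral (2 * of_real pi * \<i> * g z)) {0..2*pi}"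
    unfolding circlepath_def
    by (subst (asm) has_contour_integral_part_circlepath_iff) auto
  from has_integral_mult_right[OF this, of "-\<i>"]
  have "((\<lambda>t. g (cis t) * cis t / (cis t - z)) has_integral (2 * of_real pi * g z)) {0..2*pi}"
    by (simp add: field_simps)
  then have "integral {0..2*pi} (\<lambda>t. g (cis t) * cis t / (cis t - z)) = 2 * of_real pi * g z"
    by (rule integral_unique)
  moreover have "continuous_on UNIV (\<lambda>t. g (cis t) * cis t / (cis t - z))"
  proof (intro continuous_intros ballI)
    show "continuous_on UNIV (\<lambda>x. g (cis x))"
      by (rule continuous_on_compose2[OF holomorphic_on_imp_continuous_on[OF g]])
         (use R in \<open>auto intro!: continuous_intros\<close>)
    show "cis t - z \<noteq> 0" for t
      using z by (metis eq_iff_diff_eq_0 less_irrefl norm_cis)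
  qed
  ultimately show ?thesis
    by (subst integral_circ(2)) auto
qed

definition poisson :: "complex \<Rightarrow> real \<Rightarrow> real" where
  "poisson z t = (1 - (norm z)\<^sup>2) / (norm (cis t - z))\<^sup>2"

lemma poisson_nonneg: "norm z \<le> 1 \<Longrightarrow> poisson z t \<ge> 0"
  by (simp add: poisson_def power_le_one_iff abs_square_le_1)

lemma poisson_le:
  assumes "norm z < 1"
  shows "poisson z t \<le> 2 / (1 - norm z)"
proof -
  have "norm (cis t - z) \<ge> 1 - norm z"
    using norm_triangle_ineq2[of "cis t" z] by simp
  then have "(norm (cis t - z))\<^sup>2 \<ge> (1 - norm z)\<^sup>2"
    using assms by (intro power_mono) auto
  then have "poisson z t \<le> (1 - (norm z)\<^sup>2) / (1 - norm z)\<^sup>2"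
    unfolding poisson_def using assms
    by (intro divide_left_mono) (auto simp: abs_square_le_1 intro!: mult_pos_pos)
  also have "\<dots> = (1 + norm z) / (1 - norm z)"
  proof -
    have "1 - (norm z)\<^sup>2 = (1 + norm z) * (1 - norm z)"
      by (simp add: power2_eq_square algebra_simps)
    then show ?thesis using assms by (simp add: power2_eq_square)
  qed
  also have "\<dots> \<le> 2 / (1 - norm z)"
    using assms by (intro divide_right_mono) auto
  finally show ?thesis .
qed

lemma continuous_poisson [continuous_intros]: "norm z < 1 \<Longrightarrow> continuous_on A (poisson z)"
  unfolding poisson_def
  by (intro continuous_intros ballI) (metis eq_iff_diff_eq_0 less_irrefl norm_cis norm_eq_zero power_not_zero)

text \<open>Cauchy's formula is applied to \<open>f\<close> times
  \<open>(1 - |z|\<^sup>2) / (1 - cnj z * w)\<close>: this factor is 1 at \<open>w = z\<close>, and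
  on the circle it turns the Cauchy kernel into the Poisson kernel. Its pole
  \<open>1 / cnj z\<close> lies outside the closed disc, which is why the radius is cut down to
  \<open>R'\<close>.\<close>

lemma poisson_formula:
  assumes f: "f holomorphic_on ball 0 R" and R: "R > 1" and z: "norm z < 1"
  shows "(\<integral>t. f (cis t) * of_real (poisson z t) \<partial>circ) = f z"
proof -
  define R' where "R' = (if z = 0 then R else min R (1 / norm z))"
  have R': "R' > 1" "R' \<le> R"
    using R z by (auto simp: R'_def)
  have nz: "1 - cnj z * w \<noteq> 0" if "norm w < R'" for w
  proof (cases "z = 0")
    case False
    then have "norm w < 1 / norm z" using that by (auto simp: R'_def)
    then have "norm (cnj z * w) < 1" using False by (simp add: norm_mult field_simps)
    then show ?thesis by auto
  qed auto
  define g where "g = (\<lambda>w. f w * of_real (1 - (norm z)\<^sup>2) / (1 - cnj z * w))"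
  have "g holomorphic_on ball 0 R'"
    unfolding g_def using nz R' by (intro holomorphic_intros holomorphic_on_subset[OF f]) auto
  from Cauchy_circ[OF this R'(1) z]
  have "(\<integral>t. g (cis t) * cis t / (cis t - z) \<partial>circ) = g z" .
  moreover have "g z = f z"
  proof -
    have "complex_of_real (1 - (norm z)\<^sup>2) = 1 - cnj z * z"
      by (simp only: of_real_diff complex_norm_square) (simp add: mult.commute)
    then show ?thesis
      using z nz[of z] R' by (simp add: g_def)
  qed
  moreover have "g (cis t) * cis t / (cis t - z) = f (cis t) * of_real (poisson z t)" for t
  proof -
    have "1 - cnj z * cis t = cis t * cnj (cis t - z)"
      by (simp add: algebra_simps cis_cnj cis_mult)
    moreover have "of_real ((norm (cis t - z))\<^sup>2) = (cis t - z) * cnj (cis t - z)"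
      by (rule complex_norm_square)
    moreover have "cis t \<noteq> 0" by simp
    ultimately show ?thesis
      by (simp add: g_def poisson_def mult_ac)
  qed
  ultimately show ?thesis by simp
qed

lemma integral_poisson: "norm z < 1 \<Longrightarrow> (\<integral>t. poisson z t \<partial>circ) = 1"
proof -
  assume z: "norm z < 1"
  have "complex_of_real (\<integral>t. poisson z t \<partial>circ) = (\<integral>t. of_real (poisson z t) \<partial>circ)"
    by simp
  also have "\<dots> = 1"
    using poisson_formula[of "\<lambda>_. 1" 2 z] z by simp
  finally show ?thesis by simp
qed

text \<open>The semigroup property of the kernel: on the circle \<open>poisson w\<close> is the real
  part of \<open>H\<close>, which is holomorphic past the closed disc, so integration against
  \<open>poisson z\<close> returns \<open>Re (H z)\<close>, a Poisson kernel at radius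
  \<open>norm w * norm z\<close>. Going back to radius \<open>norm z\<close> costs a factor 2 in the
  numerator, where \<open>norm z \<le> norm w\<close> enters, and a factor 4 in the squared
  denominator.\<close>

lemma poisson_poisson:
  assumes z: "norm z < 1" and w: "norm w < 1" and z0: "norm z \<le> norm w" and ws: "w = of_real (norm w) * cis s"
  shows "(\<integral>t. poisson z t * poisson w t \<partial>circ) \<le> 8 * poisson z s"
proof -
  define R where "R = (if w = 0 then 2 else 1 / norm w)"
  have R: "R > 1" using w by (auto simp: R_def)
  have nz: "1 - cnj w * u \<noteq> 0" if "norm u < R" for u
  proof (cases "w = 0")
    case False
    then have "norm u < 1 / norm w" using that by (auto simp: R_def)
    then have "norm (cnj w * u) < 1" using False by (simp add: norm_mult field_simps)
    then show ?thesis by auto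
  qed auto
  define H where "H = (\<lambda>u. (1 + cnj w * u) / (1 - cnj w * u))"
  have H: "H holomorphic_on ball 0 R"
    unfolding H_def using nz by (intro holomorphic_intros) auto
  have ReH: "Re (H u) = (1 - (norm (cnj w * u))\<^sup>2) / (norm (1 - cnj w * u))\<^sup>2" for u
  proof -
    have "Re ((1 + v) / (1 - v)) = (1 - (norm v)\<^sup>2) / (norm (1 - v))\<^sup>2" for v :: complex
      unfolding Re_divide cmod_power2 by (simp add: power2_eq_square algebra_simps)
    then show ?thesis by (simp add: H_def)
  qed
  have ReH1: "Re (H (cis t)) = poisson w t" for t
  proof -
    have "1 - cnj w * cis t = cis t * cnj (cis t - w)"
      by (simp add: algebra_simps cis_cnj cis_mult)
    then have "norm (1 - cnj w * cis t) = norm (cis t - w)"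
      by (simp only: norm_mult complex_mod_cnj) simp
    then show ?thesis by (simp add: ReH poisson_def norm_mult)
  qed
  have cH: "continuous_on UNIV (\<lambda>t. H (cis t))"
    by (rule continuous_on_compose2[OF holomorphic_on_imp_continuous_on[OF H]])
         (use R in \<open>auto intro!: continuous_intros\<close>)
  have "Re (\<integral>t. H (cis t) * of_real (poisson z t) \<partial>circ) = (\<integral>t. Re (H (cis t) * of_real (poisson z t)) \<partial>circ)"
    by (intro integral_Re[symmetric] integral_circ(1) continuous_intros cH z)
  then have "(\<integral>t. poisson z t * poisson w t \<partial>circ) = Re (H z)"
    using poisson_formula[OF H R z] by (simp add: ReH1 mult.commute)
  also have "\<dots> \<le> 8 * poisson z s"
  proof -
    define r where "r = norm w"
    define v where "v = z * cis (- s)"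
    have v: "norm v = norm z" by (simp add: v_def norm_mult)
    have 1: "norm (1 - cnj w * z) = norm (1 - of_real r * v)"
      by (subst ws) (simp add: v_def r_def cis_cnj mult_ac)
    have "cis s - z = cis s * (1 - v)" by (simp add: v_def algebra_simps cis_mult)
    then have 2: "norm (cis s - z) = norm (1 - v)" by (simp add: norm_mult)
    have r: "0 \<le> r" "r < 1" "norm v \<le> r" using w z0 by (auto simp: r_def v)
    have "norm (1 - v) = norm ((1 - of_real r * v) - of_real (1 - r) * v)"
      by (simp add: algebra_simps)
    also have "\<dots> \<le> norm (1 - of_real r * v) + norm (of_real (1 - r) * v)"
      by (rule norm_triangle_ineq4)
    also have "norm (of_real (1 - r) * v) = (1 - r) * norm v"
      using r by (simp only: norm_mult norm_of_real)
    also have "\<dots> \<le> 1 - r * norm v"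
      using r mult_left_mono[of "norm v" 1 "1"] by (simp add: algebra_simps)
    also have "\<dots> \<le> norm (1 - of_real r * v)"
      using norm_triangle_ineq2[of 1 "of_real r * v"] r by (simp add: norm_mult)
    finally have 3: "norm (1 - v) \<le> 2 * norm (1 - of_real r * v)" by simp
    have nv: "norm v < 1" using z v by simp
    then have pos: "norm (1 - v) > 0" by auto
    have "(norm z)\<^sup>2 * (norm z)\<^sup>2 \<le> (r)\<^sup>2 * (norm z)\<^sup>2"
      using z0 by (intro mult_right_mono power_mono) (auto simp: r_def)
    moreover have "0 \<le> (1 - (norm z)\<^sup>2)\<^sup>2" by simp
    ultimately have 4: "1 - (r * norm z)\<^sup>2 \<le> 2 * (1 - (norm z)\<^sup>2)"
      by (simp add: power2_eq_square algebra_simps)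
    have 5: "(norm (1 - v))\<^sup>2 \<le> 4 * (norm (1 - of_real r * v))\<^sup>2"
      using power_mono[OF 3, of 2] by (simp add: power_mult_distrib)
    have "Re (H z) = (1 - (r * norm z)\<^sup>2) / (norm (1 - of_real r * v))\<^sup>2"
      by (simp add: ReH 1 norm_mult r_def)
    also have "\<dots> \<le> (2 * (1 - (norm z)\<^sup>2)) / ((norm (1 - v))\<^sup>2 / 4)"
      using 4 5 pos z by (intro frac_le) (auto simp: abs_square_le_1)
    also have "\<dots> = 8 * poisson z s"
      by (simp add: poisson_def 2)
    finally show ?thesis .
  qed
  finally show ?thesis .
qed

section \<open>The maximal inequality\<close>

lemma borel_measurable_cis [measurable]: "cis \<in> borel_measurable borel"
  by (intro borel_measurable_continuous_onI continuous_intros)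

lemma integrable_circ_bounded:
  fixes f :: "real \<Rightarrow> 'a :: {banach, second_countable_topology}"
  assumes [measurable]: "f \<in> borel_measurable borel" and "\<And>t. norm (f t) \<le> B"
  shows "integrable circ f"
  by (rule circ.integrable_const_bound[of _ B]) (use assms in auto)

lemma measurable_poisson [measurable]:
  assumes [measurable]: "f \<in> borel_measurable M" "g \<in> borel_measurable M"
  shows "(\<lambda>x. poisson (f x) (g x)) \<in> borel_measurable M"
  unfolding poisson_def by measurable

lemma nn_integral_poisson:
  assumes z: "norm z < 1"
  shows "(\<integral>\<^sup>+t. ennreal (poisson z t) \<partial>circ) = 1"
proof -
  have pz: "0 \<le> poisson z t" "poisson z t \<le> 2 / (1 - norm z)" for t
    using poisson_le[OF z] z by (auto intro: poisson_nonneg)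
  then have "integrable circ (poisson z)"
    by (intro integrable_circ_bounded[where B = "2 / (1 - norm z)"] borel_measurable_continuous_onI continuous_intros z) simp
  then show ?thesis
    using integral_poisson[OF z] pz by (subst nn_integral_eq_integral) auto
qed

text \<open>The sum on the right removes the question which radius is smaller. This matters below,
  where the radii are functions of the angles \<open>t\<close> and \<open>s\<close>.\<close>

lemma nn_poisson_poisson:
  assumes r: "0 \<le> r" "r < 1" and r': "0 \<le> r'" "r' < 1"
  shows "(\<integral>\<^sup>+\<theta>. ennreal (poisson (of_real r * cis t) \<theta>) * ennreal (poisson (of_real r' * cis s) \<theta>) \<partial>circ)
           \<le> 8 * (ennreal (poisson (of_real r * cis t) s) + ennreal (poisson (of_real r' * cis s) t))"
proof -
  let ?P = "\<lambda>\<theta>. poisson (of_real r * cis t) \<theta>" and ?P' = "\<lambda>\<theta>. poisson (of_real r' * cis s) \<theta>"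
  have nr: "norm (of_real r * cis t) = r" "norm (of_real r' * cis s) = r'"
    using r r' by (auto simp: norm_mult)
  have P: "?P \<theta> \<ge> 0" "?P' \<theta> \<ge> 0" "?P \<theta> \<le> 2 / (1 - r)" "?P' \<theta> \<le> 2 / (1 - r')" for \<theta>
    using poisson_le[of "of_real r * cis t" \<theta>] poisson_le[of "of_real r' * cis s" \<theta>] nr r r'
    by (auto intro!: poisson_nonneg simp: nr)
  have "\<bar>?P \<theta> * ?P' \<theta>\<bar> \<le> (2 / (1 - r)) * (2 / (1 - r'))" for \<theta>
  proof -
    have "?P \<theta> * ?P' \<theta> \<le> (2 / (1 - r)) * (2 / (1 - r'))"
      by (rule mult_mono) (use P r in auto)
    then show ?thesis using P by (simp add: abs_mult)
  qed
  then have int: "integrable circ (\<lambda>\<theta>. ?P \<theta> * ?P' \<theta>)"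
    by (intro integrable_circ_bounded[of _ "(2 / (1 - r)) * (2 / (1 - r'))"]) auto
  have "(\<integral>\<^sup>+\<theta>. ennreal (?P \<theta>) * ennreal (?P' \<theta>) \<partial>circ) = (\<integral>\<^sup>+\<theta>. ennreal (?P \<theta> * ?P' \<theta>) \<partial>circ)"
    using P by (simp add: ennreal_mult)
  also have "\<dots> = ennreal (\<integral>\<theta>. ?P \<theta> * ?P' \<theta> \<partial>circ)"
    using int P by (intro nn_integral_eq_integral) auto
  also have "(\<integral>\<theta>. ?P \<theta> * ?P' \<theta> \<partial>circ) \<le> 8 * (?P s + ?P' t)"
  proof (cases "r \<le> r'")
    case True
    have "(\<integral>\<theta>. ?P \<theta> * ?P' \<theta> \<partial>circ) \<le> 8 * ?P s"
      by (rule poisson_poisson) (use nr r r' True in auto)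
    then show ?thesis using P(2)[of t] by (simp add: algebra_simps)
  next
    case False
    have "(\<integral>\<theta>. ?P' \<theta> * ?P \<theta> \<partial>circ) \<le> 8 * ?P' t"
      by (rule poisson_poisson) (use nr r r' False in auto)
    then show ?thesis using P(1)[of s] by (simp add: algebra_simps mult.commute)
  qed
  finally show ?thesis
    using P by (simp add: ennreal_mult ennreal_leI)
qed

text \<open>Division by \<open>a\<close>, which fails for \<open>a = \<infinity>\<close>. Absorption
  arguments that use it must therefore know in advance that their integrals are finite.\<close>

lemma ennreal_sq_le_cancel:
  fixes a b :: ennreal
  assumes "a\<^sup>2 \<le> b * a" "a < \<infinity>"
  shows "a \<le> b"
proof (cases "a = 0")
  case False
  with assms show ?thesis
    by (cases a; cases b) (auto simp: power2_eq_square ennreal_mult[symmetric] ennreal_mult_top top_unique)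
qed auto

text \<open>
  \<open>\<rho>\<close> linearises the radial maximal function. This is a \<open>T T\<^sup>*\<close> argument: \<open>S = T\<^sup>* w\<close>, and the semigroup
  inequality bounds the kernel of \<open>T T\<^sup>*\<close> by that of \<open>T + T\<^sup>*\<close>.
\<close>
lemma poisson_maximal:
  fixes g :: "real \<Rightarrow> ennreal"
  assumes [measurable]: "g \<in> borel_measurable borel" "\<rho> \<in> borel_measurable borel"
    and \<rho>: "\<And>t. 0 \<le> \<rho> t" "\<And>t. \<rho> t \<le> R" and R: "R < 1"
  shows "(\<integral>\<^sup>+t. (\<integral>\<^sup>+\<theta>. ennreal (poisson (of_real (\<rho> t) * cis t) \<theta>) * g \<theta> \<partial>circ)\<^sup>2 \<partial>circ)
           \<le> 256 * (\<integral>\<^sup>+\<theta>. (g \<theta>)\<^sup>2 \<partial>circ)"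
proof (cases "(\<integral>\<^sup>+\<theta>. (g \<theta>)\<^sup>2 \<partial>circ) = \<infinity>")
  case True
  then show ?thesis by (simp add: ennreal_mult_top)
next
  case False
  interpret pair_sigma_finite circ circ
    by standard
  define K where "K t \<theta> = ennreal (poisson (of_real (\<rho> t) * cis t) \<theta>)" for t \<theta>
  have [measurable]: "case_prod K \<in> borel_measurable (circ \<Otimes>\<^sub>M circ)"
    unfolding K_def by measurable
  have Km [measurable]: "(\<lambda>x. K (f x) (h x)) \<in> borel_measurable M"
    if [measurable]: "f \<in> borel_measurable M" "h \<in> borel_measurable M" for f h and M :: "'b measure"
    unfolding K_def by measurable
  define c where "c = ennreal (2 / (1 - R))"
  have K: "K t \<theta> \<le> c" for t \<theta>
  proof -
    have n: "norm (of_real (\<rho> t) * cis t) = \<rho> t" using \<rho> by (auto simp: norm_mult)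
    have "poisson (of_real (\<rho> t) * cis t) \<theta> \<le> 2 / (1 - \<rho> t)"
      using poisson_le[of "of_real (\<rho> t) * cis t" \<theta>] \<rho>(2)[of t] R by (simp add: n)
    also have "\<dots> \<le> 2 / (1 - R)"
      using \<rho>(2)[of t] R by (intro divide_left_mono) auto
    finally show ?thesis by (auto simp: K_def c_def intro!: ennreal_leI)
  qed
  have KK: "(\<integral>\<^sup>+\<theta>. K t \<theta> * K s \<theta> \<partial>circ) \<le> 8 * (K t s + K s t)" for s t
    unfolding K_def using \<rho> R by (intro nn_poisson_poisson) (auto intro: le_less_trans)
  define \<Gamma> where "\<Gamma> = (\<integral>\<^sup>+\<theta>. (g \<theta>)\<^sup>2 \<partial>circ)"
  define w where "w t = (\<integral>\<^sup>+\<theta>. K t \<theta> * g \<theta> \<partial>circ)" for t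
  have [measurable]: "w \<in> borel_measurable borel"
    unfolding w_def by measurable
  define W where "W = (\<integral>\<^sup>+t. (w t)\<^sup>2 \<partial>circ)"
  define S where "S \<theta> = (\<integral>\<^sup>+t. K t \<theta> * w t \<partial>circ)" for \<theta>
  have [measurable]: "S \<in> borel_measurable borel"
    unfolding S_def by measurable
  define A where "A = (\<integral>\<^sup>+\<theta>. (S \<theta>)\<^sup>2 \<partial>circ)"
  \<comment> \<open>A crude bound whose constant \<open>c\<close> blows up as \<open>R\<close> tends
    to 1. It serves only to make \<open>W\<close> and \<open>A\<close> finite, so that both can be
    cancelled; \<open>c\<close> does not reach the conclusion.\<close>
  have bd: "(\<integral>\<^sup>+x. (\<integral>\<^sup>+y. k x y * f y \<partial>circ)\<^sup>2 \<partial>circ) \<le> c\<^sup>2 * (\<integral>\<^sup>+y. (f y)\<^sup>2 \<partial>circ)"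
    if k: "\<And>x y. k x y \<le> c" and [measurable]: "f \<in> borel_measurable borel" for k f
  proof -
    have "(\<integral>\<^sup>+y. k x y * f y \<partial>circ)\<^sup>2 \<le> c\<^sup>2 * (\<integral>\<^sup>+y. (f y)\<^sup>2 \<partial>circ)" for x
    proof -
      have "(\<integral>\<^sup>+y. k x y * f y \<partial>circ) \<le> (\<integral>\<^sup>+y. c * f y \<partial>circ)"
        by (intro nn_integral_mono mult_right_mono k) auto
      then have "(\<integral>\<^sup>+y. k x y * f y \<partial>circ)\<^sup>2 \<le> (\<integral>\<^sup>+y. c * f y \<partial>circ)\<^sup>2"
        by (intro power_mono) auto
      also have "\<dots> \<le> (\<integral>\<^sup>+y. c\<^sup>2 \<partial>circ) * (\<integral>\<^sup>+y. (f y)\<^sup>2 \<partial>circ)"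
        by (rule Cauchy_Schwarz_nn_integral) auto
      finally show ?thesis by (simp add: emeasure_circ)
    qed
    then have "(\<integral>\<^sup>+x. (\<integral>\<^sup>+y. k x y * f y \<partial>circ)\<^sup>2 \<partial>circ) \<le> (\<integral>\<^sup>+x. c\<^sup>2 * (\<integral>\<^sup>+y. (f y)\<^sup>2 \<partial>circ) \<partial>circ)"
      by (intro nn_integral_mono)
    then show ?thesis by (simp add: emeasure_circ)
  qed
  have cfin: "c\<^sup>2 < \<infinity>" by (simp add: c_def power2_eq_square ennreal_mult_less_top)
  have Wfin: "W < \<infinity>"
  proof -
    have "W \<le> c\<^sup>2 * \<Gamma>"
      using bd[of K g] K unfolding W_def w_def \<Gamma>_def by auto
    also have "\<dots> < \<infinity>"
      using cfin False by (simp add: ennreal_mult_less_top \<Gamma>_def less_top)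
    finally show ?thesis .
  qed
  have Afin: "A < \<infinity>"
  proof -
    have "A \<le> c\<^sup>2 * W"
      using bd[of "\<lambda>x y. K y x" w] K unfolding A_def S_def W_def by auto
    also have "\<dots> < \<infinity>"
      using cfin Wfin by (simp add: ennreal_mult_less_top)
    finally show ?thesis .
  qed
  have "W = (\<integral>\<^sup>+t. (\<integral>\<^sup>+\<theta>. w t * K t \<theta> * g \<theta> \<partial>circ) \<partial>circ)"
    unfolding W_def by (intro nn_integral_cong) (simp add: power2_eq_square w_def nn_integral_cmult[symmetric] mult_ac)
  also have "\<dots> = (\<integral>\<^sup>+\<theta>. (\<integral>\<^sup>+t. w t * K t \<theta> * g \<theta> \<partial>circ) \<partial>circ)"
    by (intro Fubini') simp
  also have "\<dots> = (\<integral>\<^sup>+\<theta>. S \<theta> * g \<theta> \<partial>circ)"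
    by (intro nn_integral_cong) (simp add: S_def nn_integral_cmult[symmetric] mult_ac)
  finally have "W\<^sup>2 \<le> A * \<Gamma>"
    unfolding A_def \<Gamma>_def by (simp add: Cauchy_Schwarz_nn_integral)
  \<comment> \<open>Expanding the square of \<open>S\<close> brings two copies of the kernel
    together under the inner integral, where \<open>KK\<close> applies. Both resulting terms equal
    the pairing of \<open>w\<close> with \<open>S\<close>, and Cauchy-Schwarz bounds its square by
    \<open>W * A\<close>.\<close>
  have "A = (\<integral>\<^sup>+\<theta>. (\<integral>\<^sup>+t. (\<integral>\<^sup>+s. w t * w s * (K t \<theta> * K s \<theta>) \<partial>circ) \<partial>circ) \<partial>circ)"
    unfolding A_def
    by (intro nn_integral_cong) (simp add: power2_eq_square S_def nn_integral_multc[symmetric] nn_integral_cmult[symmetric] mult_ac)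
  also have "\<dots> = (\<integral>\<^sup>+t. (\<integral>\<^sup>+\<theta>. (\<integral>\<^sup>+s. w t * w s * (K t \<theta> * K s \<theta>) \<partial>circ) \<partial>circ) \<partial>circ)"
    by (intro Fubini') simp
  also have "\<dots> = (\<integral>\<^sup>+t. (\<integral>\<^sup>+s. (\<integral>\<^sup>+\<theta>. w t * w s * (K t \<theta> * K s \<theta>) \<partial>circ) \<partial>circ) \<partial>circ)"
    by (intro nn_integral_cong Fubini') simp
  also have "\<dots> \<le> (\<integral>\<^sup>+t. (\<integral>\<^sup>+s. w t * w s * (8 * (K t s + K s t)) \<partial>circ) \<partial>circ)"
    by (intro nn_integral_mono) (auto simp: nn_integral_cmult simp del: distrib_left_numeral intro!: mult_left_mono KK)
  also have "\<dots> = 8 * (\<integral>\<^sup>+t. (\<integral>\<^sup>+s. w t * w s * K t s \<partial>circ) \<partial>circ) + 8 * (\<integral>\<^sup>+t. (\<integral>\<^sup>+s. w t * w s * K s t \<partial>circ) \<partial>circ)"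
    by (simp add: distrib_left nn_integral_add nn_integral_cmult[symmetric] mult_ac)
  also have "(\<integral>\<^sup>+t. (\<integral>\<^sup>+s. w t * w s * K s t \<partial>circ) \<partial>circ) = (\<integral>\<^sup>+t. w t * S t \<partial>circ)"
    by (intro nn_integral_cong) (simp add: S_def nn_integral_cmult[symmetric] mult_ac)
  also have "(\<integral>\<^sup>+t. (\<integral>\<^sup>+s. w t * w s * K t s \<partial>circ) \<partial>circ) = (\<integral>\<^sup>+s. (\<integral>\<^sup>+t. w t * w s * K t s \<partial>circ) \<partial>circ)"
    by (intro Fubini') simp
  also have "\<dots> = (\<integral>\<^sup>+t. w t * S t \<partial>circ)"
    by (intro nn_integral_cong) (simp add: S_def nn_integral_cmult[symmetric] mult_ac)
  also have "8 * \<dots> + 8 * \<dots> = 16 * (\<integral>\<^sup>+t. w t * S t \<partial>circ)"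
    by (simp flip: distrib_right)
  finally have "A\<^sup>2 \<le> (16 * (\<integral>\<^sup>+t. w t * S t \<partial>circ))\<^sup>2"
    by (intro power_mono) auto
  also have "\<dots> \<le> 256 * (W * A)"
    unfolding power_mult_distrib W_def A_def
    by (simp add: mult_left_mono Cauchy_Schwarz_nn_integral)
  finally have "A\<^sup>2 \<le> 256 * W * A"
    by (simp only: mult.assoc)
  then have "A \<le> 256 * W"
    by (rule ennreal_sq_le_cancel) (rule Afin)
  then have "A * \<Gamma> \<le> 256 * W * \<Gamma>"
    by (intro mult_right_mono) auto
  with \<open>W\<^sup>2 \<le> A * \<Gamma>\<close> have "W\<^sup>2 \<le> 256 * \<Gamma> * W"
    by (simp only: mult.assoc mult.commute[of W])
  then have "W \<le> 256 * \<Gamma>"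
    by (rule ennreal_sq_le_cancel) (rule Wfin)
  then show ?thesis by (simp add: W_def w_def K_def \<Gamma>_def)
qed

section \<open>Radial limits in the Hardy space of exponent two\<close>

lemma mean_value_circ:
  assumes "f holomorphic_on ball 0 R" "R > 1"
  shows "(\<integral>t. f (cis t) \<partial>circ) = f 0"
  using poisson_formula[OF assms, of 0] by (simp add: poisson_def)

lemma holomorphic_dilation:
  assumes "g holomorphic_on ball 0 1" "s > 0"
  shows "(\<lambda>z. g (of_real s * z)) holomorphic_on ball 0 (1 / s)"
  by (intro holomorphic_intros holomorphic_on_compose_gen[OF _ assms(1), unfolded o_def])
     (use assms(2) in \<open>auto simp: norm_mult field_simps\<close>)

lemma norm_of_real_mult_less_1: "0 \<le> r \<Longrightarrow> r \<le> 1 \<Longrightarrow> norm z < 1 \<Longrightarrow> norm (complex_of_real r * z) < 1"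
  by (simp add: norm_mult) (meson le_less_trans mult_left_le_one_le norm_ge_zero)

text \<open>Induction on \<open>N\<close>: on the circle, the cross term of the new monomial with
  the earlier ones is a polynomial \<open>q\<close> in \<open>cis t\<close> without constant term,
  so its mean is \<open>q 0 = 0\<close>.\<close>

lemma parseval_finite:
  "(\<integral>t. (norm (\<Sum>n<N. c n * cis t ^ n))\<^sup>2 \<partial>circ) = (\<Sum>n<N. (norm (c n :: complex))\<^sup>2)"
proof (induction N)
  case (Suc N)
  define p where "p = (\<lambda>t. \<Sum>n<N. c n * cis t ^ n)"
  define q where "q = (\<lambda>w::complex. \<Sum>n<N. cnj (c n) * c N * w ^ (N - n))"
  have cp [continuous_intros]: "continuous_on A p" for A
    unfolding p_def by (intro continuous_intros)
  have cq [continuous_intros]: "continuous_on A (\<lambda>t. q (cis t))" for A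
    unfolding q_def by (intro continuous_intros)
  have q: "cnj (p t) * (c N * cis t ^ N) = q (cis t)" for t
  proof -
    have "cnj (cis t ^ n) * cis t ^ N = cis t ^ (N - n)" if "n < N" for n
    proof -
      have "cis t ^ N = cis t ^ n * cis t ^ (N - n)"
        using that by (simp flip: power_add)
      moreover have "cnj (cis t ^ n) * cis t ^ n = 1"
        by (simp add: power_mult_distrib[symmetric] cis_cnj cis_mult)
      ultimately show ?thesis by (simp add: mult.assoc[symmetric])
    qed
    then have "cnj (c n * cis t ^ n) * (c N * cis t ^ N) = cnj (c n) * c N * cis t ^ (N - n)" if "n < N" for n
      using that by (simp add: mult_ac)
    then show ?thesis
      unfolding p_def q_def cnj_sum sum_distrib_right by (intro sum.cong refl) auto
  qed
  have "(norm (p t + c N * cis t ^ N))\<^sup>2 = (norm (p t))\<^sup>2 + (norm (c N))\<^sup>2 + 2 * Re (q (cis t))" for t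
  proof -
    have "(norm (a + b))\<^sup>2 = (norm a)\<^sup>2 + (norm b)\<^sup>2 + 2 * Re (cnj a * b)" for a b :: complex
      unfolding cmod_power2 by (simp add: power2_eq_square algebra_simps)
    from this[of "p t" "c N * cis t ^ N"] show ?thesis
      unfolding q by (simp add: norm_mult norm_power)
  qed
  moreover have bp: "norm (p t) \<le> (\<Sum>n<N. norm (c n))" for t
    unfolding p_def by (rule order.trans[OF norm_sum]) (simp add: norm_mult norm_power)
  have "integrable circ (\<lambda>t. (norm (p t))\<^sup>2)"
    by (intro integrable_circ_bounded[of _ "(\<Sum>n<N. norm (c n))\<^sup>2"] borel_measurable_continuous_onI continuous_intros)
       (auto intro!: power_mono bp)
  moreover have iq: "integrable circ (\<lambda>t. q (cis t))"
    by (intro integral_circ(1) continuous_intros)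
  moreover have "(\<integral>t. Re (q (cis t)) \<partial>circ) = 0"
  proof -
    have "(\<integral>t. q (cis t) \<partial>circ) = q 0"
      by (rule mean_value_circ[where R = 2]) (auto simp: q_def intro!: holomorphic_intros)
    also have "\<dots> = 0" unfolding q_def by (intro sum.neutral ballI) (auto simp: zero_power)
    finally show ?thesis using iq by simp
  qed
  moreover have "(\<Sum>n<N. c n * cis t ^ n) = p t" for t
    by (simp add: p_def)
  ultimately show ?case
    using Suc.IH by (simp add: measure_def emeasure_circ)
qed auto

lemma parseval_circ:
  assumes f: "\<And>z. norm z < 1 \<Longrightarrow> (\<lambda>n. a n * z ^ n) sums f z" and s: "0 \<le> s" "s < 1"
  shows "(\<lambda>n. (norm (a n) * s ^ n)\<^sup>2) sums (\<integral>t. (norm (f (of_real s * cis t)))\<^sup>2 \<partial>circ)" (is ?P)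
    and "(\<integral>\<^sup>+t. ennreal ((norm (f (of_real s * cis t)))\<^sup>2) \<partial>circ) = ennreal (\<Sum>n. (norm (a n) * s ^ n)\<^sup>2)" (is ?Q)
proof -
  define c where "c n = a n * of_real s ^ n" for n
  have c: "(\<lambda>n. c n * cis t ^ n) sums f (of_real s * cis t)" for t
    using f[of "of_real s * cis t"] s by (simp add: norm_mult c_def power_mult_distrib mult_ac)
  obtain s' where s': "s < s'" "s' < 1" using dense[OF s(2)] by auto
  have "summable (\<lambda>n. a n * of_real s' ^ n)"
    using f[of "of_real s'"] s s' by (auto simp: sums_iff)
  then have sm: "summable (\<lambda>n. norm (c n))"
    unfolding c_def by (rule powser_insidea) (use s s' in auto)
  define p where "p N t = (\<Sum>n<N. c n * cis t ^ n)" for N t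
  have p: "(\<lambda>N. p N t) \<longlonglongrightarrow> f (of_real s * cis t)" for t
    using c[of t] by (simp add: sums_def p_def)
  have [measurable]: "p N \<in> borel_measurable borel" for N
    unfolding p_def by (intro borel_measurable_continuous_onI continuous_intros)
  have fm [measurable]: "(\<lambda>t. f (of_real s * cis t)) \<in> borel_measurable borel"
    by (rule borel_measurable_LIMSEQ_metric[OF _ p]) auto
  have bp: "norm (p N t) \<le> (\<Sum>n. norm (c n))" for N t
  proof -
    have "norm (p N t) \<le> (\<Sum>n<N. norm (c n))"
      unfolding p_def by (rule order.trans[OF norm_sum]) (simp add: norm_mult norm_power)
    also have "\<dots> \<le> (\<Sum>n. norm (c n))"
      by (rule sum_le_suminf[OF sm]) auto
    finally show ?thesis .
  qed
  have "(\<lambda>N. \<integral>t. (norm (p N t))\<^sup>2 \<partial>circ) \<longlonglongrightarrow> (\<integral>t. (norm (f (of_real s * cis t)))\<^sup>2 \<partial>circ)"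
  proof (rule integral_dominated_convergence[where w = "\<lambda>_. (\<Sum>n. norm (c n))\<^sup>2"])
    show "AE t in circ. (\<lambda>N. (norm (p N t))\<^sup>2) \<longlonglongrightarrow> (norm (f (of_real s * cis t)))\<^sup>2"
      by (intro AE_I2 tendsto_intros p)
    show "AE t in circ. norm ((norm (p N t))\<^sup>2) \<le> (\<Sum>n. norm (c n))\<^sup>2" for N
      by (intro AE_I2) (auto intro!: power_mono bp)
  qed (auto intro!: integrable_circ_bounded)
  then show P: ?P
    unfolding p_def parseval_finite sums_def using s by (simp add: c_def norm_mult norm_power)
  have bf: "norm (f (of_real s * cis t)) \<le> (\<Sum>n. norm (c n))" for t
    by (rule LIMSEQ_le_const2[OF tendsto_norm[OF p]]) (auto intro: bp)
  have "integrable circ (\<lambda>t. (norm (f (of_real s * cis t)))\<^sup>2)"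
    by (rule integrable_circ_bounded[where B = "(\<Sum>n. norm (c n))\<^sup>2"]) (auto intro!: power_mono bf)
  then show ?Q
    using P by (subst nn_integral_eq_integral) (auto simp: sums_iff)
qed

text \<open>The bound \<open>B\<close> on the square means is a parameter, so that a whole family
  can share it and limits of the family stay in the same class.\<close>

definition hardy2 :: "real \<Rightarrow> (complex \<Rightarrow> complex) set" where
  "hardy2 B = {g. g holomorphic_on ball 0 1 \<and> (\<forall>s. 0 < s \<and> s < 1 \<longrightarrow>
     (\<integral>\<^sup>+t. ennreal ((norm (g (of_real s * cis t)))\<^sup>2) \<partial>circ) \<le> ennreal B)}"

text \<open>The difference has Taylor coefficients \<open>a n * (1 - \<rho> ^ n)\<close>. Tannery's
  theorem with majorant \<open>(norm (a n))\<^sup>2\<close> sends their square sum to 0 as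
  \<open>\<rho>\<close> tends to 1. The geometric rate makes the maximal functions of the
  differences summable later.\<close>

lemma hardy2_dilation:
  assumes g: "g \<in> hardy2 B" and B: "B \<ge> 0"
  obtains \<rho> :: "nat \<Rightarrow> real" where "\<And>k. 0 < \<rho> k" "\<And>k. \<rho> k < 1"
    "\<And>k. (\<lambda>z. g z - g (of_real (\<rho> k) * z)) \<in> hardy2 ((1/2)^k)"
proof -
  have hol: "g holomorphic_on ball 0 1" using g by (simp add: hardy2_def)
  define a where "a n = (deriv ^^ n) g 0 / fact n" for n
  have a: "(\<lambda>n. a n * z ^ n) sums g z" if "norm z < 1" for z
    using holomorphic_power_series[OF hol, of z] that by (simp add: a_def)
  have le: "(\<Sum>n<N. (norm (a n))\<^sup>2) \<le> B" for N
  proof -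
    have "(\<Sum>n<N. (norm (a n) * s ^ n)\<^sup>2) \<le> B" if s: "0 < s" "s < 1" for s
    proof -
      have "ennreal (\<Sum>n. (norm (a n) * s ^ n)\<^sup>2) \<le> ennreal B"
        using g s parseval_circ(2)[OF a, of s] by (auto simp: hardy2_def)
      then have "(\<Sum>n. (norm (a n) * s ^ n)\<^sup>2) \<le> B"
        using B by (simp add: ennreal_le_iff)
      moreover have "(\<Sum>n<N. (norm (a n) * s ^ n)\<^sup>2) \<le> (\<Sum>n. (norm (a n) * s ^ n)\<^sup>2)"
        using parseval_circ(1)[OF a, of s] s by (intro sum_le_suminf) (auto simp: sums_iff)
      ultimately show ?thesis by simp
    qed
    then have "eventually (\<lambda>s. (\<Sum>n<N. (norm (a n) * s ^ n)\<^sup>2) \<le> B) (at_left 1)"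
      by (intro eventually_at_leftI[of 0]) auto
    moreover have "((\<lambda>s. \<Sum>n<N. (norm (a n) * s ^ n)\<^sup>2) \<longlongrightarrow> (\<Sum>n<N. (norm (a n) * 1 ^ n)\<^sup>2)) (at_left 1)"
      by (intro tendsto_intros)
    ultimately show ?thesis
      using tendsto_upperbound[of "\<lambda>s. \<Sum>n<N. (norm (a n) * s ^ n)\<^sup>2" _ "at_left 1" B] by simp
  qed
  then have sa: "summable (\<lambda>n. (norm (a n))\<^sup>2)"
    by (intro summableI_nonneg_bounded[where x = B]) auto
  have lim: "((\<lambda>\<rho>. \<Sum>n. (norm (a n) * (1 - \<rho> ^ n))\<^sup>2) \<longlongrightarrow> (\<Sum>n. (norm (a n) * (1 - 1 ^ n))\<^sup>2)) (at_left (1::real))"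
  proof -
    have "eventually (\<lambda>(\<rho>::real). 0 < \<rho> \<and> \<rho> < 1) (at_left 1)"
      by (intro eventually_at_leftI[of 0]) auto
    then have ev: "\<forall>\<^sub>F (n, \<rho>) in at_top \<times>\<^sub>F at_left 1. norm ((norm (a n) * (1 - \<rho> ^ n))\<^sup>2) \<le> (norm (a n))\<^sup>2"
    proof -
      have "norm ((norm (a n) * (1 - \<rho> ^ n))\<^sup>2) \<le> (norm (a n))\<^sup>2" if "0 < \<rho>" "\<rho> < 1" for n and \<rho> :: real
      proof -
        have "norm (a n) * (1 - \<rho> ^ n) \<le> norm (a n) * 1"
          using that by (intro mult_left_mono) auto
        then show ?thesis using that by (auto intro!: power_mono simp: power_le_one)
      qed
      then show ?thesis
        unfolding eventually_prod_filter using \<open>eventually (\<lambda>(\<rho>::real). 0 < \<rho> \<and> \<rho> < 1) (at_left 1)\<close>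
        by (intro exI[of _ "\<lambda>_. True"] exI[of _ "\<lambda>(\<rho>::real). 0 < \<rho> \<and> \<rho> < 1"]) auto
    qed
    show ?thesis
      by (rule tannerys_theorem[THEN conjunct2, THEN conjunct2, OF _ ev sa]) (auto intro!: tendsto_eq_intros)
  qed
  have "\<exists>\<rho>. 0 < \<rho> \<and> \<rho> < 1 \<and> (\<lambda>z. g z - g (of_real \<rho> * z)) \<in> hardy2 ((1/2)^k)" for k
  proof -
    have "eventually (\<lambda>\<rho>. (\<Sum>n. (norm (a n) * (1 - \<rho> ^ n))\<^sup>2) < (1/2)^k) (at_left (1::real))"
      by (rule order_tendstoD[OF lim]) auto
    moreover have "eventually (\<lambda>(\<rho>::real). 0 < \<rho> \<and> \<rho> < 1) (at_left 1)"
      by (intro eventually_at_leftI[of 0]) auto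
    ultimately have "eventually (\<lambda>\<rho>. 0 < \<rho> \<and> \<rho> < 1 \<and> (\<Sum>n. (norm (a n) * (1 - \<rho> ^ n))\<^sup>2) < (1/2)^k) (at_left (1::real))"
      by eventually_elim auto
    then obtain \<rho> :: real where \<rho>: "0 < \<rho>" "\<rho> < 1" "(\<Sum>n. (norm (a n) * (1 - \<rho> ^ n))\<^sup>2) < (1/2)^k"
      using eventually_happens' trivial_limit_at_left_real by blast
    have sm: "summable (\<lambda>n. (norm (a n) * (1 - \<rho> ^ n))\<^sup>2)"
      by (rule summable_comparison_test'[OF sa])
         (use \<rho> in \<open>auto simp: power_mult_distrib power_le_one abs_square_le_1 intro!: mult_left_le\<close>)
    define f where "f z = g z - g (of_real \<rho> * z)" for z
    have f: "(\<lambda>n. (a n * (1 - of_real \<rho> ^ n)) * z ^ n) sums f z" if "norm z < 1" for z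
    proof -
      have "norm (of_real \<rho> * z) < 1"
        using \<rho> that by (intro norm_of_real_mult_less_1) auto
      from sums_diff[OF a[OF that] a[OF this]] show ?thesis
        by (simp add: f_def algebra_simps power_mult_distrib)
    qed
    have n1: "norm (1 - complex_of_real \<rho> ^ n) = 1 - \<rho> ^ n" for n
    proof -
      have "1 - complex_of_real \<rho> ^ n = of_real (1 - \<rho> ^ n)" by simp
      then show ?thesis using \<rho> by (simp only: norm_of_real) (simp add: power_le_one)
    qed
    have "f \<in> hardy2 ((1/2)^k)"
      unfolding hardy2_def mem_Collect_eq
    proof (intro conjI allI impI)
      show "f holomorphic_on ball 0 1"
        unfolding f_def
        by (intro holomorphic_intros hol holomorphic_on_compose_gen[OF _ hol, unfolded o_def])
           (use \<rho> norm_of_real_mult_less_1 in auto)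
      fix s :: real assume s: "0 < s \<and> s < 1"
      have "(\<Sum>n. (norm (a n * (1 - of_real \<rho> ^ n)) * s ^ n)\<^sup>2) \<le> (\<Sum>n. (norm (a n) * (1 - \<rho> ^ n))\<^sup>2)"
      proof (intro suminf_le sm)
        show "summable (\<lambda>n. (norm (a n * (1 - of_real \<rho> ^ n)) * s ^ n)\<^sup>2)"
          using parseval_circ(1)[OF f, of s] s by (simp add: sums_iff)
        show "(norm (a n * (1 - of_real \<rho> ^ n)) * s ^ n)\<^sup>2 \<le> (norm (a n) * (1 - \<rho> ^ n))\<^sup>2" for n
          using s \<rho> by (intro power_mono) (auto simp: norm_mult n1 power_le_one intro!: mult_left_le)
      qed
      also have "\<dots> \<le> (1/2)^k" using \<rho> by simp
      finally show "(\<integral>\<^sup>+t. ennreal ((norm (f (of_real s * cis t)))\<^sup>2) \<partial>circ) \<le> ennreal ((1/2)^k)"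
        using s by (subst parseval_circ(2)[OF f]) (auto intro!: ennreal_leI)
    qed
    then show ?thesis using \<rho> by (auto simp: f_def[abs_def])
  qed
  then show ?thesis using that by metis
qed

section \<open>The radial maximal function and radial limits\<close>

lemma continuous_on_circle:
  assumes "g holomorphic_on ball 0 R" "\<bar>r\<bar> < R"
  shows "continuous_on A (\<lambda>t. g (of_real r * cis t))"
  by (rule continuous_on_compose2[OF holomorphic_on_imp_continuous_on[OF assms(1)]])
     (use assms(2) in \<open>auto intro!: continuous_intros simp: norm_mult\<close>)

lemma measurable_on_circle:
  assumes "g holomorphic_on ball 0 R" "\<bar>r\<bar> < R"
  shows "(\<lambda>t. g (of_real r * cis t)) \<in> borel_measurable borel"
  by (intro borel_measurable_continuous_onI continuous_on_circle[OF assms])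

text \<open>Rational radii make this a countable supremum, hence measurable; continuity of
  \<open>g\<close> inside the disc recovers the other radii in \<open>radial_max_ge\<close>. The
  square is built in because the maximal inequality is one in \<open>L\<^sup>2\<close>.\<close>

definition radial_max :: "(complex \<Rightarrow> complex) \<Rightarrow> real \<Rightarrow> ennreal" where
  "radial_max g t = (SUP r\<in>{0<..<1} \<inter> \<rat>. ennreal ((norm (g (of_real r * cis t)))\<^sup>2))"

lemma countable_radii: "countable ({0<..<1} \<inter> \<rat> :: real set)"
  by (intro countable_Int2 countable_rat)

lemma measurable_radial_max [measurable]:
  assumes "g holomorphic_on ball 0 1"
  shows "radial_max g \<in> borel_measurable borel"
proof -
  have [measurable]: "(\<lambda>t. g (of_real r * cis t)) \<in> borel_measurable borel" if "r \<in> {0<..<1} \<inter> \<rat>" for r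
    by (rule measurable_on_circle[OF assms]) (use that in auto)
  show ?thesis
    unfolding radial_max_def[abs_def] by (intro borel_measurable_SUP countable_radii) auto
qed

lemma radial_max_ge:
  assumes g: "g holomorphic_on ball 0 1" and r: "0 < r" "r < 1"
  shows "ennreal ((norm (g (of_real r * cis t)))\<^sup>2) \<le> radial_max g t"
proof (rule ccontr)
  let ?h = "\<lambda>r. (norm (g (of_real r * cis t)))\<^sup>2"
  assume "\<not> ennreal (?h r) \<le> radial_max g t"
  then have *: "radial_max g t < ennreal (?h r)" by simp
  then obtain M where M: "radial_max g t = ennreal M" "M \<ge> 0" by (cases "radial_max g t") auto
  with * have lt: "M < ?h r" by (simp add: ennreal_less_iff)
  have cont: "continuous_on {0<..<1} ?h"
    by (intro continuous_intros continuous_on_compose2[OF holomorphic_on_imp_continuous_on[OF g]]) (auto simp: norm_mult)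
  then have "(?h \<longlongrightarrow> ?h r) (at r)"
    using r by (simp add: continuous_on_eq_continuous_at isCont_def)
  from order_tendstoD(1)[OF this lt] obtain d where d: "d > 0" "\<And>x. x \<noteq> r \<Longrightarrow> dist x r < d \<Longrightarrow> M < ?h x"
    unfolding eventually_at by auto
  obtain q where q: "q \<in> \<rat>" "r < q" "q < min 1 (r + d)"
    using Rats_dense_in_real[of r "min 1 (r + d)"] r d by auto
  then have "M < ?h q" using d(2)[of q] by (auto simp: dist_real_def)
  moreover have "ennreal (?h q) \<le> radial_max g t"
    unfolding radial_max_def by (intro SUP_upper) (use q r in auto)
  ultimately show False using M by simp
qed

text \<open>For finitely many radii the supremum is attained at a radius that depends measurably on
  the angle, which is the situation of \<open>poisson_maximal\<close>. The constant there does not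
  depend on the number of radii, so monotone convergence extends the bound to all of them.\<close>

lemma radial_max_hardy2:
  assumes g: "g \<in> hardy2 B"
  shows "(\<integral>\<^sup>+t. radial_max g t \<partial>circ) \<le> 256 * ennreal B"
proof -
  have hol: "g holomorphic_on ball 0 1" using g by (simp add: hardy2_def)
  define q where "q = from_nat_into ({0<..<1} \<inter> \<rat> :: real set)"
  have ne: "{0<..<1} \<inter> \<rat> \<noteq> ({} :: real set)"
    using Rats_dense_in_real[of 0 1] by auto
  have q: "0 < q i" "q i < 1" for i
    using from_nat_into[OF ne, of i] by (auto simp: q_def)
  let ?h = "\<lambda>i t. (norm (g (of_real (q i) * cis t)))\<^sup>2"
  have [measurable]: "(\<lambda>t. g (of_real (q i) * cis t)) \<in> borel_measurable borel" for i
    by (rule measurable_on_circle[OF hol]) (use q[of i] in auto)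
  have fin: "(\<integral>\<^sup>+t. (SUP i\<in>{..m}. ennreal (?h i t)) \<partial>circ) \<le> 256 * ennreal B" for m :: nat
  proof -
    \<comment> \<open>Taking the least maximising index makes the choice measurable.\<close>
    define N where "N t = (LEAST i. i \<le> m \<and> (\<forall>j\<in>{..m}. ?h j t \<le> ?h i t))" for t
    have N: "N t \<le> m \<and> (\<forall>j\<in>{..m}. ?h j t \<le> ?h (N t) t)" for t
    proof -
      have "Max ((\<lambda>i. ?h i t) ` {..m}) \<in> (\<lambda>i. ?h i t) ` {..m}"
        by (intro Max_in) auto
      then obtain i where i: "Max ((\<lambda>i. ?h i t) ` {..m}) = ?h i t" "i \<in> {..m}" by (rule imageE)
      then have "i \<le> m \<and> (\<forall>j\<in>{..m}. ?h j t \<le> ?h i t)" by (auto intro!: Max_ge simp flip: i(1))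
      then show ?thesis unfolding N_def by (rule LeastI)
    qed
    have [measurable]: "N \<in> measurable borel (count_space UNIV)"
      unfolding N_def[abs_def] by measurable
    define Q where "Q = Max (q ` {..m})"
    have Q: "Q < 1" unfolding Q_def using q by (subst Max_less_iff) auto
    have qQ: "q i \<le> Q" if "i \<le> m" for i
      unfolding Q_def using that by (intro Max_ge) auto
    have "Q > 0" using q(1)[of 0] qQ[of 0] by auto
    \<comment> \<open>Dilating by \<open>s < 1\<close> makes \<open>gs\<close> holomorphic across
      the circle, so that the Poisson formula applies; \<open>Q < s\<close> keeps the rescaled radii
      \<open>\<rho> t\<close> at most \<open>Q / s < 1\<close>.\<close>
    obtain s where s: "Q < s" "s < 1" using dense[OF Q] by auto
    define \<rho> where "\<rho> t = q (N t) / s" for t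
    have [measurable]: "\<rho> \<in> borel_measurable borel" unfolding \<rho>_def by measurable
    have \<rho>: "0 \<le> \<rho> t" "\<rho> t \<le> Q / s" for t
      using q[of "N t"] qQ[of "N t"] N[of t] s \<open>Q > 0\<close> by (auto simp: \<rho>_def divide_right_mono)
    define gs where "gs z = g (of_real s * z)" for z
    have "gs holomorphic_on ball 0 (1 / s)"
      unfolding gs_def
      by (rule holomorphic_dilation[OF hol]) (use s \<open>Q > 0\<close> in auto)
    note gs = this
    have s1: "1 / s > 1" using s \<open>Q > 0\<close> by auto
    have [measurable]: "(\<lambda>\<theta>. gs (cis \<theta>)) \<in> borel_measurable borel"
      using measurable_on_circle[OF gs, of 1] s1 by simp
    have pt: "(SUP i\<in>{..m}. ennreal (?h i t)) \<le>
       (\<integral>\<^sup>+\<theta>. ennreal (poisson (of_real (\<rho> t) * cis t) \<theta>) * ennreal (norm (gs (cis \<theta>))) \<partial>circ)\<^sup>2" for t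
    proof -
      define z where "z = of_real (\<rho> t) * cis t"
      have "Q / s < 1" using s \<open>Q > 0\<close> by simp
      then have z: "norm z < 1" using \<rho>[of t] by (simp add: z_def norm_mult)
      have "(SUP i\<in>{..m}. ennreal (?h i t)) \<le> ennreal (?h (N t) t)"
        using N[of t] by (intro SUP_least ennreal_leI) auto
      also have "?h (N t) t = (norm (gs z))\<^sup>2"
        using s \<open>Q > 0\<close> by (simp add: gs_def z_def \<rho>_def)
      also have "ennreal \<dots> = (ennreal (norm (gs z)))\<^sup>2"
        by (simp add: ennreal_power)
      also have "\<dots> \<le> (\<integral>\<^sup>+\<theta>. ennreal (poisson z \<theta>) * ennreal (norm (gs (cis \<theta>))) \<partial>circ)\<^sup>2"
      proof (rule power_mono)
        have "ennreal (norm (gs z)) = ennreal (norm (\<integral>\<theta>. gs (cis \<theta>) * of_real (poisson z \<theta>) \<partial>circ))"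
          using poisson_formula[OF gs s1 z] by simp
        also have "\<dots> \<le> (\<integral>\<^sup>+\<theta>. ennreal (norm (gs (cis \<theta>) * of_real (poisson z \<theta>))) \<partial>circ)"
          by (rule integral_norm_bound_ennreal)
             (use continuous_on_circle[OF gs, of 1 UNIV] s1 in \<open>auto intro!: integral_circ(1) continuous_intros z\<close>)
        also have "\<dots> = (\<integral>\<^sup>+\<theta>. ennreal (poisson z \<theta>) * ennreal (norm (gs (cis \<theta>))) \<partial>circ)"
          using z by (intro nn_integral_cong) (simp add: norm_mult ennreal_mult poisson_nonneg mult.commute)
        finally show "ennreal (norm (gs z)) \<le> \<dots>" .
      qed auto
      finally show ?thesis by (simp add: z_def)
    qed
    have "(\<integral>\<^sup>+t. (SUP i\<in>{..m}. ennreal (?h i t)) \<partial>circ) \<le>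
       (\<integral>\<^sup>+t. (\<integral>\<^sup>+\<theta>. ennreal (poisson (of_real (\<rho> t) * cis t) \<theta>) * ennreal (norm (gs (cis \<theta>))) \<partial>circ)\<^sup>2 \<partial>circ)"
      by (intro nn_integral_mono pt)
    also have "\<dots> \<le> 256 * (\<integral>\<^sup>+\<theta>. (ennreal (norm (gs (cis \<theta>))))\<^sup>2 \<partial>circ)"
      by (rule poisson_maximal[OF _ _ \<rho>]) (use s \<open>Q > 0\<close> in auto)
    also have "(\<integral>\<^sup>+\<theta>. (ennreal (norm (gs (cis \<theta>))))\<^sup>2 \<partial>circ) \<le> ennreal B"
      using g s \<open>Q > 0\<close> by (simp add: hardy2_def gs_def ennreal_power)
    finally show ?thesis by (simp add: mult_left_mono)
  qed
  have rng: "{0<..<1} \<inter> \<rat> = range q"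
    unfolding q_def using range_from_nat_into[OF ne countable_radii] by simp
  have "radial_max g t = (SUP m. SUP i\<in>{..m}. ennreal (?h i t))" for t
    unfolding radial_max_def rng
    by (rule antisym) (auto intro!: SUP_least intro: SUP_upper2[of i for i] SUP_upper2)
  then have "(\<integral>\<^sup>+t. radial_max g t \<partial>circ) = (\<integral>\<^sup>+t. (SUP m. SUP i\<in>{..m}. ennreal (?h i t)) \<partial>circ)"
    by simp
  also have "\<dots> = (SUP m. \<integral>\<^sup>+t. (SUP i\<in>{..m}. ennreal (?h i t)) \<partial>circ)"
    by (intro nn_integral_monotone_convergence_SUP) (auto simp: incseq_def le_fun_def intro!: SUP_subset_mono)
  also have "\<dots> \<le> 256 * ennreal B"
    by (intro SUP_least fin)
  finally show ?thesis .
qed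

text \<open>Almost everywhere the maximal functions of the differences \<open>d k\<close> have a
  finite sum, so some \<open>d k\<close> is uniformly small along the whole radius. There
  \<open>g\<close> is uniformly close to a dilate of itself, which is continuous up to the circle;
  hence the radial values form a Cauchy filter.\<close>

lemma hardy2_radial_limits:
  assumes g: "g \<in> hardy2 B" and B: "B \<ge> 0"
  shows "AE t in circ. \<exists>l. ((\<lambda>r. g (of_real r * cis t)) \<longlongrightarrow> l) (at_left (1::real))"
proof -
  have hol: "g holomorphic_on ball 0 1" using g by (simp add: hardy2_def)
  obtain \<rho> :: "nat \<Rightarrow> real" where \<rho>: "\<And>k. 0 < \<rho> k" "\<And>k. \<rho> k < 1"
    and gd: "\<And>k. (\<lambda>z. g z - g (of_real (\<rho> k) * z)) \<in> hardy2 ((1/2)^k)"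
    using hardy2_dilation[OF g B] by blast
  define d where "d k z = g z - g (of_real (\<rho> k) * z)" for k z
  have hd: "d k holomorphic_on ball 0 1" for k
    using gd[of k] by (simp add: hardy2_def d_def[abs_def])
  have [measurable]: "radial_max (d k) \<in> borel_measurable borel" for k
    by (rule measurable_radial_max[OF hd])
  have "(\<integral>\<^sup>+t. (\<Sum>k. radial_max (d k) t) \<partial>circ) = (\<Sum>k. \<integral>\<^sup>+t. radial_max (d k) t \<partial>circ)"
    by (intro nn_integral_suminf) simp
  also have "\<dots> \<le> (\<Sum>k. 256 * ennreal ((1/2)^k))"
    using radial_max_hardy2[OF gd] by (intro suminf_le) (auto simp: d_def[abs_def])
  also have "\<dots> = 256 * ennreal (\<Sum>k. (1/2)^k)"
    by (simp add: ennreal_suminf_cmult suminf_ennreal2 del: suminf_geometric)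
  also have "\<dots> < \<infinity>" by (simp add: ennreal_mult_less_top)
  finally have "AE t in circ. (\<Sum>k. radial_max (d k) t) \<noteq> \<infinity>"
    by (intro nn_integral_noteq_infinite) auto
  then show ?thesis
  proof eventually_elim
    case (elim t)
    let ?g = "\<lambda>r::real. g (of_real r * cis t)"
    have small: "\<exists>c. eventually (\<lambda>r. norm (?g r - c) < \<epsilon>) (at_left 1)" if "\<epsilon> > 0" for \<epsilon>
    proof -
      have "\<exists>k. radial_max (d k) t < ennreal ((\<epsilon>/2)\<^sup>2)"
      proof (rule ccontr)
        assume "\<nexists>k. radial_max (d k) t < ennreal ((\<epsilon>/2)\<^sup>2)"
        then have ge: "radial_max (d k) t \<ge> ennreal ((\<epsilon>/2)\<^sup>2)" for k by (auto simp: not_less)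
        obtain S where S: "(\<Sum>k. radial_max (d k) t) = ennreal S" "S \<ge> 0"
          using elim by (cases "\<Sum>k. radial_max (d k) t") auto
        obtain n :: nat where n: "S / ((\<epsilon>/2)\<^sup>2) < of_nat n" using reals_Archimedean2 by blast
        have "ennreal (of_nat n * (\<epsilon>/2)\<^sup>2) = (\<Sum>k<n. ennreal ((\<epsilon>/2)\<^sup>2))"
          by (subst sum_ennreal) (auto simp: sum_ennreal)
        also have "\<dots> \<le> (\<Sum>k<n. radial_max (d k) t)"
          by (intro sum_mono ge)
        also have "\<dots> \<le> ennreal S"
          unfolding S(1)[symmetric] by (intro sum_le_suminf summableI) auto
        finally have "of_nat n * (\<epsilon>/2)\<^sup>2 \<le> S"
          using S(2) by (simp add: ennreal_le_iff)
        moreover have "(\<epsilon>/2)\<^sup>2 > 0" using that by simp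
        ultimately show False using n by (simp only: pos_divide_less_eq)
      qed
      then obtain k where k: "radial_max (d k) t < ennreal ((\<epsilon>/2)\<^sup>2)" by blast
      have 1: "norm (d k (of_real r * cis t)) < \<epsilon> / 2" if r: "0 < r" "r < 1" for r
      proof -
        have "ennreal ((norm (d k (of_real r * cis t)))\<^sup>2) < ennreal ((\<epsilon>/2)\<^sup>2)"
          using radial_max_ge[OF hd r, of k t] k by (rule le_less_trans)
        then have "(norm (d k (of_real r * cis t)))\<^sup>2 < (\<epsilon>/2)\<^sup>2"
          by (simp add: ennreal_less_iff)
        then show ?thesis by (rule power2_less_imp_less) (use \<open>\<epsilon> > 0\<close> in auto)
      qed
      have "isCont (\<lambda>r. g (of_real (\<rho> k) * (of_real r * cis t))) 1"
      proof (rule continuous_on_interior[of "ball 0 (1 / \<rho> k)"])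
        show "continuous_on (ball 0 (1 / \<rho> k)) (\<lambda>r. g (of_real (\<rho> k) * (of_real r * cis t)))"
          by (intro continuous_intros continuous_on_compose2[OF holomorphic_on_imp_continuous_on[OF hol]])
             (use \<rho>[of k] in \<open>auto simp: norm_mult field_simps\<close>)
      qed (use \<rho>[of k] in auto)
      then have "((\<lambda>r. g (of_real (\<rho> k) * (of_real r * cis t))) \<longlongrightarrow> g (of_real (\<rho> k) * cis t)) (at_left 1)"
        by (simp add: isCont_def filterlim_at_split)
      then have "eventually (\<lambda>r. dist (g (of_real (\<rho> k) * (of_real r * cis t))) (g (of_real (\<rho> k) * cis t)) < \<epsilon> / 2) (at_left 1)"
        by (rule tendstoD) (use that in auto)
      moreover have "eventually (\<lambda>r. 0 < r \<and> r < (1::real)) (at_left 1)"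
        by (intro eventually_at_leftI[of 0]) auto
      ultimately have "eventually (\<lambda>r. norm (?g r - g (of_real (\<rho> k) * cis t)) < \<epsilon>) (at_left 1)"
      proof eventually_elim
        case (elim r)
        have "?g r - g (of_real (\<rho> k) * cis t) = d k (of_real r * cis t) + (g (of_real (\<rho> k) * (of_real r * cis t)) - g (of_real (\<rho> k) * cis t))"
          by (simp add: d_def)
        also have "norm \<dots> < \<epsilon>"
          by (rule le_less_trans[OF norm_triangle_ineq]) (use 1[of r] elim in \<open>auto simp: dist_norm\<close>)
        finally show ?case .
      qed
      then show ?thesis by blast
    qed
    have "cauchy_filter (filtermap ?g (at_left 1))"
      unfolding cauchy_filter_metric_filtermap
    proof (intro allI impI)
      fix e :: real assume "e > 0"
      then obtain c where c: "eventually (\<lambda>r. norm (?g r - c) < e/2) (at_left 1)"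
        using small[of "e/2"] by auto
      show "\<exists>P. eventually P (at_left 1) \<and> (\<forall>x y. P x \<and> P y \<longrightarrow> dist (?g x) (?g y) < e)"
        by (rule exI, rule conjI[OF c]) (auto simp: dist_norm intro: norm_diff_triangle_less[of _ c "e/2" _ "e/2", simplified] simp: norm_minus_commute)
    qed
    then have "convergent_filter (filtermap ?g (at_left 1))"
      by (intro cauchy_filter_convergent)
    then show ?case
      by (auto simp: convergent_filter_iff filterlim_def)
  qed
qed

section \<open>The Hardy space of exponent one\<close>

text \<open>On the circle the product is a trigonometric polynomial, and a term of negative
  frequency has the same real part as its conjugate, whose frequency is positive. The induction
  splits off the constant coefficients and uses \<open>cnj z * z = 1\<close> on the
  remainder.\<close>

lemma trig_product:
  "\<exists>s. \<forall>z. norm z = 1 \<longrightarrow> Re (cnj (poly p z) * poly q z) = Re (poly s z)" for p q :: "complex poly"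
proof (induction p arbitrary: q rule: pCons_induct)
  case 0
  show ?case by (intro exI[of _ 0]) auto
next
  case (pCons a p)
  obtain b q' where q: "q = pCons b q'" by (cases q)
  obtain s where s: "\<And>z. norm z = 1 \<Longrightarrow> Re (cnj (poly p z) * poly q' z) = Re (poly s z)"
    using pCons.IH[of q'] by auto
  have "Re (cnj (poly (pCons a p) z) * poly q z) = Re (poly (smult (cnj a) q + smult (cnj b) (pCons 0 p) + s) z)"
    if z: "norm z = 1" for z
  proof -
    have 1: "cnj z * z = 1" using z by (simp add: mult.commute[of "cnj z"] complex_norm_square[symmetric])
    have "cnj (poly (pCons a p) z) * poly q z = cnj a * poly q z + cnj (z * poly p z) * b + (cnj z * z) * (cnj (poly p z) * poly q' z)"
      by (simp add: q algebra_simps)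
    moreover have "Re (cnj (z * poly p z) * b) = Re (cnj b * (z * poly p z))"
      by (simp add: algebra_simps)
    ultimately have "Re (cnj (poly (pCons a p) z) * poly q z) = Re (cnj a * poly q z) + Re (cnj b * (z * poly p z)) + Re (poly s z)"
      by (simp only: 1 s[OF z] plus_complex.sel mult_1)
    also have "\<dots> = Re (poly (smult (cnj a) q + smult (cnj b) (pCons 0 p) + s) z)"
      by (simp only: poly_add poly_smult poly_pCons plus_complex.sel add_0)
    finally show ?thesis .
  qed
  then show ?case by blast
qed

text \<open>Every real trigonometric polynomial has this form. Presenting it as the real part of a
  polynomial in \<open>z\<close> alone is what allows the approximant to be exponentiated to a
  zero-free holomorphic function.\<close>

definition trig_poly :: "(complex \<Rightarrow> real) \<Rightarrow> bool" where
  "trig_poly f \<longleftrightarrow> continuous_on (sphere 0 1) f \<and> (\<exists>p. \<forall>z\<in>sphere 0 1. f z = Re (poly p z))"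

text \<open>Stone-Weierstrass. Products stay in the class by
  \<open>Re a * Re b = (Re (a * b) + Re (cnj a * b)) / 2\<close> and \<open>trig_product\<close>;
  the functions \<open>Re\<close> and \<open>Im\<close> separate points.\<close>

lemma trig_poly_approx:
  assumes "continuous_on (sphere 0 1) v" "e > 0"
  obtains p where "\<And>z. norm z = 1 \<Longrightarrow> \<bar>v z - Re (poly p z)\<bar> < e"
proof -
  have "\<exists>g. trig_poly g \<and> (\<forall>x\<in>sphere 0 1. \<bar>v x - g x\<bar> < e)"
  proof (rule Stone_Weierstrass_HOL)
    show "trig_poly (\<lambda>x. c)" for c
      unfolding trig_poly_def by (auto intro!: exI[of _ "[:of_real c:]"])
    show "continuous_on (sphere 0 1) f" if "trig_poly f" for f
      using that by (simp add: trig_poly_def)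
    show "trig_poly (\<lambda>x. f x + g x)" if fg: "trig_poly f \<and> trig_poly g" for f g
    proof -
      obtain p q where "\<forall>z\<in>sphere 0 1. f z = Re (poly p z)" "\<forall>z\<in>sphere 0 1. g z = Re (poly q z)"
        using fg unfolding trig_poly_def by auto
      then show ?thesis
        using fg unfolding trig_poly_def by (auto intro!: exI[of _ "p + q"] continuous_intros)
    qed
    show "trig_poly (\<lambda>x. f x * g x)" if fg: "trig_poly f \<and> trig_poly g" for f g
    proof -
      obtain p q where pq: "\<forall>z\<in>sphere 0 1. f z = Re (poly p z)" "\<forall>z\<in>sphere 0 1. g z = Re (poly q z)"
        using fg unfolding trig_poly_def by auto
      obtain s where s: "\<forall>z. norm z = 1 \<longrightarrow> Re (cnj (poly p z) * poly q z) = Re (poly s z)"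
        using trig_product by blast
      have "f z * g z = Re (poly (smult (1/2) (p * q + s)) z)" if z: "z \<in> sphere 0 1" for z
      proof -
        have "Re a * Re b = (Re (a * b) + Re (cnj a * b)) / 2" for a b
          by (simp add: algebra_simps)
        from this[of "poly p z" "poly q z"] have "f z * g z = (Re (poly p z * poly q z) + Re (poly s z)) / 2"
          using pq s z by (simp only: dist_0_norm mem_sphere)
        then show ?thesis by simp
      qed
      then show ?thesis
        using fg unfolding trig_poly_def by (auto intro!: continuous_intros exI[of _ "smult (1/2) (p * q + s)"])
    qed
    show "\<exists>f. trig_poly f \<and> f x \<noteq> f y" if "x \<in> sphere 0 1 \<and> y \<in> sphere 0 1 \<and> x \<noteq> y" for x y
    proof (cases "Re x = Re y")
      case False
      then show ?thesis
        by (intro exI[of _ Re]) (auto simp: trig_poly_def intro!: continuous_intros exI[of _ "[:0, 1:]"])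
    next
      case True
      then have "Im x \<noteq> Im y" using that by (auto simp: complex_eq_iff)
      then show ?thesis
        by (intro exI[of _ Im]) (auto simp: trig_poly_def intro!: continuous_intros exI[of _ "[:0, -\<i>:]"])
    qed
  qed (use assms in auto)
  then obtain g where g: "trig_poly g" "\<forall>x\<in>sphere 0 1. \<bar>v x - g x\<bar> < e"
    by blast
  then obtain p where p: "\<forall>z\<in>sphere 0 1. g z = Re (poly p z)"
    unfolding trig_poly_def by blast
  have "\<bar>v z - Re (poly p z)\<bar> < e" if "norm z = 1" for z
    using bspec[OF g(2), of z] bspec[OF p, of z] that by simp
  then show ?thesis by (rule that)
qed

text \<open>By Parseval the square mean is a power series in the radius with nonnegative
  coefficients. Rescaling by \<open>R'\<close> moves the unit circle to radius
  \<open>1 / R' < 1\<close>, where \<open>parseval_circ\<close> is available.\<close>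

lemma circ_square_mono:
  assumes h: "h holomorphic_on ball 0 R" and R: "R > 1" and s: "0 < s" "s < 1"
  shows "(\<integral>\<^sup>+t. ennreal ((norm (h (of_real s * cis t)))\<^sup>2) \<partial>circ) \<le> (\<integral>\<^sup>+t. ennreal ((norm (h (cis t)))\<^sup>2) \<partial>circ)"
proof -
  obtain R' where R': "1 < R'" "R' < R" using dense[OF R] by auto
  define f where "f z = h (of_real R' * z)" for z
  have hol: "f holomorphic_on ball 0 1"
    unfolding f_def
  proof (intro holomorphic_intros holomorphic_on_compose_gen[OF _ h, unfolded o_def])
    show "(*) (complex_of_real R') ` ball 0 1 \<subseteq> ball 0 R"
    proof (clarsimp simp: norm_mult)
      fix z :: complex assume "norm z < 1"
      then have "R' * norm z \<le> R' * 1" using R' by (intro mult_left_mono) auto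
      then have "R' * norm z < R" using R' by linarith
      then show "\<bar>R'\<bar> * norm z < R" using R' by simp
    qed
  qed
  define a where "a n = (deriv ^^ n) f 0 / fact n" for n
  have a: "(\<lambda>n. a n * z ^ n) sums f z" if "norm z < 1" for z
    using holomorphic_power_series[OF hol, of z] that by (simp add: a_def)
  have s': "0 \<le> s / R'" "s / R' < 1" "0 \<le> 1 / R'" "1 / R' < 1"
    using s R' by (auto simp: field_simps)
  have p1: "(\<integral>\<^sup>+t. ennreal ((norm (f (of_real (s / R') * cis t)))\<^sup>2) \<partial>circ) = ennreal (\<Sum>n. (norm (a n) * (s / R') ^ n)\<^sup>2)"
    by (rule parseval_circ(2)[OF _ s'(1,2)]) (rule a)
  have p2: "(\<integral>\<^sup>+t. ennreal ((norm (f (of_real (1 / R') * cis t)))\<^sup>2) \<partial>circ) = ennreal (\<Sum>n. (norm (a n) * (1 / R') ^ n)\<^sup>2)"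
    by (rule parseval_circ(2)[OF _ s'(3,4)]) (rule a)
  have "(\<integral>\<^sup>+t. ennreal ((norm (f (of_real (s / R') * cis t)))\<^sup>2) \<partial>circ) \<le> (\<integral>\<^sup>+t. ennreal ((norm (f (of_real (1 / R') * cis t)))\<^sup>2) \<partial>circ)"
    unfolding p1 p2
  proof (intro ennreal_leI suminf_le)
    show "(norm (a n) * (s / R') ^ n)\<^sup>2 \<le> (norm (a n) * (1 / R') ^ n)\<^sup>2" for n
      using s R' by (intro power_mono mult_left_mono divide_right_mono) auto
  qed (use parseval_circ(1)[OF a s'(1,2)] parseval_circ(1)[OF a s'(3,4)] in \<open>auto simp: sums_iff\<close>)
  then show ?thesis using R' by (simp add: f_def)
qed

lemma hardy2_limit:
  assumes G: "\<And>n. G n \<in> hardy2 B" and g: "g holomorphic_on ball 0 1"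
    and lim: "\<And>z. norm z < 1 \<Longrightarrow> (\<lambda>n. G n z) \<longlonglongrightarrow> g z"
  shows "g \<in> hardy2 B"
  unfolding hardy2_def
proof (intro CollectI conjI g allI impI)
  fix s :: real assume s: "0 < s \<and> s < 1"
  have Gh: "G n holomorphic_on ball 0 1" for n using G by (simp add: hardy2_def)
  have [measurable]: "(\<lambda>t. G n (of_real s * cis t)) \<in> borel_measurable borel" for n
    by (rule measurable_on_circle[OF Gh]) (use s in auto)
  have "(\<integral>\<^sup>+t. ennreal ((norm (g (of_real s * cis t)))\<^sup>2) \<partial>circ) =
      (\<integral>\<^sup>+t. liminf (\<lambda>n. ennreal ((norm (G n (of_real s * cis t)))\<^sup>2)) \<partial>circ)"
  proof (intro nn_integral_cong)
    fix t
    have "(\<lambda>n. G n (of_real s * cis t)) \<longlonglongrightarrow> g (of_real s * cis t)"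
      by (rule lim) (use s in \<open>auto simp: norm_mult\<close>)
    then have "(\<lambda>n. ennreal ((norm (G n (of_real s * cis t)))\<^sup>2)) \<longlonglongrightarrow> ennreal ((norm (g (of_real s * cis t)))\<^sup>2)"
      by (intro tendsto_intros)
    then show "ennreal ((norm (g (of_real s * cis t)))\<^sup>2) = liminf (\<lambda>n. ennreal ((norm (G n (of_real s * cis t)))\<^sup>2))"
      by (rule lim_imp_Liminf[OF sequentially_bot, symmetric])
  qed
  also have "\<dots> \<le> liminf (\<lambda>n. \<integral>\<^sup>+t. ennreal ((norm (G n (of_real s * cis t)))\<^sup>2) \<partial>circ)"
    by (intro nn_integral_liminf) simp
  also have "\<dots> \<le> liminf (\<lambda>n::nat. ennreal B)"
    using G s by (intro Liminf_mono) (auto simp: hardy2_def)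
  also have "\<dots> = ennreal B" by (simp add: Liminf_const)
  finally show "(\<integral>\<^sup>+t. ennreal ((norm (g (of_real s * cis t)))\<^sup>2) \<partial>circ) \<le> ennreal B" .
qed

text \<open>Supplies the local uniform boundedness for Montel's theorem. The Poisson formula is used
  on the circle of radius halfway between \<open>\<rho>\<close> and 1, and
  \<open>x \<le> 1 + x\<^sup>2\<close> passes from the mean of \<open>|g|\<close> to the square
  mean.\<close>

lemma hardy2_bound:
  assumes g: "g \<in> hardy2 B" and B: "B \<ge> 0" and \<rho>: "0 \<le> \<rho>" "\<rho> < 1" and z: "norm z \<le> \<rho>"
  shows "norm (g z) \<le> 2 / (1 - \<rho> / ((1 + \<rho>) / 2)) * (1 + B)"
proof -
  have hol: "g holomorphic_on ball 0 1" using g by (simp add: hardy2_def)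
  define s where "s = (1 + \<rho>) / 2"
  have s: "0 < s" "s < 1" "\<rho> < s" using \<rho> by (auto simp: s_def)
  define gs where "gs z = g (of_real s * z)" for z
  have gs: "gs holomorphic_on ball 0 (1 / s)"
    unfolding gs_def
    by (rule holomorphic_dilation[OF hol]) (use s in auto)
  have s1: "1 / s > 1" using s by auto
  have [measurable]: "(\<lambda>\<theta>. gs (cis \<theta>)) \<in> borel_measurable borel"
    using measurable_on_circle[OF gs, of 1] s1 by simp
  have zs: "norm (z / of_real s) \<le> \<rho> / s" using z s by (simp add: norm_divide divide_right_mono)
  have \<rho>s: "\<rho> / s < 1" using s by simp
  have zs1: "norm (z / of_real s) < 1" using zs \<rho>s by simp
  have bound: "poisson (z / of_real s) \<theta> \<le> 2 / (1 - \<rho> / s)" for \<theta>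
    by (rule order.trans[OF poisson_le[OF zs1]]) (use zs \<rho>s in \<open>auto intro!: divide_left_mono mult_pos_pos\<close>)
  have "ennreal (norm (g z)) = ennreal (norm (\<integral>\<theta>. gs (cis \<theta>) * of_real (poisson (z / of_real s) \<theta>) \<partial>circ))"
    using poisson_formula[OF gs s1 zs1] s by (simp add: gs_def)
  also have "\<dots> \<le> (\<integral>\<^sup>+\<theta>. ennreal (norm (gs (cis \<theta>) * of_real (poisson (z / of_real s) \<theta>))) \<partial>circ)"
    by (rule integral_norm_bound_ennreal)
       (use continuous_on_circle[OF gs, of 1 UNIV] s1 in \<open>auto intro!: integral_circ(1) continuous_intros zs1\<close>)
  also have "\<dots> \<le> (\<integral>\<^sup>+\<theta>. ennreal (2 / (1 - \<rho> / s)) * (1 + ennreal ((norm (gs (cis \<theta>)))\<^sup>2)) \<partial>circ)"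
  proof (intro nn_integral_mono)
    fix \<theta>
    have "norm (gs (cis \<theta>)) \<le> 1 + (norm (gs (cis \<theta>)))\<^sup>2"
      using zero_le_power2[of "norm (gs (cis \<theta>)) - 1/2"] by (simp add: power2_eq_square algebra_simps)
    moreover have p0: "0 \<le> poisson (z / of_real s) \<theta>" using zs1 by (intro poisson_nonneg) simp
    ultimately have "poisson (z / of_real s) \<theta> * norm (gs (cis \<theta>)) \<le> (2 / (1 - \<rho> / s)) * (1 + (norm (gs (cis \<theta>)))\<^sup>2)"
      using order.trans[OF p0 bound[of \<theta>]] by (intro mult_mono bound) simp_all
    then have "norm (gs (cis \<theta>) * of_real (poisson (z / of_real s) \<theta>)) \<le> (2 / (1 - \<rho> / s)) * (1 + (norm (gs (cis \<theta>)))\<^sup>2)"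
      using p0 by (simp add: norm_mult mult.commute)
    then have "ennreal (norm (gs (cis \<theta>) * of_real (poisson (z / of_real s) \<theta>))) \<le> ennreal ((2 / (1 - \<rho> / s)) * (1 + (norm (gs (cis \<theta>)))\<^sup>2))"
      by (rule ennreal_leI)
    also have "\<dots> = ennreal (2 / (1 - \<rho> / s)) * (1 + ennreal ((norm (gs (cis \<theta>)))\<^sup>2))"
      using \<rho>s by (subst ennreal_mult) (auto simp flip: ennreal_1 ennreal_plus)
    finally show "ennreal (norm (gs (cis \<theta>) * of_real (poisson (z / of_real s) \<theta>))) \<le> \<dots>" .
  qed
  also have "\<dots> = ennreal (2 / (1 - \<rho> / s)) * (1 + (\<integral>\<^sup>+\<theta>. ennreal ((norm (gs (cis \<theta>)))\<^sup>2) \<partial>circ))"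
    by (subst nn_integral_cmult) (auto simp: nn_integral_add emeasure_circ)
  also have "\<dots> \<le> ennreal (2 / (1 - \<rho> / s)) * (1 + ennreal B)"
    using g s by (intro mult_left_mono add_left_mono) (auto simp: hardy2_def gs_def)
  also have "\<dots> = ennreal (2 / (1 - \<rho> / s) * (1 + B))"
    using \<rho>s B by (subst ennreal_mult) (auto simp flip: ennreal_1 ennreal_plus)
  finally show ?thesis
    using \<rho>s B by (subst (asm) ennreal_le_iff) (auto simp: s_def)
qed

lemma hardy2_Montel:
  assumes G: "\<And>n. G n \<in> hardy2 B" and B: "B \<ge> 0"
  obtains g r where "g \<in> hardy2 B" "strict_mono (r :: nat \<Rightarrow> nat)" "\<And>z. norm z < 1 \<Longrightarrow> (\<lambda>n. G (r n) z) \<longlonglongrightarrow> g z"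
proof -
  obtain g and r :: "nat \<Rightarrow> nat" where gr: "g holomorphic_on ball 0 1" "strict_mono r" "\<And>z. z \<in> ball 0 1 \<Longrightarrow> (\<lambda>n. G (r n) z) \<longlonglongrightarrow> g z"
  proof (rule Montel[of "ball 0 1" "hardy2 B" G])
    show "\<exists>M. \<forall>h\<in>hardy2 B. \<forall>z\<in>K. norm (h z) \<le> M" if K: "compact K" "K \<subseteq> ball 0 1" for K
    proof -
      obtain \<rho> where \<rho>: "0 \<le> \<rho>" "\<rho> < 1" "\<And>z. z \<in> K \<Longrightarrow> norm z \<le> \<rho>"
      proof (cases "K = {}")
        case True
        then show ?thesis using that[of 0] by auto
      next
        case False
        obtain x where "x \<in> K" "\<forall>y\<in>K. norm y \<le> norm x"
          using continuous_attains_sup[OF K(1) False, of norm] by (auto intro: continuous_intros)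
        then show ?thesis using that[of "norm x"] K by auto
      qed
      then show ?thesis using hardy2_bound[OF _ B \<rho>(1,2)] by blast
    qed
  qed (use G in \<open>auto simp: hardy2_def\<close>)
  have "g \<in> hardy2 B"
    by (rule hardy2_limit[of "\<lambda>n. G (r n)"]) (use G gr in auto)
  then show ?thesis using that gr by auto
qed

text \<open>
  No zeros have to be divided out: \<open>g\<close> is the square root of a zero-free function whose modulus on the
  circle is comparable to \<open>|F| + 1\<close>, and then \<open>|F/g| \<le> |g|\<close> there.
\<close>
lemma hardy1_factor_step:
  assumes F: "F holomorphic_on ball 0 R" and R: "R > 1" and B0: "B0 \<ge> 0"
    and int: "(\<integral>\<^sup>+t. ennreal (norm (F (cis t))) \<partial>circ) \<le> ennreal B0"
  obtains g h where "g \<in> hardy2 (2 * B0 + 2)" "h \<in> hardy2 (2 * B0 + 2)" "\<And>z. norm z < 1 \<Longrightarrow> F z = h z * g z"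
proof -
  \<comment> \<open>The shift by \<open>ln 2 / 2\<close> centres the target: an error below
    \<open>ln 2 / 2\<close> leaves \<open>Re (poly p z)\<close> between
    \<open>ln (norm (F z) + 1)\<close> and that value plus \<open>ln 2\<close>. The lower bound
    gives \<open>gl\<close>, the upper one \<open>gu\<close>.\<close>
  define v where "v z = ln (norm (F z) + 1) + ln 2 / 2" for z
  have "continuous_on (sphere 0 1) v"
    unfolding v_def using R
    by (intro continuous_intros continuous_on_subset[OF holomorphic_on_imp_continuous_on[OF F]] ballI)
       (auto simp: add_nonneg_eq_0_iff)
  moreover have "ln 2 / 2 > (0::real)" by simp
  ultimately obtain p where p: "\<And>z. norm z = 1 \<Longrightarrow> \<bar>v z - Re (poly p z)\<bar> < ln 2 / 2"
    by (rule trig_poly_approx) blast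
  define g where "g z = exp (poly p z / 2)" for z
  define h where "h z = F z / g z" for z
  have gh: "g holomorphic_on ball 0 R" unfolding g_def by (intro holomorphic_intros) auto
  have hh: "h holomorphic_on ball 0 R" unfolding h_def by (intro holomorphic_intros F gh) (auto simp: g_def)
  have g2: "(norm (g z))\<^sup>2 = exp (Re (poly p z))" for z
    by (simp add: g_def power2_eq_square flip: exp_add)
  have gl: "norm (F z) \<le> (norm (g z))\<^sup>2" and gu: "(norm (g z))\<^sup>2 \<le> 2 * norm (F z) + 2" if z: "norm z = 1" for z
  proof -
    have pos: "norm (F z) + 1 > 0" by (simp add: add_nonneg_pos)
    have "ln (norm (F z) + 1) \<le> Re (poly p z)" "Re (poly p z) \<le> ln (norm (F z) + 1) + ln 2"
      using p[OF z] by (auto simp: v_def abs_if split: if_splits)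
    then have "exp (ln (norm (F z) + 1)) \<le> (norm (g z))\<^sup>2" "(norm (g z))\<^sup>2 \<le> exp (ln (norm (F z) + 1) + ln 2)"
      unfolding g2 by (simp_all only: exp_le_cancel_iff)
    then show "norm (F z) \<le> (norm (g z))\<^sup>2" "(norm (g z))\<^sup>2 \<le> 2 * norm (F z) + 2"
      using pos by (simp_all add: exp_add)
  qed
  have hu: "(norm (h z))\<^sup>2 \<le> 2 * norm (F z) + 2" if z: "norm z = 1" for z
  proof -
    have "norm (F z) * norm (F z) \<le> (norm (g z))\<^sup>2 * (norm (g z))\<^sup>2"
      by (intro mult_mono gl z) auto
    then have "(norm (h z))\<^sup>2 \<le> (norm (g z))\<^sup>2"
      by (simp add: h_def norm_divide power_divide g_def divide_le_eq power2_eq_square)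
    then show ?thesis using gu[OF z] by linarith
  qed
  have [measurable]: "(\<lambda>t. F (cis t)) \<in> borel_measurable borel"
    using measurable_on_circle[OF F, of 1] R by simp
  have *: "k \<in> hardy2 (2 * B0 + 2)"
    if k: "k holomorphic_on ball 0 R" and ku: "\<And>z. norm z = 1 \<Longrightarrow> (norm (k z))\<^sup>2 \<le> 2 * norm (F z) + 2" for k
    unfolding hardy2_def
  proof (intro CollectI conjI allI impI)
    show "k holomorphic_on ball 0 1" by (rule holomorphic_on_subset[OF k]) (use R in auto)
    fix s :: real assume s: "0 < s \<and> s < 1"
    have "(\<integral>\<^sup>+t. ennreal ((norm (k (of_real s * cis t)))\<^sup>2) \<partial>circ) \<le> (\<integral>\<^sup>+t. ennreal ((norm (k (cis t)))\<^sup>2) \<partial>circ)"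
      using circ_square_mono[OF k R] s by auto
    also have "\<dots> \<le> (\<integral>\<^sup>+t. 2 * ennreal (norm (F (cis t))) + 2 \<partial>circ)"
    proof (intro nn_integral_mono)
      fix t
      have "ennreal ((norm (k (cis t)))\<^sup>2) \<le> ennreal (2 * norm (F (cis t)) + 2)"
        by (intro ennreal_leI ku) simp
      also have "\<dots> = 2 * ennreal (norm (F (cis t))) + 2"
        by (simp add: ennreal_mult)
      finally show "ennreal ((norm (k (cis t)))\<^sup>2) \<le> \<dots>" .
    qed
    also have "\<dots> = 2 * (\<integral>\<^sup>+t. ennreal (norm (F (cis t))) \<partial>circ) + 2"
      by (simp add: nn_integral_add nn_integral_cmult emeasure_circ)
    also have "\<dots> \<le> 2 * ennreal B0 + 2"
      by (intro add_right_mono mult_left_mono int) auto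
    also have "\<dots> = ennreal (2 * B0 + 2)"
      using B0 by (simp add: ennreal_mult)
    finally show "(\<integral>\<^sup>+t. ennreal ((norm (k (of_real s * cis t)))\<^sup>2) \<partial>circ) \<le> ennreal (2 * B0 + 2)" .
  qed
  show ?thesis
  proof (rule that)
    show "g \<in> hardy2 (2 * B0 + 2)" by (rule *[OF gh gu])
    show "h \<in> hardy2 (2 * B0 + 2)" by (rule *[OF hh hu])
  qed (simp add: h_def g_def)
qed

text \<open>Factorisation requires holomorphy past the closed disc, so it is applied to the dilates
  \<open>f (r k * z)\<close>. The bounds on the factors do not depend on \<open>k\<close>, and two
  successive applications of Montel's theorem produce limits of both factors along a common
  subsequence.\<close>

lemma hardy1_factor:
  assumes f: "f \<in> hardy1"
  obtains B g h where "B \<ge> 0" "g \<in> hardy2 B" "h \<in> hardy2 B" "\<And>z. norm z < 1 \<Longrightarrow> f z = h z * g z"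
proof -
  have hol: "f holomorphic_on ball 0 1" using f by (simp add: hardy1_def)
  obtain B' where B': "B' < \<infinity>" "\<And>r. 0 < r \<Longrightarrow> r < 1 \<Longrightarrow>
        (\<integral>\<^sup>+ t \<in> {0..2*pi}. ennreal (norm (f (complex_of_real r * cis t))) \<partial>lborel) \<le> B'"
    using f unfolding hardy1_def by auto
  define B0 where "B0 = enn2real (ennreal (1 / (2 * pi)) * B')"
  have B0: "B0 \<ge> 0" by (simp add: B0_def)
  have eB0: "ennreal B0 = ennreal (1 / (2 * pi)) * B'"
    unfolding B0_def using B'(1) by (intro ennreal_enn2real) (simp add: ennreal_mult_less_top)
  define r where "r k = 1 - inverse (real (Suc (Suc k)))" for k
  have r: "0 < r k" "r k < 1" for k by (auto simp: r_def field_simps)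
  have rlim: "r \<longlonglongrightarrow> 1"
    unfolding r_def by (rule tendsto_eq_intros LIMSEQ_Suc LIMSEQ_inverse_real_of_nat refl | simp)+
  have "\<exists>g h. g \<in> hardy2 (2 * B0 + 2) \<and> h \<in> hardy2 (2 * B0 + 2) \<and> (\<forall>z. norm z < 1 \<longrightarrow> f (of_real (r k) * z) = h z * g z)" for k
  proof (rule hardy1_factor_step)
    show "(\<lambda>z. f (of_real (r k) * z)) holomorphic_on ball 0 (1 / r k)"
      by (rule holomorphic_dilation[OF hol r(1)])
    have [measurable]: "(\<lambda>t. f (of_real (r k) * cis t)) \<in> borel_measurable borel"
      by (rule measurable_on_circle[OF hol]) (use r[of k] in auto)
    show "(\<integral>\<^sup>+t. ennreal (norm (f (of_real (r k) * cis t))) \<partial>circ) \<le> ennreal B0"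
      unfolding eB0 by (subst nn_integral_circ) (auto intro!: mult_left_mono B'(2) r)
  qed (use r[of k] B0 in auto)
  then obtain g h where gh: "\<And>k. g k \<in> hardy2 (2 * B0 + 2)" "\<And>k. h k \<in> hardy2 (2 * B0 + 2)"
      "\<And>k z. norm z < 1 \<Longrightarrow> f (of_real (r k) * z) = h k z * g k z" by metis
  have B: "0 \<le> 2 * B0 + 2" using B0 by simp
  obtain G a where G: "G \<in> hardy2 (2 * B0 + 2)" "strict_mono (a :: nat \<Rightarrow> nat)"
    "\<And>z. norm z < 1 \<Longrightarrow> (\<lambda>n. g (a n) z) \<longlonglongrightarrow> G z"
    using hardy2_Montel[of g, OF gh(1) B] by blast
  obtain H b where H: "H \<in> hardy2 (2 * B0 + 2)" "strict_mono (b :: nat \<Rightarrow> nat)"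
    "\<And>z. norm z < 1 \<Longrightarrow> (\<lambda>n. h (a (b n)) z) \<longlonglongrightarrow> H z"
    using hardy2_Montel[of "\<lambda>n. h (a n)", OF gh(2) B] by blast
  have "f z = H z * G z" if z: "norm z < 1" for z
  proof (rule LIMSEQ_unique)
    have "(\<lambda>n. g (a (b n)) z) \<longlonglongrightarrow> G z"
      using LIMSEQ_subseq_LIMSEQ[OF G(3)[OF z] H(2)] by (simp add: o_def)
    from tendsto_mult[OF H(3)[OF z] this]
    show "(\<lambda>n. f (of_real (r (a (b n))) * z)) \<longlonglongrightarrow> H z * G z"
      by (simp add: gh(3)[OF z])
    have "(\<lambda>n. r (a (b n))) \<longlonglongrightarrow> 1"
      using LIMSEQ_subseq_LIMSEQ[OF LIMSEQ_subseq_LIMSEQ[OF rlim G(2)] H(2)] by (simp add: o_def)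
    then have "(\<lambda>n. of_real (r (a (b n))) * z) \<longlonglongrightarrow> of_real 1 * z"
      by (intro tendsto_intros)
    moreover have "isCont f z"
      using holomorphic_on_imp_continuous_on[OF hol] z by (simp add: continuous_on_eq_continuous_at)
    ultimately show "(\<lambda>n. f (of_real (r (a (b n))) * z)) \<longlonglongrightarrow> f z"
      using isCont_tendsto_compose by fastforce
  qed
  then show ?thesis using that[OF B G(1) H(1)] by blast
qed

text \<open>\<open>boundary f\<close> is a limit over a continuous parameter, so a Borel version
  \<open>u\<close> is taken along the sequence \<open>r k\<close>. Since
  \<open>|f| \<le> |g|\<^sup>2 + |h|\<^sup>2\<close>, the radial maximal functions of the two
  factors give an integrable majorant for \<open>f\<close>, and the Poisson formula for dilates
  passes to the limit; this replaces a maximal inequality in \<open>L\<^sup>1\<close>.\<close>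

lemma hardy1_representation:
  assumes f: "f \<in> hardy1"
  obtains u where "u \<in> borel_measurable borel" "AE t in circ. boundary f (cis t) = u t"
    "\<And>z. norm z < 1 \<Longrightarrow> f z = (\<integral>t. u t * of_real (poisson z t) \<partial>circ)"
proof -
  have hol: "f holomorphic_on ball 0 1" using f by (simp add: hardy1_def)
  obtain B g h where B: "B \<ge> 0" and g: "g \<in> hardy2 B" and h: "h \<in> hardy2 B" and fgh: "\<And>z. norm z < 1 \<Longrightarrow> f z = h z * g z"
    using hardy1_factor[OF f] by blast
  have gh: "g holomorphic_on ball 0 1" and hh: "h holomorphic_on ball 0 1" using g h by (auto simp: hardy2_def)
  note [measurable] = measurable_radial_max[OF gh] measurable_radial_max[OF hh]
  define r where "r k = 1 - inverse (real (Suc (Suc k)))" for k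
  have r: "0 < r k" "r k < 1" for k by (auto simp: r_def field_simps)
  have rlim: "r \<longlonglongrightarrow> 1"
    unfolding r_def by (rule tendsto_eq_intros LIMSEQ_Suc LIMSEQ_inverse_real_of_nat refl | simp)+
  have [measurable]: "(\<lambda>t. f (of_real (r k) * cis t)) \<in> borel_measurable borel" for k
    by (rule measurable_on_circle[OF hol]) (use r[of k] in auto)
  define u where "u t = lim (\<lambda>k. f (of_real (r k) * cis t))" for t
  have um [measurable]: "u \<in> borel_measurable borel"
    unfolding u_def[abs_def] by measurable
  have "AE t in circ. (\<exists>l. ((\<lambda>r. g (of_real r * cis t)) \<longlongrightarrow> l) (at_left (1::real))) \<and> (\<exists>l. ((\<lambda>r. h (of_real r * cis t)) \<longlongrightarrow> l) (at_left (1::real)))"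
    using hardy2_radial_limits[OF g B] hardy2_radial_limits[OF h B] by eventually_elim auto
  then have lim: "AE t in circ. boundary f (cis t) = u t \<and> (\<lambda>k. f (of_real (r k) * cis t)) \<longlonglongrightarrow> u t"
  proof eventually_elim
    case (elim t)
    then obtain a b where ab: "((\<lambda>r. g (of_real r * cis t)) \<longlongrightarrow> a) (at_left (1::real))" "((\<lambda>r. h (of_real r * cis t)) \<longlongrightarrow> b) (at_left (1::real))"
      by blast
    have "eventually (\<lambda>r. h (of_real r * cis t) * g (of_real r * cis t) = f (of_real r * cis t)) (at_left (1::real))"
      by (rule eventually_at_leftI[of 0]) (auto simp: fgh norm_mult)
    with tendsto_mult[OF ab(2,1)] have l: "((\<lambda>r. f (of_real r * cis t)) \<longlongrightarrow> b * a) (at_left (1::real))"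
      by (rule Lim_transform_eventually)
    then have "boundary f (cis t) = b * a"
      unfolding boundary_def by (intro tendsto_Lim) auto
    moreover have "filterlim r (at_left 1) sequentially"
      using rlim r by (auto simp: filterlim_at less_imp_neq)
    from filterlim_compose[OF l this] have "(\<lambda>k. f (of_real (r k) * cis t)) \<longlonglongrightarrow> b * a" .
    moreover from this have "u t = b * a" unfolding u_def by (rule limI)
    ultimately show ?case by simp
  qed
  define D where "D t = radial_max g t + radial_max h t" for t
  have [measurable]: "D \<in> borel_measurable borel" unfolding D_def[abs_def] by measurable
  have "(\<integral>\<^sup>+t. D t \<partial>circ) \<le> 256 * ennreal B + 256 * ennreal B"
    unfolding D_def by (subst nn_integral_add) (auto intro!: add_mono radial_max_hardy2 g h)
  also have "\<dots> < \<infinity>" by (simp add: ennreal_mult_less_top)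
  finally have Dfin: "(\<integral>\<^sup>+t. D t \<partial>circ) < \<infinity>" .
  then have "AE t in circ. D t \<noteq> \<infinity>"
    by (intro nn_integral_noteq_infinite) auto
  then have AED: "AE t in circ. ennreal (enn2real (D t)) = D t"
    by eventually_elim (auto simp: less_top)
  have intD: "integrable circ (\<lambda>t. enn2real (D t))"
  proof (rule integrableI_bounded)
    have "(\<integral>\<^sup>+t. ennreal (norm (enn2real (D t))) \<partial>circ) = (\<integral>\<^sup>+t. D t \<partial>circ)"
      by (rule nn_integral_cong_AE) (use AED in auto)
    with Dfin show "(\<integral>\<^sup>+t. ennreal (norm (enn2real (D t))) \<partial>circ) < \<infinity>" by simp
  qed simp
  have fD: "AE t in circ. norm (f (of_real (r k) * cis t)) \<le> enn2real (D t)" for k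
    using AED
  proof eventually_elim
    case (elim t)
    let ?z = "of_real (r k) * cis t"
    have "norm (f ?z) \<le> (norm (g ?z))\<^sup>2 + (norm (h ?z))\<^sup>2"
    proof -
      have "norm (f ?z) = norm (g ?z) * norm (h ?z)"
        using r[of k] by (subst fgh) (auto simp: norm_mult)
      moreover have "0 \<le> norm (g ?z) * norm (h ?z)" by simp
      moreover have "2 * (norm (g ?z) * norm (h ?z)) \<le> (norm (g ?z))\<^sup>2 + (norm (h ?z))\<^sup>2"
        using sum_squares_bound[of "norm (g ?z)" "norm (h ?z)"] by (simp only: mult.assoc)
      ultimately show ?thesis by linarith
    qed
    then have "ennreal (norm (f ?z)) \<le> ennreal ((norm (g ?z))\<^sup>2) + ennreal ((norm (h ?z))\<^sup>2)"
      by (simp flip: ennreal_plus add: ennreal_leI)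
    also have "\<dots> \<le> D t"
      unfolding D_def by (intro add_mono radial_max_ge gh hh r)
    also have "\<dots> = ennreal (enn2real (D t))" using elim by simp
    finally show ?case by (simp add: ennreal_le_iff)
  qed
  have rep: "f z = (\<integral>t. u t * of_real (poisson z t) \<partial>circ)" if z: "norm z < 1" for z
  proof (rule LIMSEQ_unique)
    have [measurable]: "poisson z \<in> borel_measurable borel"
      by (intro borel_measurable_continuous_onI continuous_intros z)
    have pz: "0 \<le> poisson z t" "poisson z t \<le> 2 / (1 - norm z)" for t
      using poisson_le[OF z] z by (auto intro: poisson_nonneg)
    show "(\<lambda>k. \<integral>t. f (of_real (r k) * cis t) * of_real (poisson z t) \<partial>circ) \<longlonglongrightarrow> (\<integral>t. u t * of_real (poisson z t) \<partial>circ)"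
    proof (rule integral_dominated_convergence[where w = "\<lambda>t. enn2real (D t) * (2 / (1 - norm z))"])
      show "integrable circ (\<lambda>t. enn2real (D t) * (2 / (1 - norm z)))"
        by (intro integrable_mult_left intD)
      show "AE t in circ. (\<lambda>k. f (of_real (r k) * cis t) * of_real (poisson z t)) \<longlonglongrightarrow> u t * of_real (poisson z t)"
        using lim by eventually_elim (auto intro!: tendsto_intros)
      show "AE t in circ. norm (f (of_real (r k) * cis t) * of_real (poisson z t)) \<le> enn2real (D t) * (2 / (1 - norm z))" for k
        using fD[of k]
      proof eventually_elim
        case (elim t)
        have "norm (f (of_real (r k) * cis t)) * poisson z t \<le> enn2real (D t) * (2 / (1 - norm z))"
          by (intro mult_mono elim pz) auto
        then show ?case using pz(1)[of t] by (simp add: norm_mult)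
      qed
    qed auto
    have "f (of_real (r k) * z) = (\<integral>t. f (of_real (r k) * cis t) * of_real (poisson z t) \<partial>circ)" for k
    proof -
      have "(\<lambda>z. f (of_real (r k) * z)) holomorphic_on ball 0 (1 / r k)"
        by (rule holomorphic_dilation[OF hol r(1)])
      from poisson_formula[OF this _ z] show ?thesis using r[of k] by simp
    qed
    moreover have "(\<lambda>n. of_real (r n) * z) \<longlonglongrightarrow> of_real 1 * z"
      by (intro tendsto_intros rlim)
    moreover have "isCont f z"
      using holomorphic_on_imp_continuous_on[OF hol] z by (simp add: continuous_on_eq_continuous_at)
    ultimately show "(\<lambda>k. \<integral>t. f (of_real (r k) * cis t) * of_real (poisson z t) \<partial>circ) \<longlonglongrightarrow> f z"
      using isCont_tendsto_compose[of z f "\<lambda>n. of_real (r n) * z" sequentially] by simp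
  qed
  have "AE t in circ. boundary f (cis t) = u t" using lim by eventually_elim simp
  then show ?thesis by (rule that[OF um _ rep])
qed

section \<open>Orlicz functions\<close>

lemma orlicz_mono: "orlicz_function \<Psi> \<Longrightarrow> 0 \<le> x \<Longrightarrow> x \<le> y \<Longrightarrow> \<Psi> x \<le> \<Psi> y"
  by (auto simp: orlicz_function_def mono_on_def)

lemma orlicz_nonneg: "orlicz_function \<Psi> \<Longrightarrow> 0 \<le> x \<Longrightarrow> 0 \<le> \<Psi> x"
  by (auto simp: orlicz_function_def)

lemma orlicz_zero: "orlicz_function \<Psi> \<Longrightarrow> \<Psi> 0 = 0"
  by (auto simp: orlicz_function_def)

lemma measurable_orlicz:
  assumes \<Psi>: "orlicz_function \<Psi>" and [measurable]: "u \<in> borel_measurable M" and "\<And>x. u x \<ge> (0::real)"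
  shows "(\<lambda>x. \<Psi> (u x)) \<in> borel_measurable M"
proof -
  have "mono (\<lambda>x. \<Psi> (max 0 x))"
    by (intro monoI orlicz_mono[OF \<Psi>]) auto
  then have [measurable]: "(\<lambda>x. \<Psi> (max 0 x)) \<in> borel_measurable borel"
    by (rule borel_measurable_mono)
  have "(\<lambda>x. \<Psi> (max 0 (u x))) \<in> borel_measurable M"
    by (rule measurable_compose[OF assms(2)]) auto
  then show ?thesis using assms(3) by (simp add: max_absorb2)
qed

text \<open>Integrates a supporting line of \<open>\<Psi>\<close> at \<open>a\<close> against
  \<open>p\<close>. The slope is nonnegative, so an upper estimate of \<open>a\<close> by the mean
  suffices in place of equality, and the mean may be infinite.\<close>

lemma orlicz_jensen:
  assumes \<Psi>: "orlicz_function \<Psi>" and [measurable]: "u \<in> borel_measurable M" "p \<in> borel_measurable M"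
    and u: "\<And>x. u x \<ge> (0::real)" and p: "(\<integral>\<^sup>+x. p x \<partial>M) = 1"
    and a: "0 \<le> a" "ennreal a \<le> (\<integral>\<^sup>+x. p x * ennreal (u x) \<partial>M)"
  shows "ennreal (\<Psi> a) \<le> (\<integral>\<^sup>+x. p x * ennreal (\<Psi> (u x)) \<partial>M)"
proof (cases "a = 0")
  case True
  then show ?thesis by (simp add: orlicz_zero[OF \<Psi>])
next
  case False
  with a have a0: "a > 0" by simp
  note [measurable] = measurable_orlicz[OF \<Psi> assms(2) u]
  \<comment> \<open>\<open>k\<close> is the right derivative at \<open>a\<close>, as the infimum of
    the slopes to the right. The point \<open>a\<close> has to be interior to \<open>{0..}\<close>,
    hence the separate case \<open>a = 0\<close>.\<close>
  define k where "k = Inf ((\<lambda>t. (\<Psi> a - \<Psi> t) / (a - t)) ` ({a<..} \<inter> {0..}))"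
  have k: "\<Psi> y \<ge> \<Psi> a + k * (y - a)" if "y \<ge> 0" for y
    unfolding k_def by (rule convex_le_Inf_differential)
      (use \<Psi> a0 that in \<open>auto simp: orlicz_function_def interior_real_atLeast\<close>)
  have "\<Psi> a \<le> k * a" using k[of 0] orlicz_zero[OF \<Psi>] by simp
  then have k0: "k \<ge> 0"
    using orlicz_nonneg[OF \<Psi> a(1)] a0 by (metis dual_order.trans zero_le_mult_iff not_less)
  have "ennreal (\<Psi> a) + ennreal (k * a) \<le> ennreal (\<Psi> a) * (\<integral>\<^sup>+x. p x \<partial>M) + ennreal k * (\<integral>\<^sup>+x. p x * ennreal (u x) \<partial>M)"
    using a(2) k0 by (simp add: p ennreal_mult a(1) add_mono mult_left_mono)
  also have "\<dots> = (\<integral>\<^sup>+x. p x * ennreal (\<Psi> a + k * u x) \<partial>M)"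
  proof -
    have "p x * ennreal (\<Psi> a + k * u x) = ennreal (\<Psi> a) * p x + ennreal k * (p x * ennreal (u x))" for x
      using k0 u[of x] orlicz_nonneg[OF \<Psi> a(1)] by (simp add: ennreal_mult ennreal_plus distrib_left mult_ac)
    then show ?thesis by (simp add: nn_integral_add nn_integral_cmult)
  qed
  also have "\<dots> \<le> (\<integral>\<^sup>+x. p x * ennreal (\<Psi> (u x) + k * a) \<partial>M)"
    using k[OF u] by (intro nn_integral_mono mult_left_mono ennreal_leI) (auto simp: algebra_simps)
  also have "\<dots> = (\<integral>\<^sup>+x. p x * ennreal (\<Psi> (u x)) \<partial>M) + ennreal (k * a) * (\<integral>\<^sup>+x. p x \<partial>M)"
  proof -
    have "p x * ennreal (\<Psi> (u x) + k * a) = p x * ennreal (\<Psi> (u x)) + ennreal (k * a) * p x" for x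
      using k0 a(1) orlicz_nonneg[OF \<Psi> u] by (simp add: ennreal_plus distrib_left mult_ac)
    then show ?thesis by (simp add: nn_integral_add nn_integral_cmult)
  qed
  finally show ?thesis
    by (simp add: p)
qed

lemma orlicz_star:
  assumes \<Psi>: "orlicz_function \<Psi>" and "0 \<le> t" "t \<le> 1" "0 \<le> x"
  shows "\<Psi> (t * x) \<le> t * \<Psi> x"
proof -
  have "convex_on {0..} \<Psi>" using \<Psi> by (simp add: orlicz_function_def)
  from convex_onD[OF this, of t 0 x] assms show ?thesis by (simp add: orlicz_zero[OF \<Psi>])
qed

text \<open>Turns a modular bound into a norm bound: by convexity and \<open>\<Psi> 0 = 0\<close>,
  enlarging \<open>C\<close> by the factor \<open>K\<close> divides the modular by at least
  \<open>K\<close>.\<close>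

lemma orlicz_integral_le_1:
  assumes \<Psi>: "orlicz_function \<Psi>" and [measurable]: "v \<in> borel_measurable M" and v: "\<And>x. v x \<ge> (0::real)"
    and C: "C > 0" and K: "K \<ge> 1" and le: "(\<integral>\<^sup>+x. ennreal (\<Psi> (v x / C)) \<partial>M) \<le> ennreal K"
  shows "(\<integral>\<^sup>+x. ennreal (\<Psi> (v x / (K * C))) \<partial>M) \<le> 1"
proof -
  have [measurable]: "(\<lambda>x. \<Psi> (v x / C)) \<in> borel_measurable M"
    by (rule measurable_orlicz[OF \<Psi>]) (use C v in auto)
  have "(\<integral>\<^sup>+x. ennreal (\<Psi> (v x / (K * C))) \<partial>M) \<le> (\<integral>\<^sup>+x. ennreal (1 / K) * ennreal (\<Psi> (v x / C)) \<partial>M)"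
  proof (intro nn_integral_mono)
    fix x
    have "\<Psi> (1 / K * (v x / C)) \<le> 1 / K * \<Psi> (v x / C)"
      by (rule orlicz_star[OF \<Psi>]) (use K C v in auto)
    then show "ennreal (\<Psi> (v x / (K * C))) \<le> ennreal (1 / K) * ennreal (\<Psi> (v x / C))"
      using K by (subst ennreal_mult'[symmetric]) (auto intro!: ennreal_leI)
  qed
  also have "\<dots> = ennreal (1 / K) * (\<integral>\<^sup>+x. ennreal (\<Psi> (v x / C)) \<partial>M)"
    by (rule nn_integral_cmult) simp
  also have "\<dots> \<le> ennreal (1 / K) * ennreal K"
    by (intro mult_left_mono le) simp
  also have "\<dots> = 1" using K by (simp add: ennreal_mult[symmetric])
  finally show ?thesis .
qed

lemma ex_orlicz_integral_le_1:
  assumes \<Psi>: "orlicz_function \<Psi>" and v: "v \<in> borel_measurable M" "\<And>x. v x \<ge> (0::real)"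
    and C: "C > 0" and fin: "(\<integral>\<^sup>+x. ennreal (\<Psi> (v x / C)) \<partial>M) < \<infinity>"
  shows "\<exists>C'>0. (\<integral>\<^sup>+x. ennreal (\<Psi> (v x / C')) \<partial>M) \<le> 1"
proof -
  obtain k where "(\<integral>\<^sup>+x. ennreal (\<Psi> (v x / C)) \<partial>M) = ennreal k"
    using fin by (cases "\<integral>\<^sup>+x. ennreal (\<Psi> (v x / C)) \<partial>M") auto
  then have "(\<integral>\<^sup>+x. ennreal (\<Psi> (v x / C)) \<partial>M) \<le> ennreal (max 1 k)"
    by (auto intro!: ennreal_leI)
  from orlicz_integral_le_1[OF \<Psi> v C _ this] show ?thesis
    using C by (intro exI[of _ "max 1 k * C"]) auto
qed

lemma orlicz_integral_add_finite:
  assumes \<Psi>: "orlicz_function \<Psi>" and v [measurable]: "v \<in> borel_measurable M" "\<And>x. v x \<ge> (0::real)"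
    and w [measurable]: "w \<in> borel_measurable M" "\<And>x. w x \<ge> (0::real)"
    and C: "C > 0" "D > 0" and u: "\<And>x. 0 \<le> u x" "\<And>x. u x \<le> v x + w x"
    and fin: "(\<integral>\<^sup>+x. ennreal (\<Psi> (v x / C)) \<partial>M) < \<infinity>" "(\<integral>\<^sup>+x. ennreal (\<Psi> (w x / D)) \<partial>M) < \<infinity>"
  shows "(\<integral>\<^sup>+x. ennreal (\<Psi> (u x / (2 * max C D))) \<partial>M) < \<infinity>"
proof -
  have [measurable]: "(\<lambda>x. \<Psi> (v x / C)) \<in> borel_measurable M" "(\<lambda>x. \<Psi> (w x / D)) \<in> borel_measurable M"
    by (rule measurable_orlicz[OF \<Psi>]; use C v w in auto)+
  have "(\<integral>\<^sup>+x. ennreal (\<Psi> (u x / (2 * max C D))) \<partial>M) \<le> (\<integral>\<^sup>+x. ennreal (\<Psi> (v x / C)) + ennreal (\<Psi> (w x / D)) \<partial>M)"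
  proof (intro nn_integral_mono)
    fix x
    let ?E = "max C D"
    have E: "?E > 0" using C by simp
    have "u x / (2 * ?E) \<le> (v x + w x) / (2 * ?E)"
      using u(2) E by (intro divide_right_mono) auto
    also have "\<dots> = (v x / ?E + w x / ?E) / 2" using E by (simp add: field_simps)
    also have "\<dots> \<le> (v x / C + w x / D) / 2"
      using C E v w by (intro divide_right_mono add_mono divide_left_mono) auto
    also have "\<dots> \<le> max (v x / C) (w x / D)"
    proof -
      have "(a + b) / 2 \<le> max a b" for a b :: real by (auto simp: max_def field_simps)
      then show ?thesis .
    qed
    finally have "\<Psi> (u x / (2 * ?E)) \<le> \<Psi> (max (v x / C) (w x / D))"
      using u(1) E by (intro orlicz_mono[OF \<Psi>]) auto
    also have "\<dots> \<le> \<Psi> (v x / C) + \<Psi> (w x / D)"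
      using orlicz_nonneg[OF \<Psi>, of "v x / C"] orlicz_nonneg[OF \<Psi>, of "w x / D"] v(2)[of x] w(2)[of x] C
      by (auto simp: max_def)
    finally show "ennreal (\<Psi> (u x / (2 * ?E))) \<le> ennreal (\<Psi> (v x / C)) + ennreal (\<Psi> (w x / D))"
      using orlicz_nonneg[OF \<Psi>, of "v x / C"] orlicz_nonneg[OF \<Psi>, of "w x / D"] v(2)[of x] w(2)[of x] C
      by (subst ennreal_plus[symmetric]) (auto simp del: ennreal_plus intro!: ennreal_leI)
  qed
  also have "\<dots> < \<infinity>" using fin by (subst nn_integral_add) auto
  finally show ?thesis .
qed

text \<open>The witness \<open>C0\<close> makes the set under the infimum nonempty; the real
  \<open>Inf\<close> of the empty set would carry no information.\<close>

lemma orlicz_norm_lessD: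
  assumes "orlicz_norm M f < \<eta>" "C0 > 0" "M f C0 \<le> 1"
  obtains C where "C > 0" "C < \<eta>" "M f C \<le> 1"
proof -
  have "{C. C > 0 \<and> M f C \<le> 1} \<noteq> {}" using assms by auto
  from cInf_lessD[OF this] assms(1) that show ?thesis unfolding orlicz_norm_def by auto
qed

lemma orlicz_norm_le:
  assumes "C > 0" "M f C \<le> 1"
  shows "orlicz_norm M f \<le> C"
  unfolding orlicz_norm_def by (rule cInf_lower) (use assms in \<open>auto intro!: bdd_belowI[of _ 0]\<close>)

lemma orlicz_norm_nonneg:
  assumes "C > 0" "M f C \<le> 1"
  shows "orlicz_norm M f \<ge> 0"
  unfolding orlicz_norm_def by (rule cInf_greatest) (use assms in auto)

text \<open>Lets every computation with boundary values run on a Borel function that agrees with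
  them almost everywhere.\<close>

lemma circle_modular_eq:
  assumes \<Psi>: "orlicz_function \<Psi>" and [measurable]: "u \<in> borel_measurable borel"
    and bd: "AE t in circ. g (cis t) = u t" and C: "C > 0"
  shows "circle_modular \<Psi> g C = (\<integral>\<^sup>+t. ennreal (\<Psi> (norm (u t) / C)) \<partial>circ)"
proof -
  have [measurable]: "(\<lambda>t. \<Psi> (norm (u t) / C)) \<in> borel_measurable borel"
    by (rule measurable_orlicz[OF \<Psi>]) (use C in auto)
  have "(\<integral>\<^sup>+ t \<in> {0..2*pi}. ennreal (\<Psi> (norm (g (cis t)) / C)) \<partial>lborel) = (\<integral>\<^sup>+ t \<in> {0..2*pi}. ennreal (\<Psi> (norm (u t) / C)) \<partial>lborel)"
    by (rule nn_integral_cong_AE) (use bd in \<open>auto simp: AE_circ_iff indicator_def elim!: eventually_mono\<close>)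
  then show ?thesis
    unfolding circle_modular_def by (simp add: nn_integral_circ)
qed

text \<open>Jensen's inequality for the probability density \<open>poisson z\<close>, followed by
  the kernel bound \<open>poisson_le\<close>. The first power of \<open>1 - norm z\<close> comes
  from the latter.\<close>

lemma hardy1_orlicz_bound:
  assumes \<Psi>: "orlicz_function \<Psi>" and f: "f \<in> hardy1" and C: "C > 0" and z: "norm z < 1"
  shows "ennreal (\<Psi> (norm (f z) / C)) \<le> ennreal (2 / (1 - norm z)) * circle_modular \<Psi> (boundary f) C"
proof -
  obtain u where [measurable]: "u \<in> borel_measurable borel" and bd: "AE t in circ. boundary f (cis t) = u t"
    and rep: "f z = (\<integral>t. u t * of_real (poisson z t) \<partial>circ)"
    using hardy1_representation[OF f] z by metis
  have [measurable]: "poisson z \<in> borel_measurable borel"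
    by (intro borel_measurable_continuous_onI continuous_intros z)
  have pz: "0 \<le> poisson z t" "poisson z t \<le> 2 / (1 - norm z)" for t
    using poisson_le[OF z] z by (auto intro: poisson_nonneg)
  have [measurable]: "(\<lambda>t. \<Psi> (norm (u t) / C)) \<in> borel_measurable borel"
    by (rule measurable_orlicz[OF \<Psi>]) (use C in auto)
  have "ennreal (norm (f z)) \<le> (\<integral>\<^sup>+t. ennreal (poisson z t) * ennreal (norm (u t)) \<partial>circ)"
  \<comment> \<open>Without integrability the Bochner integral that represents \<open>f z\<close> is
    0 by default, and the estimate is trivial.\<close>
  proof (cases "integrable circ (\<lambda>t. u t * of_real (poisson z t))")
    case True
    have "ennreal (norm (f z)) \<le> (\<integral>\<^sup>+t. ennreal (norm (u t * of_real (poisson z t))) \<partial>circ)"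
      unfolding rep by (rule integral_norm_bound_ennreal[OF True])
    then show ?thesis using pz by (simp add: norm_mult ennreal_mult mult.commute)
  qed (simp add: rep not_integrable_integral_eq)
  also have "\<dots> = ennreal C * (\<integral>\<^sup>+t. ennreal (poisson z t) * ennreal (norm (u t) / C) \<partial>circ)"
  proof -
    have "ennreal (poisson z t) * ennreal (norm (u t)) = ennreal C * (ennreal (poisson z t) * ennreal (norm (u t) / C))" for t
      using C pz[of t] by (simp add: ennreal_mult[symmetric])
    then show ?thesis by (simp add: nn_integral_cmult)
  qed
  finally have "ennreal (1 / C) * ennreal (norm (f z)) \<le> ennreal (1 / C) * (ennreal C * (\<integral>\<^sup>+t. ennreal (poisson z t) * ennreal (norm (u t) / C) \<partial>circ))"
    by (rule mult_left_mono) simp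
  then have "ennreal (norm (f z) / C) \<le> (\<integral>\<^sup>+t. ennreal (poisson z t) * ennreal (norm (u t) / C) \<partial>circ)"
    using C by (simp add: ennreal_mult[symmetric] mult.assoc[symmetric])
  then have "ennreal (\<Psi> (norm (f z) / C)) \<le> (\<integral>\<^sup>+t. ennreal (poisson z t) * ennreal (\<Psi> (norm (u t) / C)) \<partial>circ)"
    using C by (intro orlicz_jensen[OF \<Psi>] nn_integral_poisson z) auto
  also have "\<dots> \<le> (\<integral>\<^sup>+t. ennreal (2 / (1 - norm z)) * ennreal (\<Psi> (norm (u t) / C)) \<partial>circ)"
    by (intro nn_integral_mono mult_right_mono ennreal_leI pz) auto
  also have "\<dots> = ennreal (2 / (1 - norm z)) * circle_modular \<Psi> (boundary f) C"
    by (subst circle_modular_eq[OF \<Psi> _ bd C]) (auto simp: nn_integral_cmult)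
  finally show ?thesis .
qed

section \<open>The Orlicz function and the symbol\<close>

definition knot :: "nat \<Rightarrow> real" where
  "knot n = fact (Suc n)"

lemma knot_ge1: "knot n \<ge> 1"
  unfolding knot_def by (rule fact_ge_1)

lemma knot_pos: "knot n > 0"
  using knot_ge1[of n] by linarith

lemma knot_Suc: "knot (Suc n) = (real n + 2) * knot n"
  by (simp add: knot_def algebra_simps)

lemma knot_double: "2 * knot n \<le> knot (Suc n)"
  using knot_pos[of n] unfolding knot_Suc by (intro mult_right_mono) auto

lemma knot_mono: "n \<le> m \<Longrightarrow> knot n \<le> knot m"
  unfolding knot_def by (intro fact_mono) auto

lemma knot_ge: "real n \<le> knot n"
proof (induction n)
  case (Suc n)
  then show ?case using knot_double[of n] knot_ge1[of n] by simp
qed (simp add: knot_def)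

text \<open>The jump of the slope at a knot is chosen to give \<open>\<Psi>(2y\<^sub>n) \<ge> 4\<^sup>n\<^sup>+\<^sup>3 \<Psi>(y\<^sub>n)\<^sup>4\<close>.\<close>
primrec psi_upto :: "nat \<Rightarrow> real \<Rightarrow> real" where
  "psi_upto 0 x = x"
| "psi_upto (Suc n) x = psi_upto n x + 4 ^ (n + 3) * (psi_upto n (knot n)) ^ 4 * max 0 (x - knot n)"

text \<open>The stage \<open>nat \<lceil>x\<rceil>\<close> is late enough because
  \<open>knot n \<ge> n\<close>: all later corrections vanish at \<open>x\<close>. By
  \<open>psi_eq\<close> any stage \<open>n\<close> with \<open>x \<le> knot n\<close> gives the same
  value.\<close>

definition psi :: "real \<Rightarrow> real" where
  "psi x = psi_upto (nat \<lceil>x\<rceil>) x"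

lemma psi_upto_stable: "x \<le> knot n \<Longrightarrow> n \<le> m \<Longrightarrow> psi_upto m x = psi_upto n x"
proof (induction m)
  case (Suc m)
  then show ?case
  proof (cases "n = Suc m")
    case False
    with Suc have "n \<le> m" by simp
    then have "x \<le> knot m" using knot_mono[of n m] Suc by simp
    with Suc \<open>n \<le> m\<close> show ?thesis by simp
  qed simp
qed simp

lemma psi_eq:
  assumes "x \<le> knot n"
  shows "psi x = psi_upto n x"
proof -
  have "x \<le> knot (nat \<lceil>x\<rceil>)"
    using knot_ge[of "nat \<lceil>x\<rceil>"] by linarith
  from psi_upto_stable[OF assms, of "nat \<lceil>x\<rceil>"] psi_upto_stable[OF this, of n] show ?thesis
    unfolding psi_def by (metis nle_le)
qed

lemma psi_upto_ge: "x \<ge> 0 \<Longrightarrow> psi_upto n x \<ge> x"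
  by (induction n) (auto intro: order.trans add_increasing2)

lemma psi_upto_mono: "x \<le> y \<Longrightarrow> psi_upto n x \<le> psi_upto n y"
  by (induction n) (auto intro!: add_mono mult_left_mono)

lemma psi_upto_convex:
  assumes "0 \<le> u" "0 \<le> v" "u + v = 1"
  shows "psi_upto n (u * x + v * y) \<le> u * psi_upto n x + v * psi_upto n y"
proof (induction n)
  case (Suc n)
  let ?c = "4 ^ (n + 3) * (psi_upto n (knot n)) ^ 4"
  let ?m = "\<lambda>x. max 0 (x - knot n)"
  have "u * x + v * y - knot n = u * (x - knot n) + v * (y - knot n)"
    using assms(3) by (simp add: algebra_simps flip: distrib_right)
  also have "\<dots> \<le> u * ?m x + v * ?m y"
    using assms by (intro add_mono mult_left_mono) auto
  finally have "?m (u * x + v * y) \<le> u * ?m x + v * ?m y"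
    using assms by simp
  then have "?c * ?m (u * x + v * y) \<le> ?c * (u * ?m x + v * ?m y)"
    by (intro mult_left_mono) auto
  with Suc show ?case by (simp add: algebra_simps)
qed simp

lemma psi_ge: "x \<ge> 0 \<Longrightarrow> psi x \<ge> x"
  unfolding psi_def by (rule psi_upto_ge)

lemma psi_mono:
  assumes "x \<le> y"
  shows "psi x \<le> psi y"
proof -
  have "y \<le> knot (nat \<lceil>y\<rceil>)" using knot_ge[of "nat \<lceil>y\<rceil>"] by linarith
  then show ?thesis using assms psi_upto_mono[OF assms] by (simp add: psi_eq[of _ "nat \<lceil>y\<rceil>"])
qed

lemma orlicz_psi: "orlicz_function psi"
  unfolding orlicz_function_def
proof (intro conjI allI impI)
  show "0 \<le> psi x" if "0 \<le> x" for x using psi_ge[OF that] that by linarith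
  show "0 < psi x" if "0 < x" for x using psi_ge[of x] that by linarith
  show "mono_on {0..} psi" by (intro mono_onI psi_mono)
  show "psi 0 = 0" by (simp add: psi_def)
  show "filterlim psi at_top at_top"
    by (rule filterlim_at_top_mono[OF filterlim_ident])
       (rule eventually_mono[OF eventually_ge_at_top[of 0] psi_ge])
  show "convex_on {0..} psi"
  proof (rule convex_onI)
    fix t x y :: real assume t: "0 < t" "t < 1" and xy: "x \<in> {0..}" "y \<in> {0..}"
    define n where "n = nat \<lceil>max x y\<rceil>"
    have n: "max x y \<le> knot n" using knot_ge[of n] unfolding n_def by linarith
    have "(1 - t) * x + t * y \<le> (1 - t) * max x y + t * max x y"
      using t by (intro add_mono mult_left_mono) auto
    also have "\<dots> = max x y" by (simp add: algebra_simps)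
    finally have "(1 - t) * x + t * y \<le> knot n" using n by (rule order.trans)
    then show "psi ((1 - t) *\<^sub>R x + t *\<^sub>R y) \<le> (1 - t) * psi x + t * psi y"
      using n psi_upto_convex[of "1 - t" t n x y] t by (simp add: psi_eq[of _ n])
  qed simp
qed

lemma psi_upto_diff: "x \<le> y \<Longrightarrow> psi_upto n y - psi_upto n x \<ge> y - x"
proof (induction n)
  case (Suc n)
  have "4 ^ (n + 3) * (psi_upto n (knot n)) ^ 4 * max 0 (x - knot n) \<le> 4 ^ (n + 3) * (psi_upto n (knot n)) ^ 4 * max 0 (y - knot n)"
    using Suc.prems by (intro mult_left_mono) auto
  with Suc show ?case unfolding psi_upto.simps(2) by linarith
qed simp

lemma psi_le_cancel:
  assumes "psi x \<le> psi y"
  shows "x \<le> y"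
proof (rule ccontr)
  assume "\<not> x \<le> y"
  then have xy: "y < x" by simp
  have "x \<le> knot (nat \<lceil>x\<rceil>)" using knot_ge[of "nat \<lceil>x\<rceil>"] by linarith
  with assms xy psi_upto_diff[of y x "nat \<lceil>x\<rceil>"] show False
    by (simp add: psi_eq[of _ "nat \<lceil>x\<rceil>"])
qed

lemma psi_id: "x \<le> 1 \<Longrightarrow> psi x = x"
  using psi_eq[of x 0] by (simp add: knot_def)

text \<open>
  In the notation of the introduction, \<open>knot\<close> is \<open>y\<close>, \<open>psi1\<close> is \<open>P\<close>, \<open>psi2\<close> is \<open>Q\<close>, \<open>gap\<close> is \<open>\<delta>\<close> and
  \<open>width\<close> is \<open>\<ell>\<close>.
\<close>
definition psi1 :: "nat \<Rightarrow> real" where "psi1 n = psi (knot n)"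
definition psi2 :: "nat \<Rightarrow> real" where "psi2 n = psi (2 * knot n)"

lemma psi1_ge: "psi1 n \<ge> knot n"
  unfolding psi1_def using knot_pos[of n] by (intro psi_ge) simp

lemma psi1_ge1: "psi1 n \<ge> 1"
  using psi1_ge[of n] knot_ge1[of n] by simp

lemma psi2_ge: "psi2 n \<ge> 4 ^ (n + 3) * psi1 n ^ 4 * knot n"
proof -
  have "psi2 n = psi_upto n (2 * knot n) + 4 ^ (n + 3) * (psi_upto n (knot n)) ^ 4 * max 0 (2 * knot n - knot n)"
    unfolding psi2_def using psi_eq[OF knot_double[of n]] by simp
  moreover have "psi_upto n (2 * knot n) \<ge> 0"
    using psi_upto_ge[of "2 * knot n" n] knot_pos[of n] by simp
  moreover have "psi1 n = psi_upto n (knot n)"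
    unfolding psi1_def by (rule psi_eq) simp
  ultimately show ?thesis using knot_pos[of n] by simp
qed

lemma psi2_ge': "psi2 n \<ge> 4 ^ (n + 3) * psi1 n ^ 4"
proof -
  have "4 ^ (n + 3) * psi1 n ^ 4 * 1 \<le> 4 ^ (n + 3) * psi1 n ^ 4 * knot n"
    by (intro mult_left_mono knot_ge1) auto
  then show ?thesis using psi2_ge[of n] by linarith
qed

lemma psi2_le: "psi2 n \<le> psi1 (Suc n)"
  unfolding psi1_def psi2_def by (intro psi_mono knot_double)

lemma psi2_ge64: "psi2 n \<ge> 64 * psi1 n"
proof -
  have "64 * psi1 n \<le> 4 ^ (n + 3) * psi1 n ^ 4"
  proof (rule mult_mono)
    have "(4::real) ^ 3 \<le> 4 ^ (n + 3)" by (intro power_increasing) auto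
    then show "(64::real) \<le> 4 ^ (n + 3)" by simp
    show "psi1 n \<le> psi1 n ^ 4" using psi1_ge1[of n] by (intro self_le_power) auto
  qed (use psi1_ge1[of n] in auto)
  then show ?thesis using psi2_ge'[of n] by simp
qed

lemma psi2_pos: "psi2 n > 0"
  using psi2_ge64[of n] psi1_ge1[of n] by simp

lemma psi2_Suc: "psi2 (Suc n) \<ge> 64 * psi2 n"
  using psi2_ge64[of "Suc n"] psi2_le[of n] by simp

lemma psi2_exp: "psi2 n \<ge> 64 * 2 ^ n"
proof (induction n)
  case 0
  then show ?case using psi2_ge64[of 0] psi1_ge1[of 0] by simp
next
  case (Suc n)
  then show ?case using psi2_Suc[of n] psi2_pos[of n] by simp
qed

text \<open>The last kink of stage \<open>Suc n\<close> sits at \<open>knot n\<close>. Hence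
  \<open>psi\<close> is affine between consecutive knots, the form in which this is used in
  \<open>psi1_Suc_le\<close>.\<close>

lemma psi_upto_affine:
  "\<exists>s. \<forall>x\<ge>knot n. psi_upto (Suc n) x = psi_upto (Suc n) (knot n) + s * (x - knot n)"
proof (induction n)
  case 0
  show ?case by (rule exI[of _ "1 + 4 ^ 3 * (knot 0) ^ 4"]) (auto simp: algebra_simps)
next
  case (Suc n)
  then obtain s where s: "\<And>x. x \<ge> knot n \<Longrightarrow> psi_upto (Suc n) x = psi_upto (Suc n) (knot n) + s * (x - knot n)"
    by blast
  let ?c = "4 ^ (Suc n + 3) * (psi_upto (Suc n) (knot (Suc n))) ^ 4"
  have "psi_upto (Suc (Suc n)) x = psi_upto (Suc (Suc n)) (knot (Suc n)) + (s + ?c) * (x - knot (Suc n))" if "x \<ge> knot (Suc n)" for x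
  proof -
    have "knot n \<le> knot (Suc n)" by (intro knot_mono) simp
    then have "psi_upto (Suc n) x = psi_upto (Suc n) (knot (Suc n)) + s * (x - knot (Suc n))"
      using s[of x] s[of "knot (Suc n)"] that by (simp add: algebra_simps del: psi_upto.simps)
    then show ?thesis
      unfolding psi_upto.simps(2)[of "Suc n"] using that by (simp add: algebra_simps del: psi_upto.simps)
  qed
  then show ?case by blast
qed

text \<open>The enormous growth takes place just after the knot, between \<open>knot n\<close> and
  \<open>2 * knot n\<close>. As \<open>psi\<close> is affine up to
  \<open>knot (Suc n) = (n + 2) * knot n\<close>, the rest of the interval costs no more than the
  linear factor \<open>n + 2\<close>.\<close>

lemma psi1_Suc_le: "psi1 (Suc n) \<le> (real n + 2) * psi2 n"
proof -
  obtain s where s: "\<And>x. x \<ge> knot n \<Longrightarrow> psi_upto (Suc n) x = psi_upto (Suc n) (knot n) + s * (x - knot n)"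
    using psi_upto_affine by blast
  have e: "psi x = psi1 n + s * (x - knot n)" if "x \<ge> knot n" "x \<le> knot (Suc n)" for x
    using s[OF that(1)] psi_eq[OF that(2)] psi_eq[OF order.trans[OF that]] by (simp add: psi1_def)
  have Q: "psi2 n = psi1 n + s * knot n"
    unfolding psi2_def using e[of "2 * knot n"] knot_double[of n] knot_pos[of n] by simp
  have P: "psi1 (Suc n) = psi1 n + s * ((real n + 1) * knot n)"
    using e[of "knot (Suc n)"] knot_mono[of n "Suc n"] by (simp add: psi1_def knot_Suc algebra_simps)
  have "s * knot n \<ge> 0" using Q psi2_ge64[of n] psi1_ge1[of n] by simp
  moreover have "(real n + 1) * psi1 n \<ge> 0" using psi1_ge1[of n] by simp
  moreover have "(real n + 2) * psi2 n - psi1 (Suc n) = (real n + 1) * psi1 n + s * knot n"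
    unfolding P Q by (simp add: algebra_simps)
  ultimately show ?thesis by linarith
qed

text \<open>With the constant 8, \<open>2 / (gap n / 4) = psi2 n\<close>: the Hardy estimate at
  depth \<open>gap n / 4\<close> becomes the value of \<open>psi\<close> at
  \<open>2 * knot n\<close> exactly.\<close>

definition gap :: "nat \<Rightarrow> real" where "gap n = 8 / psi2 n"
text \<open>On the arc at scale \<open>width n\<close> the majorant is of size
  \<open>2 * knot (n + 1)\<close>. Any fixed dilation keeps it below \<open>knot (n + 2)\<close> for
  large \<open>n\<close>, hence the index \<open>n + 2\<close>; the factor \<open>(1/2) ^ n\<close>
  is left for summation.\<close>

definition width :: "nat \<Rightarrow> real" where "width n = (1/2) ^ n / psi1 (n + 2)"

lemma gap_pos: "gap n > 0"
  using psi2_pos[of n] by (simp add: gap_def)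

lemma gap_Suc: "gap (Suc n) \<le> gap n / 2"
proof -
  have "8 / psi2 (Suc n) \<le> 8 / (2 * psi2 n)"
    using psi2_Suc[of n] psi2_pos[of n] by (intro divide_left_mono) auto
  then show ?thesis by (simp add: gap_def)
qed

lemma gap_add: "gap (n + k) \<le> gap n * (1/2) ^ k"
proof (induction k)
  case (Suc k)
  then show ?case using gap_Suc[of "n + k"] by simp
qed simp

lemma gap_0: "gap 0 \<le> 1 / 8"
proof -
  have "8 / psi2 0 \<le> 8 / 64"
    using psi2_exp[of 0] by (intro divide_left_mono) auto
  then show ?thesis by (simp add: gap_def)
qed

lemma summable_gap: "summable gap"
  by (rule summable_comparison_test'[of "\<lambda>k. gap 0 * (1/2) ^ k" 0])
     (use gap_add[of 0] gap_pos in \<open>auto simp: less_imp_le intro!: summable_mult summable_geometric\<close>)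

lemma suminf_gap_tail: "(\<Sum>k. gap (n + k)) \<le> 2 * gap n"
proof -
  have "(\<Sum>k. gap (n + k)) \<le> (\<Sum>k. gap n * (1/2) ^ k)"
    by (intro suminf_le gap_add summable_mult summable_geometric)
       (use summable_ignore_initial_segment[OF summable_gap, of n] in \<open>auto simp: add.commute\<close>)
  also have "\<dots> = 2 * gap n"
    by (subst suminf_mult) (auto simp: suminf_geometric summable_geometric)
  finally show ?thesis .
qed

lemma suminf_gap: "(\<Sum>k. gap k) \<le> 1"
  using suminf_gap_tail[of 0] gap_0 by simp

lemma width_pos: "width n > 0"
  using psi1_ge1[of "n + 2"] by (simp add: width_def)

lemma width_antimono: "n \<le> m \<Longrightarrow> width m \<le> width n"
  unfolding width_def using psi1_ge1[of "n + 2"]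
  by (intro frac_le power_decreasing) (auto simp: psi1_def intro!: psi_mono knot_mono)

lemma width_le: "width n \<le> (1/2) ^ n"
  unfolding width_def using psi1_ge1[of "n + 2"] by (simp add: divide_le_eq)

lemma ex_width_less:
  assumes "e > 0"
  obtains n where "width n < e"
proof -
  obtain n where "(1/2) ^ n < e" using real_arch_pow_inv[OF assms, of "1/2"] by auto
  then show ?thesis using width_le[of n] that by (meson le_less_trans)
qed

section \<open>The symbol\<close>

definition phi_term :: "nat \<Rightarrow> complex \<Rightarrow> complex" where
  "phi_term n z = of_real (gap n) * ((1 - z) / (1 - z + of_real (width n)))"

text \<open>Each \<open>phi_term n\<close> is a smoothed step of height \<open>gap n\<close>: close
  to \<open>gap n\<close> where \<open>norm (1 - z)\<close> is much larger than
  \<open>width n\<close>, and vanishing linearly at 1. Thus \<open>1 - phi\<close> collects at each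
  distance from 1 essentially the gaps of the scales that are resolved there.\<close>

definition phi :: "complex \<Rightarrow> complex" where
  "phi z = 1 - (\<Sum>n. phi_term n z)"

lemma norm_plus_of_real_ge:
  assumes "Re w \<ge> 0" "l > 0"
  shows "(norm (w + of_real l))\<^sup>2 \<ge> (norm w)\<^sup>2 + l\<^sup>2"
proof -
  have "0 \<le> Re w * l" using assms by simp
  then show ?thesis unfolding cmod_power2 by (simp add: power2_eq_square algebra_simps)
qed

lemma Re_one_minus: "norm (z::complex) \<le> 1 \<Longrightarrow> Re (1 - z) \<ge> 0"
  using complex_Re_le_cmod[of z] by simp

lemma one_minus_width_nz: "norm (z::complex) \<le> 1 \<Longrightarrow> 1 - z + of_real (width n) \<noteq> 0"
  using Re_one_minus[of z] width_pos[of n] by (auto simp: complex_eq_iff)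

lemma norm_phi_term:
  assumes z: "norm z \<le> 1"
  shows "norm (phi_term n z) \<le> gap n"
proof -
  have "(norm (1 - z))\<^sup>2 \<le> (norm (1 - z + of_real (width n)))\<^sup>2"
    using norm_plus_of_real_ge[OF Re_one_minus[OF z] width_pos[of n]] by (smt (verit) zero_le_power2)
  then have "norm (1 - z) \<le> norm (1 - z + of_real (width n))"
    by (rule power2_le_imp_le) simp
  then have "norm ((1 - z) / (1 - z + of_real (width n))) \<le> 1"
    by (simp add: norm_divide divide_le_eq_1)
  then have "gap n * norm ((1 - z) / (1 - z + of_real (width n))) \<le> gap n * 1"
    using gap_pos[of n] by (intro mult_left_mono) auto
  then show ?thesis
    using gap_pos[of n] by (simp only: phi_term_def norm_mult norm_of_real abs_of_pos mult_1_right)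
qed

lemma phi_uniform: "uniform_limit (cball 0 1) (\<lambda>N z. \<Sum>n<N. phi_term n z) (\<lambda>z. \<Sum>n. phi_term n z) sequentially"
  by (rule Weierstrass_m_test[OF _ summable_gap]) (use norm_phi_term in auto)

lemma continuous_phi: "continuous_on (cball 0 1) phi"
proof -
  have "continuous_on (cball 0 1) (\<lambda>z. \<Sum>n. phi_term n z)"
    by (rule uniform_limit_theorem[OF _ phi_uniform])
       (auto simp: phi_term_def one_minus_width_nz intro!: continuous_intros always_eventually)
  then show ?thesis unfolding phi_def[abs_def] by (intro continuous_intros)
qed

lemma holomorphic_phi: "phi holomorphic_on ball 0 1"
proof -
  have "(\<lambda>z. \<Sum>n. phi_term n z) holomorphic_on ball 0 1"
  proof (rule holomorphic_uniform_sequence[where f = "\<lambda>N z. \<Sum>n<N. phi_term n z"])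
    show "(\<lambda>z. \<Sum>n<N. phi_term n z) holomorphic_on ball 0 1" for N
      unfolding phi_term_def by (intro holomorphic_intros) (auto simp: one_minus_width_nz)
    fix x :: complex assume "x \<in> ball 0 1"
    then obtain d where d: "d > 0" "cball x d \<subseteq> ball 0 1" using open_contains_cball by blast
    then show "\<exists>d>0. cball x d \<subseteq> ball 0 1 \<and> uniform_limit (cball x d) (\<lambda>N z. \<Sum>n<N. phi_term n z) (\<lambda>z. \<Sum>n. phi_term n z) sequentially"
      by (intro exI[of _ d] conjI uniform_limit_on_subset[OF phi_uniform]) auto
  qed auto
  then show ?thesis unfolding phi_def[abs_def] by (intro holomorphic_intros)
qed

text \<open>\<open>phi z\<close> is a convex combination of 1 and of the points \<open>q n\<close>
  of the closed disc; the weight of 1 is nonnegative by \<open>suminf_gap\<close>. Every index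
  contributes a nonnegative amount to \<open>1 - norm (phi z)\<close>, and index \<open>k\<close>
  alone contributes a quarter of its weight.\<close>

lemma phi_gap:
  assumes z: "norm z \<le> 1" and k: "norm (1 - z) \<ge> width k"
  shows "1 - norm (phi z) \<ge> gap k / 4"
proof -
  define q where "q n = of_real (width n) / (1 - z + of_real (width n))" for n
  have q1: "norm (q n) \<le> 1" for n
  proof -
    have "(width n)\<^sup>2 \<le> (norm (1 - z + of_real (width n)))\<^sup>2"
      using norm_plus_of_real_ge[OF Re_one_minus[OF z] width_pos[of n]] by (smt (verit) zero_le_power2)
    then have "width n \<le> norm (1 - z + of_real (width n))"
      by (rule power2_le_imp_le) simp
    then show ?thesis using width_pos[of n] by (simp add: q_def norm_divide divide_le_eq_1)
  qed
  \<comment> \<open>At distance at least \<open>width k\<close> the inequality of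
    \<open>norm_plus_of_real_ge\<close> gives \<open>1 / sqrt 2\<close>; the rational
    \<open>3 / 4\<close> is enough, as \<open>16 / 9 \<le> 2\<close>.\<close>
  have qk: "norm (q k) \<le> 3 / 4"
  proof -
    have "(width k)\<^sup>2 \<le> (norm (1 - z))\<^sup>2" using k width_pos[of k] by (intro power_mono) auto
    then have "(4 / 3 * width k)\<^sup>2 \<le> (norm (1 - z + of_real (width k)))\<^sup>2"
    proof -
      have "(4 / 3 * width k)\<^sup>2 = 16 / 9 * (width k)\<^sup>2" by (simp add: power2_eq_square)
      with \<open>(width k)\<^sup>2 \<le> (norm (1 - z))\<^sup>2\<close> show ?thesis
        using norm_plus_of_real_ge[OF Re_one_minus[OF z] width_pos[of k]] zero_le_power2[of "width k"]
        by linarith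
    qed
    then have "4 / 3 * width k \<le> norm (1 - z + of_real (width k))"
      by (rule power2_le_imp_le) simp
    then show ?thesis using width_pos[of k] one_minus_width_nz[OF z, of k] by (simp add: q_def norm_divide divide_le_eq)
  qed
  have pt: "phi_term n z = of_real (gap n) - of_real (gap n) * q n" for n
    using one_minus_width_nz[OF z, of n] by (simp add: phi_term_def q_def field_simps)
  have sg: "summable (\<lambda>n. complex_of_real (gap n))"
    using summable_gap by (simp add: summable_of_real_iff)
  have sq': "summable (\<lambda>n. norm (of_real (gap n) * q n))"
    by (rule summable_comparison_test'[OF summable_gap, of 0])
       (use q1 gap_pos in \<open>auto simp: norm_mult less_imp_le intro!: mult_left_le\<close>)
  then have sq: "summable (\<lambda>n. of_real (gap n) * q n)" by (rule summable_norm_cancel)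
  have "phi z = of_real (1 - (\<Sum>n. gap n)) + (\<Sum>n. of_real (gap n) * q n)"
    unfolding phi_def pt suminf_diff[OF sg sq, symmetric] by (simp add: suminf_of_real[OF summable_gap])
  then have "norm (phi z) \<le> norm (complex_of_real (1 - (\<Sum>n. gap n))) + norm (\<Sum>n. of_real (gap n) * q n)"
    by (metis norm_triangle_ineq)
  also have "norm (complex_of_real (1 - (\<Sum>n. gap n))) = 1 - (\<Sum>n. gap n)"
    unfolding norm_of_real using suminf_gap by simp
  also have "norm (\<Sum>n. of_real (gap n) * q n) \<le> (\<Sum>n. norm (of_real (gap n) * q n))"
    by (rule summable_norm[OF sq'])
  finally have 1: "1 - norm (phi z) \<ge> (\<Sum>n. gap n) - (\<Sum>n. norm (of_real (gap n) * q n))" by simp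
  have "(\<Sum>n. gap n) - (\<Sum>n. norm (of_real (gap n) * q n)) = (\<Sum>n. gap n - norm (of_real (gap n) * q n))"
    by (rule suminf_diff[OF summable_gap sq'])
  also have "\<dots> \<ge> gap k - norm (of_real (gap k) * q k)"
  proof -
    have "(\<Sum>n\<in>{k}. gap n - norm (of_real (gap n) * q n)) \<le> (\<Sum>n. gap n - norm (of_real (gap n) * q n))"
      using q1 gap_pos
      by (intro sum_le_suminf summable_diff summable_gap sq') (auto simp: norm_mult less_imp_le intro!: mult_left_le)
    then show ?thesis by simp
  qed
  finally have 2: "(\<Sum>n. gap n) - (\<Sum>n. norm (of_real (gap n) * q n)) \<ge> gap k - norm (of_real (gap k) * q k)" by simp
  have "norm (of_real (gap k) * q k) \<le> gap k * (3 / 4)"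
    using gap_pos[of k] qk by (simp add: norm_mult)
  with 1 2 show ?thesis by simp
qed

lemma norm_phi_less_1:
  assumes "norm z \<le> 1" "z \<noteq> 1"
  shows "norm (phi z) < 1"
proof -
  obtain k where "width k < norm (1 - z)" using ex_width_less[of "norm (1 - z)"] assms by (metis right_minus_eq zero_less_norm_iff)
  with phi_gap[OF assms(1), of k] gap_pos[of k] show ?thesis by simp
qed

lemma analytic_selfmap_phi: "analytic_selfmap phi"
  unfolding analytic_selfmap_def using holomorphic_phi by (auto intro!: norm_phi_less_1)

lemma norm_phi_ball: "norm z < 1 \<Longrightarrow> norm (phi z) < 1"
  using analytic_selfmap_phi by (auto simp: analytic_selfmap_def image_subset_iff)

definition peak :: "nat \<Rightarrow> real" where "peak n = gap (Suc n) * width n"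

text \<open>The depth \<open>peak n\<close> is chosen to make two contributions comparable. Terms
  with \<open>j > n\<close> are at most \<open>gap j\<close> and sum to at most
  \<open>2 * gap (Suc n)\<close>. Terms with \<open>j \<le> n\<close> are at most
  \<open>gap j * peak n / width n = gap j * gap (Suc n)\<close>, and the gaps sum to at most
  1.\<close>

lemma phi_peak:
  obtains u where "phi (of_real (1 - peak n)) = of_real (1 - u)" "0 \<le> u" "u \<le> 3 * gap (Suc n)"
proof -
  define h where "h = peak n"
  have h: "h > 0" using gap_pos width_pos by (simp add: h_def peak_def)
  define v where "v j = gap j * (h / (h + width j))" for j
  have v0: "v j \<ge> 0" for j using gap_pos[of j] width_pos[of j] h by (simp add: v_def)
  have pt: "phi_term j (of_real (1 - h)) = of_real (v j)" for j
    by (simp add: phi_term_def v_def)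
  have vg: "v j \<le> gap j" for j
  proof -
    have "h / (h + width j) \<le> 1" using width_pos[of j] h by simp
    then show ?thesis
      unfolding v_def using gap_pos[of j] by (intro mult_left_le) auto
  qed
  have sv: "summable v"
    by (rule summable_comparison_test'[OF summable_gap, of 0]) (use v0 vg in auto)
  have "phi (of_real (1 - h)) = of_real (1 - (\<Sum>j. v j))"
    unfolding phi_def pt using suminf_of_real[OF sv, where 'a = complex] by simp
  moreover have "(\<Sum>j. v j) \<ge> 0" by (intro suminf_nonneg sv v0)
  moreover have "(\<Sum>j. v j) \<le> 3 * gap (Suc n)"
  proof -
    have "(\<Sum>j. v j) = (\<Sum>j. v (j + Suc n)) + (\<Sum>j<Suc n. v j)"
      by (rule suminf_split_initial_segment[OF sv])
    also have "(\<Sum>j. v (j + Suc n)) \<le> (\<Sum>j. gap (Suc n + j))"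
      using summable_ignore_initial_segment[OF sv, of "Suc n"] summable_ignore_initial_segment[OF summable_gap, of "Suc n"]
      by (intro suminf_le) (auto simp: add.commute intro: vg)
    also have "\<dots> \<le> 2 * gap (Suc n)" by (rule suminf_gap_tail)
    also have "(\<Sum>j<Suc n. v j) \<le> (\<Sum>j<Suc n. gap j * gap (Suc n))"
    proof (intro sum_mono)
      fix j assume "j \<in> {..<Suc n}"
      then have "width n \<le> width j" by (intro width_antimono) auto
      then have "h / (h + width j) \<le> h / width n"
        using h width_pos[of n] by (intro divide_left_mono) (auto intro!: mult_pos_pos add_pos_pos)
      also have "\<dots> = gap (Suc n)" using width_pos[of n] by (simp add: h_def peak_def)
      finally show "v j \<le> gap j * gap (Suc n)"
        unfolding v_def using gap_pos[of j] by (intro mult_left_mono) auto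
    qed
    also have "\<dots> = (\<Sum>j<Suc n. gap j) * gap (Suc n)" by (rule sum_distrib_right[symmetric])
    also have "\<dots> \<le> 1 * gap (Suc n)"
      using sum_le_suminf[OF summable_gap, of "{..<Suc n}"] suminf_gap gap_pos
      by (intro mult_right_mono) (auto simp: less_imp_le)
    finally show ?thesis by simp
  qed
  ultimately show ?thesis using that by (simp add: h_def)
qed

section \<open>Failure of compactness on the Bergman-Orlicz space\<close>

lemma lborel_complex: "(lborel :: complex measure) = distr (lborel \<Otimes>\<^sub>M lborel) borel (\<lambda>(x, y). Complex x y)"
proof (rule lborel_eqI)
  have [measurable]: "(\<lambda>(x, y). Complex x y) \<in> borel_measurable (lborel \<Otimes>\<^sub>M lborel)"
    unfolding Complex_eq case_prod_beta by measurable
  fix l u :: complex assume b: "\<And>b. b \<in> Basis \<Longrightarrow> l \<bullet> b \<le> u \<bullet> b"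
  have lu: "Re l \<le> Re u" "Im l \<le> Im u"
    using b[of 1] b[of \<i>] by (auto simp: Basis_complex_def)
  have "(\<lambda>(x, y). Complex x y) -` box l u = {Re l<..<Re u} \<times> {Im l<..<Im u}"
    by (auto simp: box_def Basis_complex_def)
  then show "emeasure (distr (lborel \<Otimes>\<^sub>M lborel) borel (\<lambda>(x, y). Complex x y)) (box l u) = ennreal (\<Prod>b\<in>Basis. (u - l) \<bullet> b)"
    using lu by (subst emeasure_distr) (auto simp: space_pair_measure lborel.emeasure_pair_measure_Times Basis_complex_def ennreal_mult)
qed simp

lemma nn_integral_complex:
  assumes [measurable]: "g \<in> borel_measurable borel"
  shows "(\<integral>\<^sup>+z. g z \<partial>lborel) = (\<integral>\<^sup>+x. \<integral>\<^sup>+y. g (Complex x y) \<partial>lborel \<partial>lborel)"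
proof -
  have [measurable]: "(\<lambda>(x, y). Complex x y) \<in> borel_measurable (lborel \<Otimes>\<^sub>M lborel)"
    unfolding Complex_eq case_prod_beta by measurable
  have "(\<integral>\<^sup>+z. g z \<partial>lborel) = (\<integral>\<^sup>+p. g (case p of (x, y) \<Rightarrow> Complex x y) \<partial>(lborel \<Otimes>\<^sub>M lborel))"
    by (subst lborel_complex, subst nn_integral_distr) auto
  also have "\<dots> = (\<integral>\<^sup>+x. \<integral>\<^sup>+y. g (Complex x y) \<partial>lborel \<partial>lborel)"
    by (subst lborel.nn_integral_fst[symmetric]) auto
  finally show ?thesis .
qed

text \<open>The rotation is carried out by two substitutions in one real variable each, with factors
  \<open>\<bar>1 / cos t\<bar>\<close> and \<open>\<bar>cos t\<bar>\<close> that cancel. The angles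
  at which the division fails are negligible by \<open>AE_circ_cos\<close>.\<close>

lemma nn_integral_rotate:
  assumes [measurable]: "g \<in> borel_measurable borel" and c: "cos t \<noteq> 0"
  shows "(\<integral>\<^sup>+z. g (z * cis t) \<partial>lborel) = (\<integral>\<^sup>+z. g z \<partial>lborel)"
proof -
  have [measurable]: "(\<lambda>p. Complex (f p) (h p)) \<in> borel_measurable M" if [measurable]: "f \<in> borel_measurable M" "h \<in> borel_measurable M"
    for f h and M :: "'c measure"
    unfolding Complex_eq by measurable
  let ?c = "cos t" and ?s = "sin t"
  have "(\<integral>\<^sup>+z. g (z * cis t) \<partial>lborel) = (\<integral>\<^sup>+x. \<integral>\<^sup>+y. g (Complex (x * ?c - y * ?s) (x * ?s + y * ?c)) \<partial>lborel \<partial>lborel)"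
    by (subst nn_integral_complex) (auto simp: complex_mult cis.ctr)
  also have "\<dots> = (\<integral>\<^sup>+y. \<integral>\<^sup>+x. g (Complex (x * ?c - y * ?s) (x * ?s + y * ?c)) \<partial>lborel \<partial>lborel)"
    by (intro lborel_pair.Fubini'[symmetric]) simp
  also have "\<dots> = (\<integral>\<^sup>+y. ennreal \<bar>1 / ?c\<bar> * (\<integral>\<^sup>+u. g (Complex u (?s / ?c * u + y / ?c)) \<partial>lborel) \<partial>lborel)"
  proof (intro nn_integral_cong)
    fix y
    have e: "(y * ?s / ?c + 1 / ?c * u) * ?s + y * ?c = ?s / ?c * u + y / ?c" for u
    proof -
      have "y * ?s / ?c * ?s + y * ?c = y * (?c * ?c + ?s * ?s) / ?c"
        using c by (simp add: field_simps del: sin_cos_squared_add3)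
      then have "y * ?s / ?c * ?s + y * ?c = y / ?c"
        by (simp only: sin_cos_squared_add3 mult_1_right)
      then show ?thesis by (simp add: algebra_simps)
    qed
    have e1: "(y * ?s / ?c + 1 / ?c * u) * ?c - y * ?s = u" for u
      using c by (simp add: field_simps)
    show "(\<integral>\<^sup>+x. g (Complex (x * ?c - y * ?s) (x * ?s + y * ?c)) \<partial>lborel) = ennreal \<bar>1 / ?c\<bar> * (\<integral>\<^sup>+u. g (Complex u (?s / ?c * u + y / ?c)) \<partial>lborel)"
      by (subst nn_integral_real_affine[where c = "1 / ?c" and t = "y * ?s / ?c"])
         (simp_all only: e e1, use c in auto)
  qed
  also have "\<dots> = ennreal \<bar>1 / ?c\<bar> * (\<integral>\<^sup>+y. \<integral>\<^sup>+u. g (Complex u (?s / ?c * u + y / ?c)) \<partial>lborel \<partial>lborel)"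
    by (intro nn_integral_cmult) simp
  also have "(\<integral>\<^sup>+y. \<integral>\<^sup>+u. g (Complex u (?s / ?c * u + y / ?c)) \<partial>lborel \<partial>lborel) = (\<integral>\<^sup>+u. \<integral>\<^sup>+y. g (Complex u (?s / ?c * u + y / ?c)) \<partial>lborel \<partial>lborel)"
    by (intro lborel_pair.Fubini') simp
  also have "\<dots> = (\<integral>\<^sup>+u. ennreal \<bar>?c\<bar> * (\<integral>\<^sup>+v. g (Complex u v) \<partial>lborel) \<partial>lborel)"
  proof (intro nn_integral_cong)
    fix u
    have e2: "?s / ?c * u + (- ?s * u + ?c * v) / ?c = v" for v
      using c by (simp add: field_simps)
    show "(\<integral>\<^sup>+y. g (Complex u (?s / ?c * u + y / ?c)) \<partial>lborel) = ennreal \<bar>?c\<bar> * (\<integral>\<^sup>+v. g (Complex u v) \<partial>lborel)"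
      by (subst nn_integral_real_affine[where c = "?c" and t = "- ?s * u"])
         (simp_all only: e2, use c in auto)
  qed
  also have "\<dots> = ennreal \<bar>?c\<bar> * (\<integral>\<^sup>+u. \<integral>\<^sup>+v. g (Complex u v) \<partial>lborel \<partial>lborel)"
    by (intro nn_integral_cmult) simp
  also have "ennreal \<bar>1 / ?c\<bar> * \<dots> = (\<integral>\<^sup>+z. g z \<partial>lborel)"
    using c by (simp add: mult.assoc[symmetric] ennreal_mult[symmetric] nn_integral_complex flip: abs_mult)
  finally show ?thesis .
qed

lemma AE_circ_cos: "AE t in circ. cos t \<noteq> 0"
proof (subst AE_circ_iff)
  have "countable {t::real. cos t = 0}"
  proof -
    have "{t::real. cos t = 0} \<subseteq> range (\<lambda>n::int. of_int n * (pi / 2))"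
      by (auto simp: cos_zero_iff_int)
    then show ?thesis by (rule countable_subset) simp
  qed
  then have "{t::real. cos t = 0} \<in> null_sets lborel"
    by (rule countable_imp_null_set_lborel)
  from AE_not_in[OF this] show "AE t in lborel. t \<in> {0..2*pi} \<longrightarrow> cos t \<noteq> 0"
    by eventually_elim auto
qed

lemma emeasure_ball_complex: "r \<ge> 0 \<Longrightarrow> emeasure lborel (ball (z::complex) r) = ennreal (pi * r\<^sup>2)"
  by (simp add: emeasure_ball unit_ball_vol_2)

text \<open>Works without polar coordinates: for each \<open>w\<close> the mean over the circle
  through \<open>a + w\<close> dominates \<open>norm (f a)\<close>. Integrating over
  \<open>w\<close>, exchanging the integrals and removing \<open>cis t\<close> by rotation
  invariance leaves the area integral.\<close>

lemma area_mean_value: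
  assumes f: "f holomorphic_on ball a R" and R: "R > 0"
  shows "ennreal (norm (f a)) * ennreal (pi * R\<^sup>2) \<le> (\<integral>\<^sup>+z\<in>ball a R. ennreal (norm (f z)) \<partial>lborel)"
proof -
  interpret pair_sigma_finite circ "lborel :: complex measure"
    by (intro pair_sigma_finite.intro circ.sigma_finite_measure_axioms lborel.sigma_finite_measure_axioms)
  define F where "F w = (if w \<in> ball 0 R then f (a + w) else 0)" for w
  have Fm [measurable]: "F \<in> borel_measurable borel"
    unfolding F_def
    by (intro borel_measurable_continuous_on_if continuous_on_compose2[OF holomorphic_on_imp_continuous_on[OF f]])
       (auto intro!: continuous_intros simp: dist_norm)
  have mv: "ennreal (norm (f a)) \<le> (\<integral>\<^sup>+t. ennreal (norm (F (w * cis t))) \<partial>circ)" if w: "w \<in> ball 0 R" for w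
  proof -
    define R' where "R' = (if w = 0 then 2 else R / norm w)"
    have R': "R' > 1" using w R by (auto simp: R'_def)
    have wR: "norm (w * x) < R" if "norm x < R'" for x
      using that R by (auto simp: R'_def norm_mult field_simps split: if_splits)
    have h: "(\<lambda>x. f (a + w * x)) holomorphic_on ball 0 R'"
      by (intro holomorphic_intros holomorphic_on_compose_gen[OF _ f, unfolded o_def])
         (use wR in \<open>auto simp: dist_norm\<close>)
    have "f a = (\<integral>t. f (a + w * cis t) \<partial>circ)"
      using mean_value_circ[OF h R'] by simp
    moreover have "F (w * cis t) = f (a + w * cis t)" for t
      using w by (simp add: F_def norm_mult)
    moreover have "ennreal (norm (\<integral>t. f (a + w * cis t) \<partial>circ)) \<le> (\<integral>\<^sup>+t. ennreal (norm (f (a + w * cis t))) \<partial>circ)"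
      by (rule integral_norm_bound_ennreal, rule integral_circ(1))
         (use continuous_on_circle[OF h, of 1 UNIV] R' in simp)
    ultimately show ?thesis by simp
  qed
  have "ennreal (norm (f a)) * ennreal (pi * R\<^sup>2) = (\<integral>\<^sup>+(w::complex)\<in>ball 0 R. ennreal (norm (f a)) \<partial>lborel)"
    using R by (subst nn_integral_cmult_indicator) (auto simp: emeasure_ball_complex)
  also have "\<dots> \<le> (\<integral>\<^sup>+w. (\<integral>\<^sup>+t. ennreal (norm (F (w * cis t))) \<partial>circ) \<partial>lborel)"
    using mv by (intro nn_integral_mono) (auto simp: indicator_def)
  also have "\<dots> = (\<integral>\<^sup>+t. (\<integral>\<^sup>+w. ennreal (norm (F (w * cis t))) \<partial>lborel) \<partial>circ)"
    by (intro Fubini') simp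
  also have "\<dots> = (\<integral>\<^sup>+t. (\<integral>\<^sup>+w. ennreal (norm (F w)) \<partial>lborel) \<partial>circ)"
    by (rule nn_integral_cong_AE)
       (use AE_circ_cos in \<open>auto elim!: eventually_mono intro!: nn_integral_rotate[of "\<lambda>w. ennreal (norm (F w))"]\<close>)
  also have "\<dots> = (\<integral>\<^sup>+w. ennreal (norm (F w)) \<partial>lborel)"
    by (simp add: emeasure_circ)
  also have "\<dots> = (\<integral>\<^sup>+w. ennreal (norm (F w)) \<partial>distr lborel borel ((+) (- a)))"
    by (subst lborel_distr_plus) simp
  also have "\<dots> = (\<integral>\<^sup>+z. ennreal (norm (F (- a + z))) \<partial>lborel)"
    by (subst nn_integral_distr) auto
  also have "\<dots> = (\<integral>\<^sup>+z\<in>ball a R. ennreal (norm (f z)) \<partial>lborel)"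
    by (intro nn_integral_cong) (auto simp: F_def indicator_def dist_norm norm_minus_commute)
  finally show ?thesis .
qed

text \<open>Jensen's inequality for normalised area on the largest disc about \<open>a\<close>
  inside the unit disc. Its area \<open>pi * (1 - norm a)\<^sup>2\<close> is the source of the
  square, in contrast to \<open>hardy1_orlicz_bound\<close>.\<close>

lemma bergman_orlicz_bound:
  assumes \<Psi>: "orlicz_function \<Psi>" and f: "f holomorphic_on ball 0 1" and C: "C > 0" and a: "norm a < 1"
  shows "ennreal (\<Psi> (norm (f a) / C)) \<le> ennreal (1 / (1 - norm a)\<^sup>2) * disc_modular \<Psi> f C"
proof -
  define R where "R = 1 - norm a"
  have R: "R > 0" using a by (simp add: R_def)
  have sub: "ball a R \<subseteq> ball 0 1"
    by (auto simp: ball_subset_ball_iff dist_norm R_def)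
  define u where "u z = (if z \<in> ball 0 1 then norm (f z) else 0) / C" for z
  have um [measurable]: "u \<in> borel_measurable borel"
    unfolding u_def
    by (intro borel_measurable_divide borel_measurable_const borel_measurable_continuous_on_if continuous_on_norm
        holomorphic_on_imp_continuous_on[OF f]) auto
  have u0: "u z \<ge> 0" for z using C by (simp add: u_def)
  have [measurable]: "(\<lambda>z. \<Psi> (u z)) \<in> borel_measurable borel"
    by (rule measurable_orlicz[OF \<Psi> um u0])
  define p where "p z = ennreal (1 / (pi * R\<^sup>2)) * indicator (ball a R) z" for z
  have [measurable]: "ball a R \<in> sets borel" "ball (0::complex) 1 \<in> sets borel" by simp_all
  have [measurable]: "p \<in> borel_measurable lborel" unfolding p_def by measurable
  have p1: "(\<integral>\<^sup>+z. p z \<partial>lborel) = 1"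
    unfolding p_def using R by (simp add: nn_integral_cmult emeasure_ball_complex ennreal_mult[symmetric])
  have "ennreal (norm (f a) / C) \<le> (\<integral>\<^sup>+z. p z * ennreal (u z) \<partial>lborel)"
  proof -
    have "ennreal (norm (f a)) * ennreal (pi * R\<^sup>2) \<le> (\<integral>\<^sup>+z\<in>ball a R. ennreal (norm (f z)) \<partial>lborel)"
      by (rule area_mean_value[OF holomorphic_on_subset[OF f sub] R])
    then have "ennreal (1 / (C * (pi * R\<^sup>2))) * (ennreal (norm (f a)) * ennreal (pi * R\<^sup>2)) \<le> ennreal (1 / (C * (pi * R\<^sup>2))) * (\<integral>\<^sup>+z\<in>ball a R. ennreal (norm (f z)) \<partial>lborel)"
      by (rule mult_left_mono) simp
    also have "(\<integral>\<^sup>+z\<in>ball a R. ennreal (norm (f z)) \<partial>lborel) = (\<integral>\<^sup>+z\<in>ball a R. ennreal (C * u z) \<partial>lborel)"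
      using sub C by (intro nn_integral_cong) (auto simp: u_def indicator_def)
    also have "ennreal (1 / (C * (pi * R\<^sup>2))) * \<dots> = (\<integral>\<^sup>+z. ennreal (1 / (C * (pi * R\<^sup>2))) * (ennreal (C * u z) * indicator (ball a R) z) \<partial>lborel)"
      by (intro nn_integral_cmult[symmetric]) simp
    also have "\<dots> = (\<integral>\<^sup>+z. p z * ennreal (u z) \<partial>lborel)"
    proof (intro nn_integral_cong)
      fix z
      have "ennreal (1 / (C * (pi * R\<^sup>2))) * ennreal (C * u z) = ennreal (1 / (pi * R\<^sup>2)) * ennreal (u z)"
        using C R u0[of z] by (simp add: ennreal_mult[symmetric])
      then show "ennreal (1 / (C * (pi * R\<^sup>2))) * (ennreal (C * u z) * indicator (ball a R) z) = p z * ennreal (u z)"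
        by (simp add: p_def indicator_def)
    qed
    also have "ennreal (1 / (C * (pi * R\<^sup>2))) * (ennreal (norm (f a)) * ennreal (pi * R\<^sup>2)) = ennreal (norm (f a) / C)"
      using C R by (simp add: ennreal_mult[symmetric])
    finally show ?thesis .
  qed
  then have "ennreal (\<Psi> (norm (f a) / C)) \<le> (\<integral>\<^sup>+z. p z * ennreal (\<Psi> (u z)) \<partial>lborel)"
    using C by (intro orlicz_jensen[OF \<Psi> _ _ u0 p1]) auto
  also have "\<dots> \<le> (\<integral>\<^sup>+z. ennreal (1 / (pi * R\<^sup>2)) * (ennreal (\<Psi> (u z)) * indicator (ball 0 1) z) \<partial>lborel)"
    using sub by (intro nn_integral_mono) (auto simp: p_def indicator_def)
  also have "\<dots> = ennreal (1 / (pi * R\<^sup>2)) * (\<integral>\<^sup>+z\<in>ball 0 1. ennreal (\<Psi> (u z)) \<partial>lborel)"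
    by (intro nn_integral_cmult) simp
  also have "(\<integral>\<^sup>+z\<in>ball 0 1. ennreal (\<Psi> (u z)) \<partial>lborel) = (\<integral>\<^sup>+z\<in>ball 0 1. ennreal (\<Psi> (norm (f z) / C)) \<partial>lborel)"
    by (intro nn_integral_cong) (auto simp: u_def indicator_def)
  also have "ennreal (1 / (pi * R\<^sup>2)) * \<dots> = ennreal (1 / (1 - norm a)\<^sup>2) * disc_modular \<Psi> f C"
    unfolding disc_modular_def R_def[symmetric]
    using R by (simp add: ennreal_mult[symmetric] mult.assoc[symmetric] mult.commute)
  finally show ?thesis .
qed

section \<open>The disc modular as an integral for one measure\<close>

definition disc_area :: "complex measure" where
  "disc_area = density lborel (\<lambda>z. ennreal (1 / pi) * indicator (ball 0 1) z)"

text \<open>The value 0 outside the disc makes this a Borel function on the plane, whatever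
  \<open>f\<close> is there.\<close>

definition disc_abs :: "(complex \<Rightarrow> complex) \<Rightarrow> complex \<Rightarrow> real" where
  "disc_abs f z = (if z \<in> ball 0 1 then norm (f z) else 0)"

lemma measurable_disc_abs:
  assumes "f holomorphic_on ball 0 1"
  shows "disc_abs f \<in> borel_measurable disc_area"
proof -
  have "disc_abs f \<in> borel_measurable borel"
    unfolding disc_abs_def[abs_def]
    by (intro borel_measurable_continuous_on_if continuous_on_norm holomorphic_on_imp_continuous_on[OF assms]) auto
  then show ?thesis by (simp add: disc_area_def)
qed

lemma disc_abs_nonneg: "disc_abs f z \<ge> 0"
  by (simp add: disc_abs_def)

lemma disc_modular_eq:
  assumes \<Psi>: "orlicz_function \<Psi>" and f: "f holomorphic_on ball 0 1" and C: "C > 0"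
  shows "disc_modular \<Psi> f C = (\<integral>\<^sup>+z. ennreal (\<Psi> (disc_abs f z / C)) \<partial>disc_area)"
proof -
  have "(\<lambda>z. \<Psi> (disc_abs f z / C)) \<in> borel_measurable disc_area"
    by (rule measurable_orlicz[OF \<Psi> borel_measurable_divide[OF measurable_disc_abs[OF f]]]) (use C disc_abs_nonneg in auto)
  then have [measurable]: "(\<lambda>z. \<Psi> (disc_abs f z / C)) \<in> borel_measurable borel" by (simp add: disc_area_def)
  have [measurable]: "ball (0::complex) 1 \<in> sets borel" by simp
  have "(\<integral>\<^sup>+z. ennreal (\<Psi> (disc_abs f z / C)) \<partial>disc_area) = (\<integral>\<^sup>+z. ennreal (1 / pi) * (ennreal (\<Psi> (disc_abs f z / C)) * indicator (ball 0 1) z) \<partial>lborel)"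
    unfolding disc_area_def by (subst nn_integral_density) (auto simp: mult_ac)
  also have "\<dots> = ennreal (1 / pi) * (\<integral>\<^sup>+z\<in>ball 0 1. ennreal (\<Psi> (disc_abs f z / C)) \<partial>lborel)"
    by (rule nn_integral_cmult) simp
  also have "(\<integral>\<^sup>+z\<in>ball 0 1. ennreal (\<Psi> (disc_abs f z / C)) \<partial>lborel) = (\<integral>\<^sup>+z\<in>ball 0 1. ennreal (\<Psi> (norm (f z) / C)) \<partial>lborel)"
    by (intro nn_integral_cong) (auto simp: disc_abs_def indicator_def)
  finally show ?thesis by (simp add: disc_modular_def)
qed

lemma bergman_orlicz_diff:
  assumes \<Psi>: "orlicz_function \<Psi>" and f: "f \<in> bergman_orlicz \<Psi>" and g: "g \<in> bergman_orlicz \<Psi>"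
  shows "\<exists>C>0. disc_modular \<Psi> (\<lambda>z. f z - g z) C \<le> 1"
proof -
  have hol: "f holomorphic_on ball 0 1" "g holomorphic_on ball 0 1" using f g by (auto simp: bergman_orlicz_def)
  obtain C D where CD: "C > 0" "D > 0" "disc_modular \<Psi> f C < \<infinity>" "disc_modular \<Psi> g D < \<infinity>"
    using f g by (auto simp: bergman_orlicz_def)
  have hd: "(\<lambda>z. f z - g z) holomorphic_on ball 0 1" by (intro holomorphic_intros hol)
  have "(\<integral>\<^sup>+z. ennreal (\<Psi> (disc_abs (\<lambda>z. f z - g z) z / (2 * max C D))) \<partial>disc_area) < \<infinity>"
    by (rule orlicz_integral_add_finite[OF \<Psi> measurable_disc_abs[OF hol(1)] _ measurable_disc_abs[OF hol(2)] _ CD(1,2)])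
       (use CD in \<open>auto simp: disc_modular_eq[OF \<Psi>] hol disc_abs_def norm_triangle_ineq4\<close>)
  from ex_orlicz_integral_le_1[OF \<Psi> measurable_disc_abs[OF hd] disc_abs_nonneg _ this] CD
  show ?thesis by (auto simp: disc_modular_eq[OF \<Psi> hd])
qed

section \<open>Test functions concentrated near 1\<close>

definition bump :: "nat \<Rightarrow> complex \<Rightarrow> complex" where
  "bump n z = of_real (knot (n + 2)) * (of_real (3 * gap (n + 1)) / (1 + of_real (3 * gap (n + 1)) - z)) ^ 4"

lemma bump_denominator:
  assumes "norm (z::complex) \<le> 1" "h > 0"
  shows "norm (1 + of_real h - z) \<ge> h" "norm (1 + of_real h - z) \<ge> 1 - norm z" "1 + of_real h - z \<noteq> 0"
proof -
  have "Re z \<le> norm z" by (rule complex_Re_le_cmod)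
  moreover have "Re (1 + of_real h - z) \<le> norm (1 + of_real h - z)" by (rule complex_Re_le_cmod)
  ultimately show 1: "norm (1 + of_real h - z) \<ge> h" and "norm (1 + of_real h - z) \<ge> 1 - norm z"
    using assms by auto
  show "1 + of_real h - z \<noteq> 0" using 1 assms by auto
qed

lemma holomorphic_bump: "bump n holomorphic_on ball 0 1"
  unfolding bump_def[abs_def] using gap_pos[of "n + 1"]
  by (intro holomorphic_intros) (use bump_denominator(3)[of _ "3 * gap (n + 1)"] in auto)

text \<open>Absorbs the cubic factor that \<open>P \<le> (n + 3) * Q\<close> leaves in
  \<open>disc_modular_bump\<close>.\<close>

lemma psi2_ge_cube: "32 * (real n + 3) ^ 3 \<le> psi2 (n + 1)"
proof -
  have "real n + 2 \<le> knot (n + 1)"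
    using knot_ge1[of n] knot_Suc[of n] by (simp add: mult_left_mono[of 1 "knot n" "real n + 2", simplified])
  also have "\<dots> \<le> psi1 (n + 1)" by (rule psi1_ge)
  finally have a: "real n + 2 \<le> psi1 (n + 1)" .
  have "(real n + 3) ^ 3 \<le> (2 * (real n + 2)) ^ 3" by (intro power_mono) auto
  also have "\<dots> = 8 * (real n + 2) ^ 3" by (simp only: power_mult_distrib) simp
  finally have "32 * (real n + 3) ^ 3 \<le> 256 * (real n + 2) ^ 3" by simp
  also have "\<dots> \<le> 4 ^ (n + 1 + 3) * psi1 (n + 1) ^ 4"
  proof (rule mult_mono)
    have "(4::real) ^ 4 \<le> 4 ^ (n + 1 + 3)" by (intro power_increasing) auto
    then show "(256::real) \<le> 4 ^ (n + 1 + 3)" by simp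
    have "(real n + 2) ^ 3 \<le> psi1 (n + 1) ^ 3" using a by (intro power_mono) auto
    also have "\<dots> \<le> psi1 (n + 1) ^ 4" using psi1_ge1[of "n + 1"] by (intro power_increasing) auto
    finally show "(real n + 2) ^ 3 \<le> psi1 (n + 1) ^ 4" .
  qed auto
  also have "\<dots> \<le> psi2 (n + 1)" by (rule psi2_ge')
  finally show ?thesis .
qed

text \<open>Splits the disc at distance \<open>\<rho>\<close> from the pole \<open>1 + h\<close>.
  Inside, \<open>psi\<close> is at most \<open>P\<close>; outside, \<open>orlicz_star\<close> scales
  it by \<open>k = (h / \<rho>) ^ 4\<close>. With \<open>\<rho>\<^sup>2 = 1 / (2 * P)\<close> the
  inner part costs \<open>1 / 2\<close> and the outer one \<open>4 * P ^ 3 * h ^ 4\<close>, of order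
  \<open>(n + 3) ^ 3 / Q\<close>. A square in place of the fourth power would leave no factor
  \<open>1 / Q\<close> in this estimate.\<close>

lemma disc_modular_bump: "disc_modular psi (bump n) 1 \<le> ennreal 50000"
proof -
  define h where "h = 3 * gap (n + 1)"
  have h: "h > 0" using gap_pos[of "n + 1"] by (simp add: h_def)
  define P where "P = psi1 (n + 2)"
  define Q where "Q = psi2 (n + 1)"
  have P: "P \<ge> 1" unfolding P_def by (rule psi1_ge1)
  have Q: "Q > 0" unfolding Q_def by (rule psi2_pos)
  have PQ: "P \<le> (real n + 3) * Q"
    using psi1_Suc_le[of "n + 1"] by (simp add: P_def Q_def add.commute)
  have hQ: "h = 24 / Q" by (simp add: h_def gap_def Q_def)
  define \<rho> where "\<rho> = sqrt (1 / (2 * P))"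
  have \<rho>: "\<rho> > 0" "\<rho>\<^sup>2 = 1 / (2 * P)" using P by (auto simp: \<rho>_def)
  define k where "k = (h / \<rho>) ^ 4"
  have k: "k \<ge> 0" unfolding k_def by simp
  have kP: "k = 4 * P\<^sup>2 * h ^ 4"
  proof -
    have "\<rho> ^ 4 = (\<rho>\<^sup>2)\<^sup>2" by simp
    also have "\<dots> = 1 / (4 * P\<^sup>2)" unfolding \<rho>(2) by (simp add: power_divide power_mult_distrib)
    finally show ?thesis using P by (simp add: k_def power_divide)
  qed
  have pt: "ennreal (psi (norm (bump n z) / 1)) * indicator (ball 0 1) z \<le>
      ennreal P * (indicator (ball (1 + of_real h) \<rho>) z + ennreal k * indicator (ball 0 1) z)" for z
  proof (cases "z \<in> ball 0 1")
    case True
    then have z: "norm z \<le> 1" by simp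
    define x where "x = (h / norm (1 + of_real h - z)) ^ 4"
    have d: "norm (1 + of_real h - z) \<ge> h" by (rule bump_denominator[OF z h])
    have r: "0 \<le> h / norm (1 + of_real h - z)" "h / norm (1 + of_real h - z) \<le> 1"
      using d h by (auto simp: divide_le_eq_1)
    have x: "0 \<le> x" "x \<le> 1" unfolding x_def using r by (auto intro: power_le_one)
    have "norm (bump n z) = x * knot (n + 2)"
      using knot_pos[of "n + 2"] h unfolding bump_def h_def[symmetric] x_def by (simp add: norm_mult norm_power norm_divide)
    then have "psi (norm (bump n z)) \<le> x * P"
      unfolding P_def psi1_def using orlicz_star[OF orlicz_psi x] knot_pos[of "n + 2"] by auto
    also have "\<dots> \<le> P * (indicator (ball (1 + of_real h) \<rho>) z + k)"
    proof (cases "z \<in> ball (1 + of_real h) \<rho>")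
      case True
      have "x * P \<le> (1 + k) * P" using x(2) k P by (intro mult_right_mono) auto
      then show ?thesis using True by (simp add: mult.commute)
    next
      case False
      then have "\<rho> \<le> norm (1 + of_real h - z)" by (simp add: dist_norm)
      then have "h / norm (1 + of_real h - z) \<le> h / \<rho>" using \<rho> h by (intro divide_left_mono) (auto intro!: mult_pos_pos)
      then have "x \<le> k" unfolding x_def k_def using r by (intro power_mono)
      then show ?thesis using False P by (simp add: mult.commute)
    qed
    finally have "ennreal (psi (norm (bump n z))) \<le> ennreal (P * (indicator (ball (1 + of_real h) \<rho>) z + k))"
      by (rule ennreal_leI)
    also have "\<dots> = ennreal P * (indicator (ball (1 + of_real h) \<rho>) z + ennreal k)"
      using P k by (auto simp: ennreal_mult ennreal_plus indicator_def)
    finally show ?thesis using True by simp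
  qed simp
  have [measurable]: "ball (1 + complex_of_real h) \<rho> \<in> sets borel" "ball (0::complex) 1 \<in> sets borel" by simp_all
  have "disc_modular psi (bump n) 1 \<le> ennreal (1 / pi) * (\<integral>\<^sup>+(z::complex). ennreal P * (indicator (ball (1 + of_real h) \<rho>) z + ennreal k * indicator (ball 0 1) z) \<partial>lborel)"
    unfolding disc_modular_def by (intro mult_left_mono nn_integral_mono pt) simp
  also have "\<dots> = ennreal (1 / pi) * (ennreal P * (ennreal (pi * \<rho>\<^sup>2) + ennreal k * ennreal pi))"
    using \<rho>(1) by (subst nn_integral_cmult) (auto simp: nn_integral_add nn_integral_cmult emeasure_ball_complex)
  also have "\<dots> = ennreal (P * (\<rho>\<^sup>2 + k))"
    using P k by (simp add: ennreal_mult[symmetric] ennreal_plus[symmetric] field_simps del: ennreal_plus)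
  also have "P * (\<rho>\<^sup>2 + k) \<le> 50000"
  proof -
    have "P * (\<rho>\<^sup>2 + k) = 1 / 2 + 4 * P ^ 3 * h ^ 4"
      unfolding \<rho>(2) kP using P by (simp add: field_simps power2_eq_square power3_eq_cube)
    also have "P ^ 3 \<le> ((real n + 3) * Q) ^ 3" using PQ P by (intro power_mono) auto
    then have "4 * P ^ 3 * h ^ 4 \<le> 4 * ((real n + 3) * Q) ^ 3 * h ^ 4" by (intro mult_right_mono) auto
    \<comment> \<open>The constant is \<open>4 * 24 ^ 4\<close>, from \<open>h = 24 / Q\<close>; the
      32 in \<open>psi2_ge_cube\<close> reduces it to 41472.\<close>
    also have "\<dots> = 1327104 * (real n + 3) ^ 3 / Q"
      unfolding hQ using Q by (simp add: power_divide power_mult_distrib field_simps eval_nat_numeral)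
    also have "\<dots> \<le> 41472"
      using psi2_ge_cube[of n] Q by (simp add: Q_def divide_le_eq)
    finally show ?thesis by simp
  qed
  finally show ?thesis by (simp add: ennreal_leI)
qed

lemma bump_modular_le_1: "disc_modular psi (bump n) 50000 \<le> 1"
  using orlicz_integral_le_1[OF orlicz_psi measurable_disc_abs[OF holomorphic_bump] disc_abs_nonneg, of 1 50000] disc_modular_bump[of n]
  by (simp add: disc_modular_eq[OF orlicz_psi holomorphic_bump])

text \<open>The constant is \<open>24 ^ 4\<close>, from \<open>h = 24 / Q\<close>. Of the three
  factors \<open>1 / Q\<close> that remain, one beats \<open>n + 3\<close>, one supplies
  \<open>(1/2) ^ n\<close>, and one is bounded by 1.\<close>

lemma norm_bump_le:
  assumes z: "norm z < 1"
  shows "norm (bump n z) \<le> 331776 / (1 - norm z) ^ 4 * (1/2) ^ n"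
proof -
  define h where "h = 3 * gap (n + 1)"
  have h: "h > 0" using gap_pos[of "n + 1"] by (simp add: h_def)
  define Q where "Q = psi2 (n + 1)"
  have Q: "Q > 0" unfolding Q_def by (rule psi2_pos)
  have hQ: "h = 24 / Q" by (simp add: h_def gap_def Q_def)
  have "h / norm (1 + of_real h - z) \<le> h / (1 - norm z)"
    using bump_denominator[of z h] z h by (intro divide_left_mono) (auto intro!: mult_pos_pos)
  then have hz: "(h / norm (1 + of_real h - z)) ^ 4 \<le> (h / (1 - norm z)) ^ 4"
    using h by (intro power_mono) auto
  have "knot (n + 2) * (h / norm (1 + of_real h - z)) ^ 4 \<le> ((real n + 3) * Q) * (h / (1 - norm z)) ^ 4"
  proof (rule mult_mono[OF _ hz])
    have "knot (n + 2) \<le> psi1 (n + 2)" by (rule psi1_ge)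
    also have "\<dots> \<le> (real n + 3) * Q" using psi1_Suc_le[of "n + 1"] by (simp add: Q_def add.commute)
    finally show "knot (n + 2) \<le> (real n + 3) * Q" .
  qed (use Q in auto)
  also have "\<dots> = 331776 / (1 - norm z) ^ 4 * ((real n + 3) / Q * (1 / Q) * (1 / Q))"
  proof -
    have "((real n + 3) * Q) * (24 / Q / c) ^ 4 = 331776 / c ^ 4 * ((real n + 3) / Q * (1 / Q) * (1 / Q))" for c
      using Q by (cases "c = 0") (auto simp: power_divide field_simps eval_nat_numeral)
    then show ?thesis unfolding hQ .
  qed
  also have "\<dots> \<le> 331776 / (1 - norm z) ^ 4 * (1 * (1/2)^n * 1)"
  proof (intro mult_left_mono mult_mono)
    have "real n + 3 \<le> (real n + 3) ^ 3" by (intro self_le_power) auto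
    also have "\<dots> \<le> Q" using psi2_ge_cube[of n] zero_le_power[of "real n + 3" 3] unfolding Q_def by linarith
    finally show "(real n + 3) / Q \<le> 1" using Q by simp
    have "(2::real) ^ n \<le> 64 * 2 ^ (n + 1)" by simp
    also have "\<dots> \<le> Q" unfolding Q_def by (rule psi2_exp)
    finally have Q2: "2 ^ n \<le> Q" .
    then have "1 / Q \<le> 1 / 2 ^ n" by (intro divide_left_mono) (auto intro!: mult_pos_pos Q)
    then show "1 / Q \<le> (1/2) ^ n" by (simp add: power_one_over)
    have "(1::real) \<le> 2 ^ n" by simp
    then have "1 \<le> Q" using Q2 by (rule order.trans)
    then show "1 / Q \<le> 1" by simp
  qed (use Q z in auto)
  finally show ?thesis
    using knot_pos[of "n + 2"] h unfolding bump_def h_def[symmetric] by (simp add: norm_mult norm_power norm_divide)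
qed

lemma bump_tendsto_0: "norm z < 1 \<Longrightarrow> (\<lambda>n. bump n z) \<longlonglongrightarrow> 0"
  by (rule Lim_null_comparison[where g = "\<lambda>n. 331776 / (1 - norm z) ^ 4 * (1/2) ^ n"])
     (rule always_eventually, rule allI, erule norm_bump_le, auto intro!: tendsto_mult_right_zero LIMSEQ_power_zero)

text \<open>Norm convergence controls the values at points of the disc (\<open>pt\<close>), so the
  pointwise limit 0 is the only possible limit \<open>g\<close>. Then some image has small norm,
  whereas at \<open>1 - peak n\<close> its value exceeds what \<open>bergman_orlicz_bound\<close>
  permits.\<close>

lemma not_compact_bergman:
  "\<not> compact_comp_op (bergman_orlicz psi) (bergman_orlicz_norm psi) (\<lambda>f. f \<circ> phi)"
proof
  assume cpt: "compact_comp_op (bergman_orlicz psi) (bergman_orlicz_norm psi) (\<lambda>f. f \<circ> phi)"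
  have bump_in: "bump n \<in> bergman_orlicz psi" for n
    unfolding bergman_orlicz_def using holomorphic_bump[of n] bump_modular_le_1[of n]
    by (auto intro!: exI[of _ 50000] elim: le_less_trans)
  have "bergman_orlicz_norm psi (bump n) \<le> 50000" for n
    unfolding bergman_orlicz_norm_def by (rule orlicz_norm_le) (use bump_modular_le_1[of n] in auto)
  then obtain r g where r: "strict_mono (r :: nat \<Rightarrow> nat)" and g: "g \<in> bergman_orlicz psi"
    and lim: "(\<lambda>k. bergman_orlicz_norm psi (\<lambda>z. (bump (r k) \<circ> phi) z - g z)) \<longlonglongrightarrow> 0"
    using cpt bump_in unfolding compact_comp_op_def by blast
  have hol_comp: "(bump n \<circ> phi) holomorphic_on ball 0 1" for n
    using analytic_selfmap_phi unfolding analytic_selfmap_def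
    by (intro holomorphic_on_compose_gen[OF _ holomorphic_bump]) auto
  have comp_in: "(bump n \<circ> phi) \<in> bergman_orlicz psi" for n
  proof -
    have b: "norm ((bump n \<circ> phi) z) \<le> knot (n + 2)" if z: "norm z < 1" for z
    proof -
      define h where "h = 3 * gap (n + 1)"
      have h: "h > 0" using gap_pos[of "n + 1"] by (simp add: h_def)
      have "norm (phi z) \<le> 1" using norm_phi_ball[OF z] by simp
      from bump_denominator(1)[OF this h] have "h / norm (1 + of_real h - phi z) \<le> 1"
        using h by (auto simp: divide_le_eq_1)
      then have "(h / norm (1 + of_real h - phi z)) ^ 4 \<le> 1" using h by (intro power_le_one) auto
      then show ?thesis
        using knot_pos[of "n + 2"] h unfolding bump_def h_def[symmetric] by (simp add: norm_mult norm_power norm_divide mult_left_le)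
    qed
    have "disc_modular psi (bump n \<circ> phi) 1 \<le> ennreal (1 / pi) * (\<integral>\<^sup>+(z::complex)\<in>ball 0 1. ennreal (psi (knot (n + 2))) \<partial>lborel)"
      unfolding disc_modular_def using b
      by (intro mult_left_mono nn_integral_mono) (auto simp: indicator_def intro!: ennreal_leI psi_mono)
    also have "\<dots> < \<infinity>"
      by (subst nn_integral_cmult_indicator) (auto simp: emeasure_ball_complex ennreal_mult_less_top)
    finally show ?thesis using hol_comp[of n] by (auto simp: bergman_orlicz_def intro!: exI[of _ 1])
  qed
  have pt: "\<exists>C>0. C < \<eta> \<and> ennreal (psi (norm (bump n (phi z) - g z) / C)) \<le> ennreal (1 / (1 - norm z)\<^sup>2)"
    if "bergman_orlicz_norm psi (\<lambda>z. (bump n \<circ> phi) z - g z) < \<eta>" and z: "norm z < 1" for n \<eta> z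
  proof -
    obtain C0 where "C0 > 0" "disc_modular psi (\<lambda>z. (bump n \<circ> phi) z - g z) C0 \<le> 1"
      using bergman_orlicz_diff[OF orlicz_psi comp_in g] by blast
    from orlicz_norm_lessD[where M = "disc_modular psi" and f = "\<lambda>z. (bump n \<circ> phi) z - g z", OF that(1)[unfolded bergman_orlicz_norm_def] this]
    obtain C where C: "C > 0" "C < \<eta>" "disc_modular psi (\<lambda>z. (bump n \<circ> phi) z - g z) C \<le> 1"
      by blast
    have "(\<lambda>z. (bump n \<circ> phi) z - g z) holomorphic_on ball 0 1"
      using g by (intro holomorphic_intros hol_comp) (simp add: bergman_orlicz_def)
    from bergman_orlicz_bound[OF orlicz_psi this C(1) z]
    have "ennreal (psi (norm (bump n (phi z) - g z) / C)) \<le> ennreal (1 / (1 - norm z)\<^sup>2) * disc_modular psi (\<lambda>z. (bump n \<circ> phi) z - g z) C"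
      by simp
    also have "\<dots> \<le> ennreal (1 / (1 - norm z)\<^sup>2) * 1" by (intro mult_left_mono C(3)) simp
    finally show ?thesis using C by auto
  qed
  have g0: "g z = 0" if z: "norm z < 1" for z
  proof -
    have "norm (phi z) < 1" by (rule norm_phi_ball[OF z])
    then have "(\<lambda>k. bump (r k) (phi z)) \<longlonglongrightarrow> 0"
      using LIMSEQ_subseq_LIMSEQ[OF bump_tendsto_0 r] by (simp add: o_def)
    moreover have "(\<lambda>k. bump (r k) (phi z) - g z) \<longlonglongrightarrow> 0"
    proof (rule tendstoI)
      fix e :: real assume e: "e > 0"
      have "eventually (\<lambda>k. bergman_orlicz_norm psi (\<lambda>z. (bump (r k) \<circ> phi) z - g z) < e * (1 - norm z)\<^sup>2) sequentially"
        by (rule order_tendstoD[OF lim]) (use e z in auto)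
      then show "eventually (\<lambda>k. dist (bump (r k) (phi z) - g z) 0 < e) sequentially"
      proof eventually_elim
        case (elim k)
        from pt[OF this z] obtain C where C: "C > 0" "C < e * (1 - norm z)\<^sup>2"
          "ennreal (psi (norm (bump (r k) (phi z) - g z) / C)) \<le> ennreal (1 / (1 - norm z)\<^sup>2)" by blast
        let ?v = "norm (bump (r k) (phi z) - g z)"
        have "?v / C \<le> psi (?v / C)" using C by (intro psi_ge) auto
        also have "\<dots> \<le> 1 / (1 - norm z)\<^sup>2" using C(3) by (simp add: ennreal_le_iff)
        finally have "?v \<le> C / (1 - norm z)\<^sup>2" using C(1) by (simp add: field_simps)
        also have "\<dots> < e" using C(2) z by (simp add: divide_less_eq)
        finally show ?case by (simp add: dist_norm)
      qed
    qed
    ultimately have "(\<lambda>k. bump (r k) (phi z) - (bump (r k) (phi z) - g z)) \<longlonglongrightarrow> 0 - 0"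
      by (rule tendsto_diff)
    then show ?thesis by (simp add: LIMSEQ_const_iff)
  qed
  \<comment> \<open>At the peak point \<open>norm (bump n (phi a))\<close> is at least
    \<open>knot (n + 2) / 16\<close>, since \<open>u \<le> h\<close>. Dividing by
    \<open>C < 1 / 32\<close> lifts this to \<open>2 * knot (n + 2)\<close>, the argument at which
    \<open>psi2 (n + 2)\<close> is taken.\<close>
  have "eventually (\<lambda>k. bergman_orlicz_norm psi (\<lambda>z. (bump (r k) \<circ> phi) z - g z) < 1 / 32) sequentially"
    by (rule order_tendstoD[OF lim]) simp
  then obtain k where k: "bergman_orlicz_norm psi (\<lambda>z. (bump (r k) \<circ> phi) z - g z) < 1 / 32"
    by (auto simp: eventually_sequentially)
  define n where "n = r k"
  define a where "a = complex_of_real (1 - peak n)"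
  have peak: "0 < peak n" "peak n < 1"
  proof -
    show "0 < peak n" unfolding peak_def by (intro mult_pos_pos gap_pos width_pos)
    have "gap (Suc n) \<le> gap 0 * (1/2)^Suc n" using gap_add[of 0 "Suc n"] by simp
    also have "\<dots> \<le> 1/8 * 1" using gap_0 gap_pos[of 0] by (intro mult_mono power_le_one) auto
    finally have g: "gap (Suc n) \<le> 1/8" by simp
    have "width n \<le> 1" using width_le[of n] power_le_one[of "1/2::real" n] by simp
    with g have "gap (Suc n) * width n \<le> 1/8 * 1" using width_pos[of n] by (intro mult_mono) auto
    then show "peak n < 1" by (simp add: peak_def)
  qed
  have na: "norm a = 1 - peak n" unfolding a_def norm_of_real using peak by simp
  have a1: "norm a < 1" using na peak by simp
  obtain C where C: "C > 0" "C < 1 / 32" "ennreal (psi (norm (bump n (phi a)) / C)) \<le> ennreal (1 / (peak n)\<^sup>2)"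
    using pt[OF k a1] g0[OF a1] na by (auto simp: n_def)
  obtain u where u: "phi a = of_real (1 - u)" "0 \<le> u" "u \<le> 3 * gap (Suc n)"
    unfolding a_def by (rule phi_peak)
  define h where "h = 3 * gap (n + 1)"
  have h: "h > 0" using gap_pos[of "n + 1"] by (simp add: h_def)
  have "1 + of_real h - phi a = of_real (h + u)" by (simp add: u)
  then have "norm (1 + of_real h - phi a) = h + u" using h u by (simp only: norm_of_real)
  then have "norm (bump n (phi a)) = knot (n + 2) * (h / (h + u)) ^ 4"
    using knot_pos[of "n + 2"] h unfolding bump_def h_def[symmetric] by (simp add: norm_mult norm_power norm_divide)
  moreover have "(1/2) ^ 4 \<le> (h / (h + u)) ^ 4"
    using h u(2,3) by (intro power_mono) (auto simp: h_def field_simps)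
  ultimately have "knot (n + 2) * (1/2) ^ 4 \<le> norm (bump n (phi a))"
    using knot_pos[of "n + 2"] by simp
  moreover have "2 * knot (n + 2) * C \<le> 2 * knot (n + 2) * (1/32)"
    using C knot_pos[of "n + 2"] by (intro mult_left_mono) auto
  moreover have "2 * knot (n + 2) * (1/32) = knot (n + 2) * (1/2) ^ 4"
    by (simp add: power_divide)
  ultimately have "2 * knot (n + 2) * C \<le> norm (bump n (phi a))" by linarith
  then have "psi2 (n + 2) \<le> psi (norm (bump n (phi a)) / C)"
    unfolding psi2_def using C by (intro psi_mono) (simp add: field_simps)
  also have "\<dots> \<le> 1 / (peak n)\<^sup>2" using C(3) by (simp add: ennreal_le_iff)
  also have "\<dots> = (psi2 (n + 1) * psi1 (n + 2) * 2 ^ n / 8)\<^sup>2"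
    using psi2_pos[of "Suc n"] psi1_ge1[of "Suc (Suc n)"] by (simp add: peak_def gap_def width_def power_divide power_mult_distrib power_one_over)
  also have "\<dots> \<le> (psi1 (n + 2) * psi1 (n + 2) * 2 ^ n)\<^sup>2"
  proof (rule power_mono)
    have "psi2 (n + 1) * (psi1 (n + 2) * 2 ^ n) \<le> psi1 (n + 2) * (psi1 (n + 2) * 2 ^ n)"
      using psi2_le[of "n + 1"] psi1_ge1[of "n + 2"] by (intro mult_right_mono) auto
    moreover have "0 \<le> psi2 (n + 1) * (psi1 (n + 2) * 2 ^ n)"
      using psi2_pos[of "n + 1"] psi1_ge1[of "n + 2"] by simp
    ultimately show "psi2 (n + 1) * psi1 (n + 2) * 2 ^ n / 8 \<le> psi1 (n + 2) * psi1 (n + 2) * 2 ^ n"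
      by (simp add: mult.assoc)
  qed (use psi2_pos[of "n + 1"] psi1_ge1[of "n + 2"] in simp)
  also have "\<dots> = 4 ^ n * psi1 (n + 2) ^ 4"
    by (simp add: power_mult_distrib power_mult[symmetric] power2_eq_square eval_nat_numeral flip: power_mult_distrib)
  also have "\<dots> < 4 ^ (n + 2 + 3) * psi1 (n + 2) ^ 4"
    using psi1_ge1[of "n + 2"] by (intro mult_strict_right_mono power_strict_increasing) auto
  also have "\<dots> \<le> psi2 (n + 2)" by (rule psi2_ge')
  finally show False by simp
qed

section \<open>Compactness on the Hardy-Orlicz space\<close>

text \<open>A radius stays at least half as far from 1 as its endpoint. This permits a majorant that
  depends on the angle alone.\<close>

lemma norm_one_minus_radial:
  assumes "0 \<le> r" "r \<le> 1"
  shows "norm (1 - cis t) \<le> 2 * norm (1 - of_real r * cis t)"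
proof -
  have "1 - cis t = (1 - of_real r * cis t) - of_real (1 - r) * cis t" by (simp add: algebra_simps)
  then have "norm (1 - cis t) \<le> norm (1 - of_real r * cis t) + norm (of_real (1 - r) * cis t)"
    by (metis norm_triangle_ineq4)
  also have "norm (of_real (1 - r) * cis t) = 1 - r"
    using assms by (simp only: norm_mult norm_of_real norm_cis) simp
  also have "1 - r \<le> norm (1 - of_real r * cis t)"
    using norm_triangle_ineq2[of 1 "of_real r * cis t"] assms by (simp add: norm_mult)
  finally show ?thesis by simp
qed

text \<open>The first scale that is resolved along the whole radius to \<open>cis t\<close>; the 2
  compensates the loss in \<open>norm_one_minus_radial\<close>. For \<open>cis t = 1\<close> no
  index qualifies and the value is unspecified, which concerns a null set only.\<close>

definition level :: "real \<Rightarrow> nat" where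
  "level t = (LEAST n. 2 * width n \<le> norm (1 - cis t))"

text \<open>The common majorant, along the radius to \<open>cis t\<close>, of
  \<open>f \<circ> phi\<close> for all \<open>f\<close> in the Hardy-Orlicz unit ball; see
  \<open>hardy_on_image\<close>.\<close>

definition ceil_value :: "real \<Rightarrow> real" where
  "ceil_value t = 2 * knot (level t)"

lemma measurable_level [measurable]: "level \<in> measurable borel (count_space UNIV)"
  unfolding level_def[abs_def] by measurable

lemma measurable_ceil_value [measurable]: "ceil_value \<in> borel_measurable borel"
  unfolding ceil_value_def[abs_def] by measurable

lemma ceil_value_pos: "ceil_value t > 0"
  unfolding ceil_value_def using knot_pos by simp

lemma level:
  assumes "cis t \<noteq> 1"
  shows "2 * width (level t) \<le> norm (1 - cis t)"
proof -
  obtain n where "width n < norm (1 - cis t) / 2"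
    using ex_width_less[of "norm (1 - cis t) / 2"] assms by auto
  then have "2 * width n \<le> norm (1 - cis t)" by simp
  then show ?thesis unfolding level_def by (rule LeastI)
qed

lemma level_Suc: "level t = Suc n \<Longrightarrow> norm (1 - cis t) < 2 * width n"
  using not_less_Least[of n "\<lambda>n. 2 * width n \<le> norm (1 - cis t)"] by (simp add: level_def not_le)

lemma hardy_on_image:
  assumes f: "f \<in> hardy1" and C: "C > 0" "circle_modular psi (boundary f) C \<le> 1"
    and t: "cis t \<noteq> 1" and r: "0 \<le> r" "r \<le> 1"
  shows "norm (f (phi (of_real r * cis t))) \<le> C * ceil_value t"
proof -
  define z where "z = of_real r * cis t"
  have z: "norm z \<le> 1" using r by (simp add: z_def norm_mult)
  have "width (level t) \<le> norm (1 - z)"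
    using level[OF t] norm_one_minus_radial[OF r, of t] by (simp add: z_def)
  from phi_gap[OF z this] have g: "gap (level t) / 4 \<le> 1 - norm (phi z)" .
  have g0: "gap (level t) > 0" by (rule gap_pos)
  have pz: "norm (phi z) < 1" using g g0 by simp
  have "ennreal (psi (norm (f (phi z)) / C)) \<le> ennreal (2 / (1 - norm (phi z))) * circle_modular psi (boundary f) C"
    by (rule hardy1_orlicz_bound[OF orlicz_psi f C(1) pz])
  also have "\<dots> \<le> ennreal (2 / (1 - norm (phi z))) * 1"
    by (intro mult_left_mono C) simp
  finally have "psi (norm (f (phi z)) / C) \<le> 2 / (1 - norm (phi z))"
    using pz by (simp add: ennreal_le_iff)
  also have "\<dots> \<le> 2 / (gap (level t) / 4)"
    using g g0 by (intro divide_left_mono) auto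
  also have "\<dots> = psi (2 * knot (level t))"
    using psi2_pos[of "level t"] by (simp add: gap_def psi2_def)
  finally have "norm (f (phi z)) / C \<le> 2 * knot (level t)" by (rule psi_le_cancel)
  then show ?thesis using C(1) by (simp add: z_def ceil_value_def field_simps)
qed

text \<open>The Poisson kernel at \<open>1 - s\<close> exceeds \<open>1 / (4 s)\<close> on the arc.\<close>
lemma emeasure_arc:
  assumes s: "s > 0"
  shows "emeasure circ {t. norm (1 - cis t) < s} \<le> ennreal (4 * s)"
proof (cases "s < 1")
  case False
  have "emeasure circ {t. norm (1 - cis t) < s} \<le> emeasure circ (space circ)"
    by (rule emeasure_space)
  also have "\<dots> = ennreal 1" by (simp add: emeasure_circ)
  also have "\<dots> \<le> ennreal (4 * s)" using False by (intro ennreal_leI) simp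
  finally show ?thesis .
next
  case True
  define z where "z = complex_of_real (1 - s)"
  have nz: "norm z = 1 - s" unfolding z_def norm_of_real using s True by simp
  have z: "norm z < 1" using nz s by simp
  have [measurable]: "poisson z \<in> borel_measurable borel"
    by (intro borel_measurable_continuous_onI continuous_intros z)
  have pz: "0 \<le> poisson z t" "poisson z t \<le> 2 / (1 - norm z)" for t
    using poisson_le[OF z] z by (auto intro: poisson_nonneg)
  have [measurable]: "{t. norm (1 - cis t) < s} \<in> sets borel"
    by measurable
  have "emeasure circ {t. norm (1 - cis t) < s} = (\<integral>\<^sup>+t. indicator {t. norm (1 - cis t) < s} t \<partial>circ)"
    by (simp add: nn_integral_indicator)
  also have "\<dots> \<le> (\<integral>\<^sup>+t. ennreal (4 * s) * ennreal (poisson z t) \<partial>circ)"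
  proof (intro nn_integral_mono)
    fix t
    show "indicator {t. norm (1 - cis t) < s} t \<le> ennreal (4 * s) * ennreal (poisson z t)"
    proof (cases "norm (1 - cis t) < s")
      case l: True
      have "cis t - z = (cis t - 1) + of_real s" by (simp add: z_def)
      then have "norm (cis t - z) \<le> norm (1 - cis t) + s"
        using norm_triangle_ineq[of "cis t - 1" "of_real s"] s by (simp only: norm_minus_commute[of 1] norm_of_real abs_of_pos)
      also have "\<dots> \<le> 2 * s" using l by simp
      finally have "(norm (cis t - z))\<^sup>2 \<le> (2 * s)\<^sup>2" by (intro power_mono) auto
      moreover have "norm (cis t - z) > 0" using z by (auto simp: norm_cis)
      ultimately have "(1 - (norm z)\<^sup>2) / (2 * s)\<^sup>2 \<le> poisson z t"
        unfolding poisson_def using z by (intro divide_left_mono) (auto simp: abs_square_le_1 intro!: mult_pos_pos)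
      then have "4 * s * ((1 - (norm z)\<^sup>2) / (2 * s)\<^sup>2) \<le> 4 * s * poisson z t"
        using s by (intro mult_left_mono) auto
      moreover have "4 * s * ((1 - (norm z)\<^sup>2) / (2 * s)\<^sup>2) = 2 - s"
        unfolding nz using s by (simp add: power2_eq_square field_simps)
      ultimately have "1 \<le> 4 * s * poisson z t" using True by simp
      then show ?thesis
        using l s pz(1)[of t] by (simp add: ennreal_mult[symmetric] ennreal_leI[of 1, simplified])
    qed simp
  qed
  also have "\<dots> = ennreal (4 * s) * (\<integral>\<^sup>+t. ennreal (poisson z t) \<partial>circ)"
    by (rule nn_integral_cmult) simp
  also have "(\<integral>\<^sup>+t. ennreal (poisson z t) \<partial>circ) = 1"
    by (rule nn_integral_poisson[OF z])
  finally show ?thesis by simp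
qed

lemma measurable_psi_ceil [measurable]:
  assumes "A \<ge> 0"
  shows "(\<lambda>t. psi (A * ceil_value t)) \<in> borel_measurable borel"
  by (rule measurable_orlicz[OF orlicz_psi]) (auto intro!: mult_nonneg_nonneg assms less_imp_le[OF ceil_value_pos])

text \<open>Level \<open>n + 1\<close> occurs only on an arc of measure at most
  \<open>8 * width n\<close>. As soon as \<open>2 * A \<le> n + 3\<close>, the argument
  \<open>A * (2 * knot (n + 1))\<close> is at most \<open>knot (n + 2)\<close>, so the term is at
  most \<open>8 * (1/2) ^ n\<close>. An arbitrary \<open>A\<close> thus affects finitely many terms
  only.\<close>

lemma integral_ceil_finite:
  assumes A: "A \<ge> 0"
  shows "(\<integral>\<^sup>+t. ennreal (psi (A * ceil_value t)) \<partial>circ) < \<infinity>"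
proof -
  define c where "c n = psi (A * (2 * knot n))" for n
  have c0: "c n \<ge> 0" for n
    unfolding c_def using A knot_pos[of n] by (intro orlicz_nonneg[OF orlicz_psi]) auto
  define E where "E n = {t. norm (1 - cis t) < 2 * width n}" for n
  have [measurable]: "E n \<in> sets borel" for n unfolding E_def by measurable
  have "(\<integral>\<^sup>+t. ennreal (psi (A * ceil_value t)) \<partial>circ) \<le> (\<integral>\<^sup>+t. ennreal (c 0) + (\<Sum>n. ennreal (c (Suc n)) * indicator (E n) t) \<partial>circ)"
  proof (intro nn_integral_mono)
    fix t
    show "ennreal (psi (A * ceil_value t)) \<le> ennreal (c 0) + (\<Sum>n. ennreal (c (Suc n)) * indicator (E n) t)"
    proof (cases "level t")
      case 0
      then show ?thesis by (simp add: c_def ceil_value_def)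
    next
      case (Suc n)
      then have "t \<in> E n" using level_Suc[OF Suc] by (simp add: E_def)
      then have "ennreal (psi (A * ceil_value t)) = (\<Sum>k\<in>{n}. ennreal (c (Suc k)) * indicator (E k) t)"
        using Suc by (simp add: c_def ceil_value_def)
      also have "\<dots> \<le> (\<Sum>n. ennreal (c (Suc n)) * indicator (E n) t)"
        by (intro sum_le_suminf summableI) auto
      finally show ?thesis by (rule order.trans) simp
    qed
  qed
  also have "\<dots> = ennreal (c 0) + (\<Sum>n. ennreal (c (Suc n)) * emeasure circ (E n))"
    by (simp add: nn_integral_add nn_integral_suminf nn_integral_cmult_indicator emeasure_circ)
  also have "\<dots> \<le> ennreal (c 0) + (\<Sum>n. ennreal (c (Suc n) * (8 * width n)))"
  proof (intro add_left_mono suminf_le summableI)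
    fix n
    have "emeasure circ (E n) \<le> ennreal (4 * (2 * width n))"
      unfolding E_def by (rule emeasure_arc) (use width_pos[of n] in simp)
    then have "ennreal (c (Suc n)) * emeasure circ (E n) \<le> ennreal (c (Suc n)) * ennreal (8 * width n)"
      by (intro mult_left_mono) auto
    then show "ennreal (c (Suc n)) * emeasure circ (E n) \<le> ennreal (c (Suc n) * (8 * width n))"
      using c0[of "Suc n"] width_pos[of n] by (simp add: ennreal_mult)
  qed
  also have "\<dots> < \<infinity>"
  proof -
    obtain n0 :: nat where n0: "2 * A \<le> real n0" using real_arch_simple by blast
    have "summable (\<lambda>n. c (Suc n) * (8 * width n))"
    proof (rule summable_comparison_test'[where g = "\<lambda>n. 8 * (1/2) ^ n" and N = n0])
      show "summable (\<lambda>n. 8 * (1/2::real) ^ n)" by (intro summable_mult summable_geometric) simp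
      fix n assume n: "n \<ge> n0"
      have "A * (2 * knot (Suc n)) = (2 * A) * knot (Suc n)" by simp
      also have "\<dots> \<le> (real (Suc n) + 2) * knot (Suc n)"
        using n n0 knot_pos[of "Suc n"] by (intro mult_right_mono) auto
      also have "\<dots> = knot (n + 2)" using knot_Suc[of "Suc n"] by simp
      finally have "c (Suc n) \<le> psi1 (n + 2)" unfolding c_def psi1_def by (rule psi_mono)
      then have "c (Suc n) * width n \<le> psi1 (n + 2) * width n" using width_pos[of n] by (intro mult_right_mono) auto
      also have "\<dots> = (1/2) ^ n" using psi1_ge1[of "n + 2"] by (simp add: width_def)
      finally show "norm (c (Suc n) * (8 * width n)) \<le> 8 * (1/2) ^ n"
        using c0[of "Suc n"] width_pos[of n] by (simp add: abs_mult)
    qed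
    then have "(\<Sum>n. ennreal (c (Suc n) * (8 * width n))) = ennreal (\<Sum>n. c (Suc n) * (8 * width n))"
      by (intro suminf_ennreal2) (auto intro!: mult_nonneg_nonneg c0 less_imp_le[OF width_pos])
    then show ?thesis by simp
  qed
  finally show ?thesis .
qed

lemma AE_circ_cis: "AE t in circ. cis t \<noteq> 1"
proof (subst AE_circ_iff)
  have "{t::real. cis t = 1} \<subseteq> range (\<lambda>n::int. of_int n * 2 * pi)"
    using cos_one_2pi_int by (auto simp: complex_eq_iff)
  then have "countable {t::real. cis t = 1}"
    by (rule countable_subset) simp
  then have "{t::real. cis t = 1} \<in> null_sets lborel"
    by (rule countable_imp_null_set_lborel)
  from AE_not_in[OF this] show "AE t in lborel. t \<in> {0..2*pi} \<longrightarrow> cis t \<noteq> 1"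
    by eventually_elim auto
qed

text \<open>A Borel version of the boundary values of \<open>H \<circ> phi\<close>. At
  \<open>cis t = 1\<close> the symbol takes the value 1, where \<open>H\<close> is not controlled,
  so a default 0 is used.\<close>

definition on_arc :: "(complex \<Rightarrow> complex) \<Rightarrow> real \<Rightarrow> complex" where
  "on_arc H t = (if cis t = 1 then 0 else H (phi (cis t)))"

lemma measurable_on_arc:
  assumes H: "H holomorphic_on ball 0 1"
  shows "on_arc H \<in> borel_measurable borel"
  unfolding on_arc_def[abs_def]
proof -
  have "(\<lambda>t. if t \<in> {t. cis t = 1} then 0 else H (phi (cis t))) \<in> borel_measurable borel"
  proof (rule borel_measurable_continuous_on_if)
    show "{t. cis t = 1} \<in> sets borel" by measurable
    show "continuous_on (- {t. cis t = 1}) (\<lambda>t. H (phi (cis t)))"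
    proof (rule continuous_on_compose2[OF holomorphic_on_imp_continuous_on[OF H]])
      show "continuous_on (- {t. cis t = 1}) (\<lambda>t. phi (cis t))"
        by (rule continuous_on_compose2[OF continuous_phi]) (auto intro!: continuous_intros)
    qed (auto intro!: norm_phi_less_1)
  qed simp
  then show "(\<lambda>t. if cis t = 1 then 0 else H (phi (cis t))) \<in> borel_measurable borel" by simp
qed

lemma boundary_comp_phi:
  assumes H: "H holomorphic_on ball 0 1" and t: "cis t \<noteq> 1"
  shows "boundary (\<lambda>z. H (phi z)) (cis t) = H (phi (cis t))"
proof -
  have "((\<lambda>r. of_real r * cis t) \<longlongrightarrow> of_real 1 * cis t) (at_left (1::real))"
    by (intro tendsto_intros)
  moreover have "eventually (\<lambda>r. of_real r * cis t \<in> cball 0 1) (at_left (1::real))"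
    by (rule eventually_at_leftI[of 0]) (auto simp: norm_mult)
  ultimately have "((\<lambda>r. phi (of_real r * cis t)) \<longlongrightarrow> phi (cis t)) (at_left (1::real))"
    using continuous_on_tendsto_compose[OF continuous_phi] by (fastforce simp: norm_cis)
  moreover have "isCont H (phi (cis t))"
    using holomorphic_on_imp_continuous_on[OF H] norm_phi_less_1[of "cis t"] t by (simp add: continuous_on_eq_continuous_at)
  ultimately have "((\<lambda>r. H (phi (of_real r * cis t))) \<longlongrightarrow> H (phi (cis t))) (at_left (1::real))"
    by (rule isCont_tendsto_compose[rotated])
  then show ?thesis unfolding boundary_def by (intro tendsto_Lim) auto
qed

lemma circle_modular_comp_phi:
  assumes H: "H holomorphic_on ball 0 1" and C: "C > 0"
  shows "circle_modular psi (boundary (\<lambda>z. H (phi z))) C = (\<integral>\<^sup>+t. ennreal (psi (norm (on_arc H t) / C)) \<partial>circ)"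
proof (rule circle_modular_eq[OF orlicz_psi measurable_on_arc[OF H] _ C])
  show "AE t in circ. boundary (\<lambda>z. H (phi z)) (cis t) = on_arc H t"
    using AE_circ_cis by eventually_elim (simp add: boundary_comp_phi[OF H] on_arc_def)
qed

lemma hardy_orlicz_modular_le_1:
  assumes f: "f \<in> hardy_orlicz psi" and M: "hardy_orlicz_norm psi f < M"
  shows "circle_modular psi (boundary f) M \<le> 1"
proof -
  have f1: "f \<in> hardy1" using f by (simp add: hardy_orlicz_def)
  obtain u where [measurable]: "u \<in> borel_measurable borel" and bd: "AE t in circ. boundary f (cis t) = u t"
    using hardy1_representation[OF f1] by metis
  note eq = circle_modular_eq[OF orlicz_psi \<open>u \<in> borel_measurable borel\<close> bd]
  obtain C1 where "C1 > 0" "circle_modular psi (boundary f) C1 < \<infinity>" using f by (auto simp: hardy_orlicz_def)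
  then obtain C0 where "C0 > 0" "circle_modular psi (boundary f) C0 \<le> 1"
    using ex_orlicz_integral_le_1[OF orlicz_psi, of "\<lambda>t. norm (u t)" circ C1] by (auto simp: eq)
  from orlicz_norm_lessD[where M = "circle_modular psi" and f = "boundary f", OF M[unfolded hardy_orlicz_norm_def] this]
  obtain C where C: "C > 0" "C < M" "circle_modular psi (boundary f) C \<le> 1" by blast
  have "circle_modular psi (boundary f) M \<le> circle_modular psi (boundary f) C"
    unfolding circle_modular_def using C
    by (intro mult_left_mono nn_integral_mono mult_right_mono ennreal_leI psi_mono divide_left_mono) auto
  with C show ?thesis by simp
qed

lemma compact_hardy:
  "compact_comp_op (hardy_orlicz psi) (hardy_orlicz_norm psi) (\<lambda>f. f \<circ> phi)"
  unfolding compact_comp_op_def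
proof (intro allI impI)
  fix F :: "nat \<Rightarrow> complex \<Rightarrow> complex" and M0 :: real
  assume F: "\<forall>n. F n \<in> hardy_orlicz psi \<and> hardy_orlicz_norm psi (F n) \<le> M0"
  \<comment> \<open>The added 1 makes \<open>M\<close> positive whatever \<open>M0\<close> is, and
    strictly larger than the norms, as \<open>hardy_orlicz_modular_le_1\<close> requires.\<close>
  define M where "M = \<bar>M0\<bar> + 1"
  have M: "M > 0" by (simp add: M_def)
  have F1: "F n \<in> hardy1" for n using F by (simp add: hardy_orlicz_def)
  have Fhol: "F n holomorphic_on ball 0 1" for n using F1[of n] by (simp add: hardy1_def)
  have FM: "circle_modular psi (boundary (F n)) M \<le> 1" for n
    by (rule hardy_orlicz_modular_le_1) (use F[rule_format, of n] in \<open>auto simp: M_def\<close>)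
  have Fb: "norm (F n z) \<le> M * (2 / (1 - norm z))" if z: "norm z < 1" for n z
  proof -
    have "ennreal (psi (norm (F n z) / M)) \<le> ennreal (2 / (1 - norm z)) * circle_modular psi (boundary (F n)) M"
      by (rule hardy1_orlicz_bound[OF orlicz_psi F1 M z])
    also have "\<dots> \<le> ennreal (2 / (1 - norm z)) * 1"
      by (intro mult_left_mono FM) simp
    finally have "psi (norm (F n z) / M) \<le> 2 / (1 - norm z)"
      using z by (simp add: ennreal_le_iff)
    moreover have "norm (F n z) / M \<le> psi (norm (F n z) / M)" using M by (intro psi_ge) simp
    ultimately have "norm (F n z) / M \<le> 2 / (1 - norm z)" by simp
    then show ?thesis using M by (simp add: field_simps)
  qed
  obtain G and r :: "nat \<Rightarrow> nat" where G: "G holomorphic_on ball 0 1" "strict_mono r" "\<And>z. z \<in> ball 0 1 \<Longrightarrow> (\<lambda>n. F (r n) z) \<longlonglongrightarrow> G z"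
  proof (rule Montel[of "ball 0 1" "range F" F])
    show "\<exists>B. \<forall>h\<in>range F. \<forall>z\<in>K. norm (h z) \<le> B" if K: "compact K" "K \<subseteq> ball 0 1" for K
    proof (cases "K = {}")
      case False
      obtain x where x: "x \<in> K" "\<forall>y\<in>K. norm y \<le> norm x"
        using continuous_attains_sup[OF K(1) False, of norm] by (auto intro: continuous_intros)
      then have x1: "norm x < 1" using K by auto
      have "norm (F n z) \<le> M * (2 / (1 - norm x))" if "z \<in> K" for n z
      proof -
        have z: "norm z \<le> norm x" using x that by auto
        have "norm (F n z) \<le> M * (2 / (1 - norm z))" by (rule Fb) (use z x1 in simp)
        also have "\<dots> \<le> M * (2 / (1 - norm x))"
          using z x1 M by (intro mult_left_mono divide_left_mono) auto
        finally show ?thesis .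
      qed
      then show ?thesis by blast
    qed simp
  qed (use Fhol in auto)
  have bound: "norm (F n (phi (of_real s * cis t))) \<le> M * ceil_value t" if "cis t \<noteq> 1" "0 \<le> s" "s \<le> 1" for n t s
    by (rule hardy_on_image[OF F1 M FM that])
  have lim: "(\<lambda>n. F (r n) (phi (of_real s * cis t))) \<longlonglongrightarrow> G (phi (of_real s * cis t))" if "cis t \<noteq> 1" "0 \<le> s" "s \<le> 1" for t s
  proof (rule G(3))
    have "of_real s * cis t \<noteq> 1"
    proof
      assume e: "of_real s * cis t = 1"
      then have "norm (of_real s * cis t) = 1" by simp
      then have "s = 1" using that by (simp add: norm_mult)
      with e that show False by simp
    qed
    then show "phi (of_real s * cis t) \<in> ball 0 1"
      using norm_phi_less_1[of "of_real s * cis t"] that by (simp add: norm_mult)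
  qed
  have Gbound: "norm (G (phi (of_real s * cis t))) \<le> M * ceil_value t" if "cis t \<noteq> 1" "0 \<le> s" "s \<le> 1" for t s
    by (rule LIMSEQ_le_const2[OF tendsto_norm[OF lim[OF that]]]) (use bound[OF that] in auto)
  have comp_hol: "(\<lambda>z. G (phi z)) holomorphic_on ball 0 1"
    using analytic_selfmap_phi unfolding analytic_selfmap_def
    by (intro holomorphic_on_compose_gen[OF _ G(1), unfolded o_def]) auto
  \<comment> \<open>Compactness asks for a limit of the images in the space, so membership is shown
    for the composite. Its means over all circles are bounded by one integral, because the majorant
    depends on the angle only.\<close>
  have "(\<lambda>z. G (phi z)) \<in> hardy1"
    unfolding hardy1_def
  proof (intro CollectI conjI comp_hol exI allI impI)
    let ?B = "\<integral>\<^sup>+t\<in>{0..2*pi}. ennreal (M * ceil_value t) \<partial>lborel"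
    have "(\<integral>\<^sup>+t. ennreal (M * ceil_value t) \<partial>circ) \<le> (\<integral>\<^sup>+t. ennreal (psi (M * ceil_value t)) \<partial>circ)"
      using M ceil_value_pos by (intro nn_integral_mono ennreal_leI psi_ge) (auto simp: less_imp_le)
    also have "\<dots> < \<infinity>" using M by (intro integral_ceil_finite) simp
    finally have "ennreal (1 / (2 * pi)) * ?B < \<infinity>" by (simp add: nn_integral_circ)
    then show "?B < \<infinity>"
      by (auto simp: ennreal_mult_less_top)
    fix s :: real assume s: "0 < s \<and> s < 1"
    have "AE t in lborel. t \<in> {0..2*pi} \<longrightarrow> cis t \<noteq> 1" using AE_circ_cis by (simp add: AE_circ_iff)
    then show "(\<integral>\<^sup>+t\<in>{0..2*pi}. ennreal (norm (G (phi (of_real s * cis t)))) \<partial>lborel) \<le> ?B"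
      by (intro nn_integral_mono_AE, elim eventually_mono)
         (use Gbound s in \<open>auto simp: indicator_def intro!: ennreal_leI\<close>)
  qed
  moreover have "circle_modular psi (boundary (\<lambda>z. G (phi z))) M < \<infinity>"
  proof -
    have "circle_modular psi (boundary (\<lambda>z. G (phi z))) M = (\<integral>\<^sup>+t. ennreal (psi (norm (on_arc G t) / M)) \<partial>circ)"
      by (rule circle_modular_comp_phi[OF G(1) M])
    also have "\<dots> \<le> (\<integral>\<^sup>+t. ennreal (psi (1 * ceil_value t)) \<partial>circ)"
    proof (rule nn_integral_mono)
      fix t
      have "norm (on_arc G t) \<le> M * ceil_value t"
        using Gbound[of t 1] M ceil_value_pos[of t] by (auto simp: on_arc_def)
      then show "ennreal (psi (norm (on_arc G t) / M)) \<le> ennreal (psi (1 * ceil_value t))"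
        using M by (intro ennreal_leI psi_mono) (simp add: field_simps)
    qed
    also have "\<dots> < \<infinity>" by (rule integral_ceil_finite) simp
    finally show ?thesis .
  qed
  ultimately have Gin: "(\<lambda>z. G (phi z)) \<in> hardy_orlicz psi"
    using M by (auto simp: hardy_orlicz_def)
  define D where "D k z = F (r k) z - G z" for k z
  have Dhol: "D k holomorphic_on ball 0 1" for k
    unfolding D_def by (intro holomorphic_intros Fhol G(1))
  have norm_D: "hardy_orlicz_norm psi (\<lambda>z. (F (r k) \<circ> phi) z - G (phi z)) = orlicz_norm (circle_modular psi) (boundary (\<lambda>z. D k (phi z)))" for k
    by (simp add: hardy_orlicz_norm_def D_def)
  have small: "eventually (\<lambda>k. circle_modular psi (boundary (\<lambda>z. D k (phi z))) e \<le> 1) sequentially" if e: "e > 0" for e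
  proof -
    have [measurable]: "on_arc (D k) \<in> borel_measurable borel" for k by (rule measurable_on_arc[OF Dhol])
    have [measurable]: "(\<lambda>t. psi (norm (on_arc (D k) t) / e)) \<in> borel_measurable borel" for k
      by (rule measurable_orlicz[OF orlicz_psi]) (use e in auto)
    \<comment> \<open>Both \<open>F (r k)\<close> and \<open>G\<close> obey the bound
      \<open>M * ceil_value t\<close> on the image, and their difference is divided by
      \<open>e\<close>. As \<open>e\<close> is arbitrary, the majorant has to be integrable for
      every \<open>A\<close>.\<close>
    define A where "A = 2 * M / e"
    have A: "A \<ge> 0" using M e by (simp add: A_def)
    note [measurable] = measurable_psi_ceil[OF A]
    have "(\<lambda>k. \<integral>\<^sup>+t. ennreal (psi (norm (on_arc (D k) t) / e)) \<partial>circ) \<longlonglongrightarrow> (\<integral>\<^sup>+t. 0 \<partial>circ)"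
    proof (rule nn_integral_dominated_convergence[where w = "\<lambda>t. ennreal (psi (A * ceil_value t))"])
      show "(\<integral>\<^sup>+t. ennreal (psi (A * ceil_value t)) \<partial>circ) < \<infinity>" by (rule integral_ceil_finite[OF A])
      show "AE t in circ. ennreal (psi (norm (on_arc (D k) t) / e)) \<le> ennreal (psi (A * ceil_value t))" for k
        using AE_circ_cis
      proof eventually_elim
        case (elim t)
        have "norm (on_arc (D k) t) \<le> norm (F (r k) (phi (cis t))) + norm (G (phi (cis t)))"
          using elim by (simp add: on_arc_def D_def norm_triangle_ineq4)
        also have "\<dots> \<le> M * ceil_value t + M * ceil_value t"
          using bound[OF elim, of 1 "r k"] Gbound[OF elim, of 1] by (intro add_mono) auto
        finally have "norm (on_arc (D k) t) / e \<le> A * ceil_value t"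
          using e by (simp add: A_def field_simps)
        then show ?case by (intro ennreal_leI psi_mono)
      qed
      show "AE t in circ. (\<lambda>k. ennreal (psi (norm (on_arc (D k) t) / e))) \<longlonglongrightarrow> 0"
        using AE_circ_cis
      proof eventually_elim
        case (elim t)
        have "(\<lambda>k. F (r k) (phi (cis t)) - G (phi (cis t))) \<longlonglongrightarrow> 0"
          using lim[OF elim, of 1] by (simp add: LIM_zero)
        then have "(\<lambda>k. on_arc (D k) t) \<longlonglongrightarrow> 0" using elim by (simp add: on_arc_def D_def)
        then have l: "(\<lambda>k. norm (on_arc (D k) t) / e) \<longlonglongrightarrow> 0"
          using tendsto_divide[OF tendsto_norm tendsto_const[of e]] e by fastforce
        \<comment> \<open>On \<open>[0, 1]\<close> the function \<open>psi\<close> is the identity,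
          so arguments tending to 0 give modular integrands tending to 0 at once.\<close>
        have "eventually (\<lambda>k. norm (on_arc (D k) t) / e < 1) sequentially"
          by (rule order_tendstoD[OF l]) simp
        then have "eventually (\<lambda>k. norm (on_arc (D k) t) / e = psi (norm (on_arc (D k) t) / e)) sequentially"
          by eventually_elim (simp add: psi_id)
        with l have "(\<lambda>k. psi (norm (on_arc (D k) t) / e)) \<longlonglongrightarrow> 0"
          by (rule Lim_transform_eventually)
        then have "(\<lambda>k. ennreal (psi (norm (on_arc (D k) t) / e))) \<longlonglongrightarrow> ennreal 0"
          by (intro tendsto_intros)
        then show ?case by simp
      qed
    qed auto
    then have "eventually (\<lambda>k. (\<integral>\<^sup>+t. ennreal (psi (norm (on_arc (D k) t) / e)) \<partial>circ) < 1) sequentially"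
      by (intro order_tendstoD) auto
    then show ?thesis
      by eventually_elim (simp add: circle_modular_comp_phi[OF Dhol e])
  qed
  have "(\<lambda>k. hardy_orlicz_norm psi (\<lambda>z. (F (r k) \<circ> phi) z - G (phi z))) \<longlonglongrightarrow> 0"
  proof (rule tendstoI)
    fix e :: real assume e: "e > 0"
    have "eventually (\<lambda>k. circle_modular psi (boundary (\<lambda>z. D k (phi z))) (e/2) \<le> 1) sequentially"
      by (rule small) (use e in simp)
    then show "eventually (\<lambda>k. dist (hardy_orlicz_norm psi (\<lambda>z. (F (r k) \<circ> phi) z - G (phi z))) 0 < e) sequentially"
    proof eventually_elim
      case (elim k)
      then show ?case
        using orlicz_norm_le[of "e/2" "circle_modular psi", OF _ elim] orlicz_norm_nonneg[of "e/2" "circle_modular psi", OF _ elim] e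
        unfolding norm_D by simp
    qed
  qed
  then show "\<exists>r g. strict_mono r \<and> g \<in> hardy_orlicz psi \<and> (\<lambda>k. hardy_orlicz_norm psi (\<lambda>z. (F (r k) \<circ> phi) z - g z)) \<longlonglongrightarrow> 0"
    using G(2) Gin by blast
qed

theorem theorem4p2:
  shows "\<exists>(\<phi>::complex \<Rightarrow> complex) (\<Psi>::real \<Rightarrow> real).
           analytic_selfmap \<phi> \<and> orlicz_function \<Psi> \<and>
           compact_comp_op (hardy_orlicz \<Psi>) (hardy_orlicz_norm \<Psi>) (\<lambda>f. f \<circ> \<phi>) \<and>
           \<not> compact_comp_op (bergman_orlicz \<Psi>) (bergman_orlicz_norm \<Psi>) (\<lambda>f. f \<circ> \<phi>)"
  using analytic_selfmap_phi orlicz_psi compact_hardy not_compact_bergman by blast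

end
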